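(* Let $k \ge 7$ be an odd integer and let $\chi$ be a nonprincipal, real, primitive, odd Dirichlet character modulo $k$. Then \begin{align*} \sum_{ j=1 }^{ k-1 } \chi(j) \sin^2 \left( \frac{ \pi j }{ k } \right) \tan \left( \frac{ 2 \pi j }{ k } \right) &= \sqrt k \left( - \frac 1 2 + \left( \chi(2) - 2 \right) h(-k) \right) \\ &= \begin{cases} \sqrt k \left( - \frac 1 2 - 3 \, h(-k) \right) & \text{ if } k \equiv 3 \bmod 8 , \\ \sqrt k \left( - \frac 1 2 - h(-k) \right) & \text{ if } k \equiv 7 \bmod 8 , \end{cases} \end{align*} where $h(-k)$ is the class number of the imaginary quadratic field $\mathbb{Q}(\sqrt{-k})$.
   Context: A Dirichlet character modulo $k$ is a nonzero completely multiplicative $k$-periodic function $\chi:\mathbb{Z}\to\mathbb{C}$ with $\chi(n)=0$ whenever $\gcd(n,k)>1$; it is real if it takes only real values, odd if $\chi(-n)=-\chi(n)$, and primitive if it is not induced by a character modulo a proper divisor of $k$. $h(-k)$ denotes the class number of $\mathbb{Q}(\sqrt{-k})$. *)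

theory Defs
  imports
    Complex_Main
    "HOL-Computational_Algebra.Polynomial"
    "HOL-Algebra.Ideal"
begin

definition dirichlet_character :: "int \<Rightarrow> (int \<Rightarrow> complex) \<Rightarrow> bool" where
  "dirichlet_character k \<chi> \<longleftrightarrow>
     k > 0 \<and>
     (\<exists>n. \<chi> n \<noteq> 0) \<and>
     (\<forall>m n. \<chi> (m * n) = \<chi> m * \<chi> n) \<and>
     (\<forall>n. \<chi> (n + k) = \<chi> n) \<and>
     (\<forall>n. gcd n k > 1 \<longrightarrow> \<chi> n = 0)"

definition principal_character :: "int \<Rightarrow> (int \<Rightarrow> complex) \<Rightarrow> bool" where
  "principal_character k \<chi> \<longleftrightarrow>
     dirichlet_character k \<chi> \<and> (\<forall>n. coprime n k \<longrightarrow> \<chi> n = 1)"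

definition real_character :: "(int \<Rightarrow> complex) \<Rightarrow> bool" where
  "real_character \<chi> \<longleftrightarrow> (\<forall>n. \<chi> n \<in> \<real>)"

definition odd_character :: "(int \<Rightarrow> complex) \<Rightarrow> bool" where
  "odd_character \<chi> \<longleftrightarrow> (\<forall>n. \<chi> (- n) = - \<chi> n)"

(* \<chi> is the product of \<psi> and the principal character modulo k. *)
definition induced_by :: "int \<Rightarrow> (int \<Rightarrow> complex) \<Rightarrow> int \<Rightarrow> (int \<Rightarrow> complex) \<Rightarrow> bool" where
  "induced_by k \<chi> d \<psi> \<longleftrightarrow>
     dirichlet_character k \<chi> \<and> dirichlet_character d \<psi> \<and> d dvd k \<and>
     (\<forall>n. coprime n k \<longrightarrow> \<chi> n = \<psi> n)"

definition primitive_character :: "int \<Rightarrow> (int \<Rightarrow> complex) \<Rightarrow> bool" where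
  "primitive_character k \<chi> \<longleftrightarrow>
     dirichlet_character k \<chi> \<and> \<not> (\<exists>d \<psi>. d < k \<and> induced_by k \<chi> d \<psi>)"

definition nonzero_ideals :: "('a, 'b) ring_scheme \<Rightarrow> 'a set set" where
  "nonzero_ideals R = {I. ideal I R \<and> I \<noteq> {\<zero>\<^bsub>R\<^esub>}}"

(* The ideal class group of an integral domain, represented by nonzero integral ideals:
   I and J are in the same class iff a I = b J for some nonzero a and b, that is, iff they
   differ by a principal fractional ideal.  Every fractional ideal is a scalar multiple
   of an integral one, so every ideal class is represented. *)
definition ideal_class_rel :: "('a, 'b) ring_scheme \<Rightarrow> ('a set \<times> 'a set) set" where
  "ideal_class_rel R =
     {(I, J). I \<in> nonzero_ideals R \<and> J \<in> nonzero_ideals R \<and>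
        (\<exists>a \<in> carrier R - {\<zero>\<^bsub>R\<^esub>}. \<exists>b \<in> carrier R - {\<zero>\<^bsub>R\<^esub>}.
           a <#\<^bsub>R\<^esub> I = b <#\<^bsub>R\<^esub> J)}"

definition class_number :: "('a, 'b) ring_scheme \<Rightarrow> nat" where
  "class_number R = card (nonzero_ideals R // ideal_class_rel R)"

definition quadratic_field :: "int \<Rightarrow> complex set" where
  "quadratic_field d = {x + y * csqrt (of_int d) | x y. x \<in> \<rat> \<and> y \<in> \<rat>}"

definition quadratic_integers :: "int \<Rightarrow> complex ring" where
  "quadratic_integers d =
     \<lparr>carrier = {z \<in> quadratic_field d. algebraic_int z},
      mult = (*), one = 1, zero = 0, add = (+)\<rparr>"

(* The class number of the field Q(sqrt d), written h(d) when d is its discriminant. *)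
definition quadratic_class_number :: "int \<Rightarrow> nat" where
  "quadratic_class_number d = class_number (quadratic_integers d)"

end

theory Submission
  imports
    Defs
    "HOL-Probability.Probability"
    "HOL-Real_Asymp.Real_Asymp"
    "HOL-Computational_Algebra.Squarefree"
    "HOL-Number_Theory.Number_Theory"
begin

text \<open>
  Write \<open>tan t = cot t - 2 cot 2t\<close>. Substituting \<open>j \<mapsto> 2j\<close> and \<open>j \<mapsto> 4j\<close> modulo \<open>k\<close> turns the sum into
  \<open>((\<chi>(2) - 2) C - S) / 2\<close> with \<open>C = \<Sum> \<chi>(j) cot(\<pi>j/k)\<close> and \<open>S = \<Sum> \<chi>(j) sin(2\<pi>j/k)\<close>.

  That \<open>S = \<surd>k\<close> is the sign of the Gauss sum. A real primitive character of odd modulus is a product of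
  Legendre symbols for the distinct primes dividing \<open>k\<close>, so its Gauss sum is \<open>\<Sum> e(n\<^sup>2/k)\<close>, which has modulus
  \<open>\<surd>k\<close> and is purely imaginary; the sign follows from a lower bound \<open>> -\<surd>k\<close> for its imaginary part, obtained
  by keeping the terms near the stationary point and summing the others by parts.

  That \<open>C = 2 \<surd>k h(-k)\<close> is Dirichlet's class number formula. Let \<open>r(n)\<close> be the number of ideals of norm \<open>n\<close> in
  the ring of integers. Counting ideals in normal form \<open>c (a \<int> + (x + \<omega>) \<int>)\<close> and quadratic reciprocity give
  \<open>r(n) = \<Sum>\<^bsub>d | n\<^esub> \<chi>(d)\<close>, so that \<open>s \<Sum> r(n) exp(-sn)\<close> is a Lambert series, which tends to
  \<open>L(1, \<chi>) = \<pi> C / (2k)\<close> as \<open>s\<close> tends to 0 by the partial fractions of the cotangent. Within a single ideal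
  class the same sum is half a theta series of a binary quadratic form of discriminant \<open>-k\<close> and tends to
  \<open>\<pi> / \<surd>k\<close>. Comparing the two shows that there are finitely many classes and that \<open>h(-k) \<pi> / \<surd>k = \<pi> C / (2k)\<close>.
\<close>

(* vec_syntax turns \<chi> into a binder *)
unbundle no vec_syntax

section \<open>Real primitive characters\<close>

text \<open>The weights exp(-s n) keep all series absolutely convergent, and each limit at s = 0
  rests on an explicit bound: an integral test with error O(sqrt s) for the theta series, a majorant
  of order 1/m^2 that is uniform in s for the Lambert series. \<open>class_number\<close> is a
  \<open>card\<close>, which is 0 on an infinite set, so finiteness of the class group is part of
  the formula: all classes contribute the same positive limit, and any finitely many of them
  contribute at most L(1, \<chi>). Character and field meet at the primes q. The value \<chi>(q) is
  a product of symbols (q/p) over the primes p dividing k, whereas x^2 + x + N, of discriminant -k,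
  has 1 + (-k/q) roots modulo an odd q; reciprocity identifies the two symbols. Ideals are treated
  as lattices with explicit bases and their norms as covolumes. The bound k >= 7 excludes k = 3,
  where six units instead of two would change the factor one half in the count within a
  class.\<close>

lemma Legendre_cong: "[a = b] (mod p) \<Longrightarrow> Legendre a p = Legendre b p"
  by (simp add: Legendre_def QuadRes_def cong_def)

lemma Legendre_values: "Legendre a p \<in> {-1, 0, 1}"
  by (auto simp: Legendre_def)

lemma Legendre_eq_0_iff: "Legendre a p = 0 \<longleftrightarrow> p dvd a"
  by (auto simp: Legendre_def cong_0_iff)

text \<open>Two such values differ by at most 2, which is less than p. This turns the congruences of
  Euler's criterion into equalities.\<close>

lemma signs_eq_if_cong:
  fixes p x y :: int
  assumes "p > 2" "x \<in> {-1,0,1}" "y \<in> {-1,0,1}" "[x = y] (mod p)"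
  shows "x = y"
proof (rule ccontr)
  assume "x \<noteq> y"
  have "p dvd x - y" using assms(4) by (simp add: cong_iff_dvd_diff)
  hence "p \<le> \<bar>x - y\<bar>" using dvd_imp_le_int[of "x - y" p] \<open>x \<noteq> y\<close> by simp
  thus False using assms by auto
qed

lemma euler_criterion_int:
  fixes p :: int
  assumes "prime p" "p > 2"
  shows "[Legendre a p = a ^ nat ((p - 1) div 2)] (mod p)"
proof -
  have "prime (nat p)" "2 < nat p" using assms by auto
  from euler_criterion[OF this, of a] have "[Legendre a p = a ^ ((nat p - 1) div 2)] (mod p)"
    using assms by simp
  moreover have "(nat p - 1) div 2 = nat ((p - 1) div 2)"
    using assms by (simp add: nat_div_distrib nat_diff_distrib)
  ultimately show ?thesis by simp
qed

lemma Legendre_mult: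
  fixes p :: int
  assumes "prime p" "p > 2"
  shows "Legendre (a * b) p = Legendre a p * Legendre b p"
proof (rule signs_eq_if_cong[OF assms(2)])
  show "Legendre a p * Legendre b p \<in> {-1,0,1}"
    using Legendre_values[of a p] Legendre_values[of b p] by auto
  have "[Legendre (a * b) p = (a * b) ^ nat ((p - 1) div 2)] (mod p)"
    by (rule euler_criterion_int[OF assms])
  moreover have "[Legendre a p * Legendre b p = a ^ nat ((p - 1) div 2) * b ^ nat ((p - 1) div 2)] (mod p)"
    by (intro cong_mult euler_criterion_int[OF assms])
  ultimately show "[Legendre (a * b) p = Legendre a p * Legendre b p] (mod p)"
    by (metis cong_sym cong_trans power_mult_distrib)
qed (rule Legendre_values)

lemma Legendre_minus_one:
  fixes p :: int
  assumes "prime p" "p > 2"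
  shows "Legendre (- 1) p = (- 1) ^ nat ((p - 1) div 2)"
  by (rule signs_eq_if_cong[OF assms(2) Legendre_values _ euler_criterion_int[OF assms]])
     (use neg_one_even_power neg_one_odd_power in blast)

text \<open>Gauss's lemma with multiplier 2: among the doubled residues 2x with 0 < x <= h, those
  above h = (p - 1) / 2 are the ones with x > h div 2, so the sign is the parity of h - h div
  2.\<close>

lemma Legendre_two:
  fixes p :: int
  assumes "prime p" "p > 2"
  shows "Legendre 2 p = (if p mod 8 = 1 \<or> p mod 8 = 7 then 1 else - 1)"
proof -
  define h where "h = (p - 1) div 2"
  have podd: "odd p" using assms prime_odd_int by auto
  have ph: "p = 2 * h + 1" using podd by (auto simp: h_def)
  interpret G: GAUSS "nat p" 2
  proof
    show "[2 \<noteq> 0] (mod int (nat p))"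
      using assms zdvd_imp_le[of p 2] by (auto simp: cong_0_iff)
  qed (use assms in auto)
  have hp: "h > 0" using assms ph by linarith
  have C: "G.C = (\<lambda>x. x * 2) ` {0<..h}"
  proof -
    have "G.C = (\<lambda>x. (x * 2) mod p) ` {0<..h}"
      using assms by (simp add: G.C_def G.B_def G.A_def h_def image_image)
    also have "\<dots> = (\<lambda>x. x * 2) ` {0<..h}"
      by (intro image_cong refl mod_pos_pos_trivial) (auto simp: ph)
    finally show ?thesis .
  qed
  have E: "G.E = (\<lambda>x. x * 2) ` {h div 2<..h}"
  proof -
    have "G.E = (\<lambda>x. x * 2) ` {0<..h} \<inter> {h<..}"
      using assms C by (simp add: G.E_def h_def)
    also have "\<dots> = (\<lambda>x. x * 2) ` {h div 2<..h}"
      using hp by (auto simp: image_iff)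
    finally show ?thesis .
  qed
  have "card G.E = nat (h - h div 2)"
    unfolding E by (subst card_image) (auto simp: inj_on_def)
  hence L: "Legendre 2 p = (- 1) ^ nat (h - h div 2)"
    using G.gauss_lemma assms by simp
  have ev: "even (nat (h - h div 2)) \<longleftrightarrow> even (h - h div 2)"
    using hp by (subst even_nat_iff) auto
  have "even (h - h div 2) \<longleftrightarrow> (p mod 8 = 1 \<or> p mod 8 = 7)"
    unfolding ph by presburger
  thus ?thesis using L ev by (auto simp: minus_one_power_iff)
qed

text \<open>Roots come in pairs y, p - y, distinct because p is odd, and collapse to the single root
  0 when p divides j.\<close>

lemma card_square_roots:
  fixes p :: int
  assumes p: "prime p" "p > 2"
  shows "int (card {y\<in>{0..<p}. y\<^sup>2 mod p = j mod p}) = 1 + Legendre j p"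
proof (cases "p dvd j")
  case True
  have "{y\<in>{0..<p}. y\<^sup>2 mod p = j mod p} = {0}"
  proof (intro equalityI subsetI)
    fix y assume "y \<in> {y\<in>{0..<p}. y\<^sup>2 mod p = j mod p}"
    hence y: "y \<in> {0..<p}" "p dvd y\<^sup>2" using True by auto
    hence "p dvd y" using p prime_dvd_power by blast
    thus "y \<in> {0}" using y zdvd_imp_le[of p y] by force
  qed (use p True in auto)
  thus ?thesis using True by (simp add: Legendre_eq_0_iff[THEN iffD2])
next
  case False
  show ?thesis
  proof (cases "QuadRes p j")
    case True
    then obtain y0 where y0: "[y0\<^sup>2 = j] (mod p)" by (auto simp: QuadRes_def)
    define y where "y = y0 mod p"
    have y: "y \<in> {0..<p}" "y\<^sup>2 mod p = j mod p"
      using p y0 by (auto simp: y_def power_mod cong_def)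
    have "y \<noteq> 0" using y False by (auto simp: dvd_eq_mod_eq_0)
    hence yp: "y > 0" using y by auto
    have odd: "odd p" using p prime_odd_int by auto
    have "{z\<in>{0..<p}. z\<^sup>2 mod p = j mod p} = {y, p - y}"
    proof (intro equalityI subsetI)
      fix z assume "z \<in> {z\<in>{0..<p}. z\<^sup>2 mod p = j mod p}"
      hence z: "z \<in> {0..<p}" "z\<^sup>2 mod p = y\<^sup>2 mod p" using y by auto
      hence "p dvd z\<^sup>2 - y\<^sup>2" by (simp add: mod_eq_dvd_iff)
      hence "p dvd (z - y) * (z + y)" by (simp add: algebra_simps power2_eq_square)
      hence "p dvd z - y \<or> p dvd z + y" using p prime_dvd_mult_iff by blast
      thus "z \<in> {y, p - y}"
      proof
        assume "p dvd z - y"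
        hence "z mod p = y mod p" by (simp add: mod_eq_dvd_iff)
        thus ?thesis using z y by simp
      next
        assume "p dvd z + y"
        then obtain c where c: "z + y = p * c" by auto
        have "0 < p * c" "p * c < p * 2" using c[symmetric] z y yp by auto
        hence "c = 1" using p by (simp add: zero_less_mult_iff mult_less_cancel_left)
        thus ?thesis using c by auto
      qed
    next
      fix z assume "z \<in> {y, p - y}"
      moreover have "(p - y)\<^sup>2 = y\<^sup>2 + p * (p - 2 * y)" by (simp add: algebra_simps power2_eq_square)
      hence "(p - y)\<^sup>2 mod p = y\<^sup>2 mod p" by simp
      ultimately show "z \<in> {z\<in>{0..<p}. z\<^sup>2 mod p = j mod p}" using y yp by auto
    qed
    moreover have "y \<noteq> p - y" using odd by presburger
    ultimately show ?thesis using True False by (simp add: Legendre_def cong_0_iff)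
  next
    case nqr: False
    hence e: "{y\<in>{0..<p}. y\<^sup>2 mod p = j mod p} = {}" by (auto simp: QuadRes_def cong_def)
    show ?thesis unfolding e using nqr False by (simp add: Legendre_def cong_0_iff)
  qed
qed

text \<open>The number e is the idempotent of the factor p in the ring of residues modulo p m; with
  e and 1 - e residues modulo p and modulo m are glued together.\<close>

lemma bezout_idempotent_int:
  fixes p m :: int
  assumes "coprime p m"
  obtains e where "[e = 1] (mod p)" "[e = 0] (mod m)"
proof -
  obtain e where "[m * e = 1] (mod p)"
    using cong_solve_coprime_int[of m p] assms by (auto simp: coprime_commute)
  thus ?thesis using that[of "m * e"] by (simp add: cong_0_iff)
qed

text \<open>For squarefree k this is the Jacobi symbol (n/k). The product runs over the distinct
  primes only.\<close>

definition jacobi :: "int \<Rightarrow> int \<Rightarrow> int" where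
  "jacobi k n = (\<Prod>p\<in>prime_factors k. Legendre n p)"

lemma squarefree_dvdI:
  fixes k n :: int
  assumes "squarefree k" "\<And>p. p \<in> prime_factors k \<Longrightarrow> p dvd n"
  shows "k dvd n"
proof (cases "n = 0")
  case False
  have k0: "k \<noteq> 0" using assms(1) by auto
  show ?thesis
  proof (rule multiplicity_le_imp_dvd[OF k0])
    fix p :: int assume p: "prime p"
    show "multiplicity p k \<le> multiplicity p n"
    proof (cases "p dvd k")
      case True
      have "p dvd n" using assms(2)[of p] True p k0 by (auto simp: prime_factors_dvd)
      hence "multiplicity p n \<ge> 1" using False p by (auto intro!: multiplicity_geI)
      moreover have "multiplicity p k \<le> 1" using assms(1) p k0
        by (simp add: squarefree_factorial_semiring'')
      ultimately show ?thesis by linarith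
    qed (simp add: not_dvd_imp_multiplicity_0)
  qed
qed auto

text \<open>Binomial expansion modulo x^2. With n = p and x a multiple of k / p, where p^2 divides
  k, it makes (1 + x)^p congruent to 1 modulo k.\<close>

lemma square_dvd_power_expansion:
  fixes x :: int
  shows "x\<^sup>2 dvd (1 + x) ^ n - 1 - of_nat n * x"
proof (induction n)
  case (Suc n)
  have "(1 + x) ^ Suc n - 1 - of_nat (Suc n) * x
      = (1 + x) * ((1 + x) ^ n - 1 - of_nat n * x) + x\<^sup>2 * of_nat n"
    by (simp add: algebra_simps power2_eq_square)
  thus ?case using Suc by (metis dvd_add dvd_mult dvd_triv_left)
qed simp

locale real_primitive_character =
  fixes k :: int and \<chi> :: "int \<Rightarrow> complex"
  assumes k_odd: "odd k"
    and dirichlet: "dirichlet_character k \<chi>"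
    and real: "real_character \<chi>"
    and primitive: "primitive_character k \<chi>"
begin

lemma k_pos: "k > 0" and mult: "\<chi> (m * n) = \<chi> m * \<chi> n"
  and periodic: "\<chi> (n + k) = \<chi> n" and vanish: "gcd n k > 1 \<Longrightarrow> \<chi> n = 0"
  using dirichlet by (auto simp: dirichlet_character_def)

lemma one: "\<chi> 1 = 1"
proof -
  obtain n where "\<chi> n \<noteq> 0" using dirichlet by (auto simp: dirichlet_character_def)
  thus ?thesis using mult[of 1 n] by simp
qed

lemma periodic_nat: "\<chi> (n + int i * k) = \<chi> n"
proof (induction i)
  case (Suc i)
  thus ?case using periodic[of "n + int i * k"] by (simp add: algebra_simps)
qed simp

lemma periodic_mult: "\<chi> (n + i * k) = \<chi> n"
proof (cases "i \<ge> 0")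
  case True
  thus ?thesis using periodic_nat[of n "nat i"] by simp
next
  case False
  thus ?thesis using periodic_nat[of "n + i * k" "nat (- i)"] by simp
qed

lemma cong_eq: "[m = n] (mod k) \<Longrightarrow> \<chi> m = \<chi> n"
  using periodic_mult by (metis cong_iff_lin cong_sym mult.commute)

lemma power: "\<chi> (n ^ i) = \<chi> n ^ i"
  by (induction i) (auto simp: one mult)

lemma not_coprime: "\<not> coprime n k \<Longrightarrow> \<chi> n = 0"
  using vanish[of n] k_pos
  by (metis coprime_iff_gcd_eq_1 gcd_ge_0_int gcd_eq_0_iff less_irrefl zless_imp_add1_zle add_0 order_le_less)

lemma nonzero: "coprime n k \<Longrightarrow> \<chi> n \<noteq> 0"
  using cong_solve_coprime_int[of n k] cong_eq one mult by (metis mult_zero_left zero_neq_one)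

text \<open>By Euler's theorem the value is a root of unity, and a real number of modulus 1 is a
  sign.\<close>

lemma sign: assumes "coprime n k" shows "\<chi> n = 1 \<or> \<chi> n = - 1"
proof -
  have kk: "coprime (nat \<bar>n\<bar>) (nat k)" using assms k_pos
    by (metis abs_of_pos coprime_int_iff coprime_abs_left_iff int_nat_eq less_imp_le nat_0_le abs_ge_zero)
  have "[(int (nat \<bar>n\<bar>)) ^ totient (nat k) = 1] (mod int (nat k))"
    using euler_theorem[OF kk] by (metis cong_int_iff of_nat_1 of_nat_power)
  hence "[\<bar>n\<bar> ^ totient (nat k) = 1] (mod k)" using k_pos by simp
  \<comment> \<open>The theorem was applied to the absolute value of n as a natural number; doubling
    the exponent removes the absolute value.\<close>
  hence "[n ^ (2 * totient (nat k)) = 1] (mod k)"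
    using cong_pow[of "\<bar>n\<bar> ^ totient (nat k)" 1 k 2] by (simp add: power_mult mult.commute[of 2] flip: power_abs)
  hence "\<chi> n ^ (2 * totient (nat k)) = 1" using cong_eq one power by metis
  moreover have "totient (nat k) > 0" using k_pos by simp
  ultimately have "norm (\<chi> n) = 1"
    using power_eq_1_iff[of "\<chi> n" "2 * totient (nat k)"] by simp
  moreover obtain r where r: "\<chi> n = of_real r" using real by (auto simp: real_character_def elim: Reals_cases)
  ultimately have "\<bar>r\<bar> = 1" by simp
  thus ?thesis using r by (auto simp: abs_if split: if_splits)
qed

text \<open>Otherwise \<chi> itself would be a character modulo d, and would induce itself from the
  proper divisor d.\<close>

lemma not_induced_self: assumes "0 < d" "d < k" "d dvd k" shows "\<exists>n. \<chi> (n + d) \<noteq> \<chi> n \<or> (gcd n d > 1 \<and> \<chi> n \<noteq> 0)"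
proof (rule ccontr)
  assume *: "\<not> ?thesis"
  have "dirichlet_character d \<chi>" unfolding dirichlet_character_def
    using * assms one mult by (metis zero_neq_one)
  hence "induced_by k \<chi> d \<chi>" using dirichlet assms by (simp add: induced_by_def)
  thus False using primitive assms by (auto simp: primitive_character_def)
qed

text \<open>If \<open>p\<^sup>2\<close> divides \<open>k\<close>, the residues congruent to 1 modulo \<open>k / p\<close> have order dividing the odd
  number \<open>p\<close>, so a real character is trivial on them and has period \<open>k / p\<close>.\<close>

lemma squarefree: "squarefree k"
proof (rule ccontr)
  assume "\<not> squarefree k"
  then obtain p where p: "prime p" "p\<^sup>2 dvd k"
    using k_pos squarefree_factorial_semiring[of k] by auto
  then obtain m' where m': "k = p\<^sup>2 * m'" by auto
  define m where "m = p * m'"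
  have km: "k = p * m" by (simp add: m_def m' power2_eq_square)
  have p1: "p > 1" using p prime_gt_1_int by auto
  have mpos: "m > 0" using km k_pos p1 by (simp add: zero_less_mult_iff)
  have mk: "m < k" using km mpos p1 by simp
  have "odd p" using k_odd km by auto
  have unit: "\<chi> (1 + m * t) = 1" for t
  proof -
    have "(m * t)\<^sup>2 = k * (m' * t\<^sup>2)" by (simp add: m_def m' power2_eq_square)
    hence "k dvd (1 + m * t) ^ nat p - 1 - of_nat (nat p) * (m * t)"
      using square_dvd_power_expansion[of "m * t" "nat p"] by (metis dvd_mult_left)
    hence "k dvd (1 + m * t) ^ nat p - 1 - k * t" using p1 by (simp add: km mult.assoc)
    hence "k dvd (1 + m * t) ^ nat p - 1"
      by (metis diff_add_cancel dvd_add dvd_triv_left)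
    hence "\<chi> (1 + m * t) ^ nat p = 1"
      using cong_eq one power by (metis cong_iff_dvd_diff)
    moreover obtain r where r: "\<chi> (1 + m * t) = of_real r"
      using real by (auto simp: real_character_def elim: Reals_cases)
    ultimately have "of_real (r ^ nat p) = (of_real 1 :: complex)" by simp
    hence "r ^ nat p = 1 ^ nat p" by (simp only: of_real_eq_iff power_one)
    moreover have "odd (nat p)" using \<open>odd p\<close> p1 by (simp add: even_nat_iff)
    ultimately have "r = 1" using power_eq_1_iff[of r "nat p"] p1 by (auto simp: abs_if split: if_splits)
    thus ?thesis using r by simp
  qed
  have per: "\<chi> (n + m) = \<chi> n" for n
  proof (cases "coprime n k")
    case True
    then obtain i where i: "[n * i = 1] (mod k)" using cong_solve_coprime_int by blast
    have "[n * (1 + m * i) = n + m] (mod k)"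
      using cong_add[OF cong_refl[of n] cong_mult[OF i cong_refl[of m]]] by (simp add: algebra_simps)
    hence "\<chi> (n + m) = \<chi> n * \<chi> (1 + m * i)" using cong_eq mult by metis
    thus ?thesis using unit by simp
  next
    case False
    then obtain q where q: "prime q" "q dvd n" "q dvd k"
      using k_pos prime_divisor_exists[of "gcd n k"] by (auto simp: is_unit_gcd)
    \<comment> \<open>Since p also divides m, the primes dividing k are those dividing m, so adding
      m keeps n non-coprime to k.\<close>
    have "q dvd m" using q km p by (metis m_def prime_dvd_mult_iff dvd_triv_left)
    hence "\<not> coprime (n + m) k" using q by (meson dvd_add not_coprimeI not_prime_unit)
    thus ?thesis using False not_coprime by simp
  qed
  have "gcd n m > 1 \<Longrightarrow> \<chi> n = 0" for n
    using not_coprime[of n] km by (metis coprime_iff_gcd_eq_1 coprime_mult_right_iff less_irrefl)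
  thus False using not_induced_self[OF mpos mk] km per by auto
qed

lemma cofactor_coprime:
  assumes "prime p" and km: "k = p * m"
  shows "coprime p m"
proof (rule prime_imp_coprime[OF assms(1)], rule notI)
  assume "p dvd m"
  hence "p\<^sup>2 dvd k" unfolding km power2_eq_square by (rule mult_dvd_mono[OF dvd_refl])
  thus False using squarefreeD[OF squarefree] assms(1) not_prime_unit by blast
qed

text \<open>On residues congruent to 1 modulo m, \<chi> is a real character of the units modulo p.
  Squares modulo p lift to squares modulo k and get the value 1. If some nonresidue got the value 1
  as well, the component at p would be trivial and \<chi> would be induced from the modulus m = k /
  p.\<close>

lemma local_component:
  assumes p: "prime p" and km: "k = p * m" and u: "[u = 1] (mod m)"
  shows "\<chi> u = of_int (Legendre u p)"
proof -
  have cop: "coprime p m" by (rule cofactor_coprime[OF p km])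
  have p1: "p > 1" using p prime_gt_1_int by auto
  have "odd p" using k_odd km by auto
  hence p2: "p > 2" using p1 by (cases "p = 2") auto
  have mpos: "m > 0" using km k_pos p1 by (simp add: zero_less_mult_iff)
  have mk: "m < k" using km mpos p1 by simp
  have crt: "[a = b] (mod k)" if "[a = b] (mod p)" "[a = b] (mod m)" for a b
    using coprime_cong_mult[OF that cop] km by simp
  obtain e where e: "[e = 1] (mod p)" "[e = 0] (mod m)" using bezout_idempotent_int[OF cop] .
  define f where "f = 1 - e"
  have f: "[f = 0] (mod p)" "[f = 1] (mod m)"
    using cong_diff[OF cong_refl[of 1] e(1)] cong_diff[OF cong_refl[of 1] e(2)] by (auto simp: f_def)
  \<comment> \<open>The Chinese remainder map: \<open>j x y\<close> is x modulo p and y modulo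
    m.\<close>
  define j where "j x y = x * e + y * f" for x y
  have jp: "[j x y = x] (mod p)" and jm: "[j x y = y] (mod m)" for x y
    unfolding j_def using cong_add[OF cong_mult[OF cong_refl[of x] e(1)] cong_mult[OF cong_refl[of y] f(1)]]
       cong_add[OF cong_mult[OF cong_refl[of x] e(2)] cong_mult[OF cong_refl[of y] f(2)]] by auto
  have copi: "coprime v k" if "[v = 1] (mod m)" "\<not> p dvd v" for v
    using that p km by (metis cong_imp_coprime cong_sym coprime_1_left coprime_commute coprime_mult_right_iff prime_imp_coprime)
  have QR: "\<chi> v = 1" if v: "[v = 1] (mod m)" "\<not> p dvd v" "QuadRes p v" for v
  proof -
    obtain y where y: "[y^2 = v] (mod p)" using v by (auto simp: QuadRes_def)
    have "[(j y 1)^2 = v] (mod p)" using cong_pow[OF jp] y cong_trans by blast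
    moreover have "[(j y 1)^2 = v] (mod m)" using cong_pow[OF jm, of y 1 2] v(1) by (metis cong_sym cong_trans power_one)
    ultimately have eq: "\<chi> v = \<chi> (j y 1) ^ 2" using crt cong_eq power by metis
    moreover have "coprime v k" using copi v by auto
    ultimately have "\<chi> v \<noteq> 0" using nonzero by auto
    hence "coprime (j y 1) k" using eq not_coprime by (metis zero_power2)
    thus ?thesis using eq sign by force
  qed
  show ?thesis
  proof (cases "p dvd u")
    case True
    hence "\<not> coprime u k" using p km by (metis dvd_triv_left not_coprimeI not_prime_unit)
    thus ?thesis using True not_coprime by (simp add: Legendre_eq_0_iff[THEN iffD2])
  next
    case False
    show ?thesis
    proof (cases "QuadRes p u")
      case True
      thus ?thesis using QR[OF u False] False by (simp add: Legendre_def cong_0_iff)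
    next
      case nqr: False
      hence Lu: "Legendre u p = -1" using False by (simp add: Legendre_def cong_0_iff)
      have "\<chi> u \<noteq> 1"
      proof
        assume u1: "\<chi> u = 1"
        \<comment> \<open>The product of two nonresidues is a residue, so one nonresidue with value
          1 forces the value 1 on all of them.\<close>
        have triv: "\<chi> v = 1" if v: "[v = 1] (mod m)" "\<not> p dvd v" for v
        proof (cases "QuadRes p v")
          case False
          have "Legendre v p = -1" using False v by (simp add: Legendre_def cong_0_iff)
          hence "Legendre (u * v) p = 1" using Lu Legendre_mult[OF p p2] by simp
          hence "QuadRes p (u * v)" by (auto simp: Legendre_def split: if_splits)
          moreover have "[u * v = 1] (mod m)" using cong_mult[OF u v(1)] by simp
          moreover have "\<not> p dvd u * v" using \<open>\<not> p dvd u\<close> v p by (simp add: prime_dvd_mult_iff)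
          ultimately have "\<chi> (u * v) = 1" using QR by blast
          thus ?thesis using u1 mult by simp
        qed (use QR v in auto)
        \<comment> \<open>The component of \<chi> at m: with the coordinate at p frozen at 1, only
          the class of n modulo m matters.\<close>
        define \<psi> where "\<psi> n = \<chi> (j 1 n)" for n
        have "dirichlet_character m \<psi>" unfolding dirichlet_character_def
        proof (intro conjI allI impI)
          show "m > 0" by (rule mpos)
          show "\<exists>n. \<psi> n \<noteq> 0"
            using cong_eq[OF crt[OF jp[of 1 1] jm[of 1 1]]] one by (intro exI[of _ 1]) (simp add: \<psi>_def)
          show "\<psi> (a * b) = \<psi> a * \<psi> b" for a b
          proof -
            have "[j 1 (a * b) = j 1 a * j 1 b] (mod k)"
            proof (rule crt)
              show "[j 1 (a * b) = j 1 a * j 1 b] (mod p)"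
                using cong_mult[OF jp[of 1 a] jp[of 1 b]] jp[of 1 "a * b"] by (metis cong_sym cong_trans mult_1)
              show "[j 1 (a * b) = j 1 a * j 1 b] (mod m)"
                using cong_mult[OF jm[of 1 a] jm[of 1 b]] jm[of 1 "a * b"] by (metis cong_sym cong_trans)
            qed
            thus ?thesis unfolding \<psi>_def using cong_eq mult by metis
          qed
          show "\<psi> (n + m) = \<psi> n" for n
          proof -
            have "[j 1 (n + m) = j 1 n] (mod k)"
            proof (rule crt)
              show "[j 1 (n + m) = j 1 n] (mod p)" using jp by (metis cong_sym cong_trans)
              have "[n + m = n] (mod m)" by (simp add: cong_iff_dvd_diff)
              thus "[j 1 (n + m) = j 1 n] (mod m)" using jm by (metis cong_sym cong_trans)
            qed
            thus ?thesis unfolding \<psi>_def by (rule cong_eq)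
          qed
          show "\<psi> n = 0" if "gcd n m > 1" for n
          proof -
            have "\<not> coprime n m" using that by (auto simp: coprime_iff_gcd_eq_1)
            hence "\<not> coprime (j 1 n) m" using jm cong_imp_coprime by blast
            hence "\<not> coprime (j 1 n) k" by (simp add: km)
            thus ?thesis unfolding \<psi>_def by (rule not_coprime)
          qed
        qed
        moreover have "\<chi> n = \<psi> n" if n: "coprime n k" for n
        proof -
          have "\<not> p dvd n" using n km p by (metis dvd_triv_left not_coprimeI not_prime_unit)
          hence "\<not> p dvd j n 1" using jp by (metis cong_dvd_iff)
          hence "\<chi> (j n 1) = 1" using triv jm by blast
          moreover have "[n = j 1 n * j n 1] (mod k)"
          proof (rule crt)
            show "[n = j 1 n * j n 1] (mod p)"
              using cong_mult[OF jp[of 1 n] jp[of n 1]] by (simp add: cong_sym)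
            show "[n = j 1 n * j n 1] (mod m)"
              using cong_mult[OF jm[of 1 n] jm[of n 1]] by (simp add: cong_sym)
          qed
          ultimately show ?thesis unfolding \<psi>_def using cong_eq mult by (metis mult.right_neutral)
        qed
        ultimately have "induced_by k \<chi> m \<psi>" using dirichlet km by (simp add: induced_by_def)
        thus False using primitive mk by (auto simp: primitive_character_def)
      qed
      thus ?thesis using sign[OF copi[OF u False]] Lu by simp
    qed
  qed
qed

text \<open>Induction on the set S of primes at which n may differ from 1. Modulo k, n is u v with u
  congruent to 1 away from p and v congruent to 1 at p; \<open>local_component\<close> evaluates
  \<chi>(u), the induction hypothesis \<chi>(v). When S consists of all primes of k, no condition on
  n is left.\<close>

lemma eq_jacobi: "\<chi> n = of_int (jacobi k n)"
proof -
  have "\<forall>n. (\<forall>p\<in>prime_factors k - S. [n = 1] (mod p)) \<longrightarrow> \<chi> n = of_int (\<Prod>p\<in>S. Legendre n p)"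
    if "S \<subseteq> prime_factors k" for S
    using finite_subset[OF that finite_set_mset] that
  proof (induction S rule: finite_induct)
    case empty
    have "\<chi> n = 1" if "\<forall>p\<in>prime_factors k. [n = 1] (mod p)" for n
    proof -
      have "k dvd n - 1" using squarefree_dvdI[OF squarefree] that by (simp add: cong_iff_dvd_diff)
      thus ?thesis using cong_eq one by (metis cong_iff_dvd_diff)
    qed
    thus ?case by simp
  next
    case (insert p S)
    show ?case
    proof (intro allI impI)
      fix n assume n: "\<forall>q\<in>prime_factors k - insert p S. [n = 1] (mod q)"
      have p: "prime p" "p dvd k" using insert by auto
      then obtain m where km: "k = p * m" by auto
      have cop: "coprime p m" by (rule cofactor_coprime[OF p(1) km])
      have crt: "[a = b] (mod k)" if "[a = b] (mod p)" "[a = b] (mod m)" for a b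
        using coprime_cong_mult[OF that cop] km by simp
      obtain e where e: "[e = 1] (mod p)" "[e = 0] (mod m)" using bezout_idempotent_int[OF cop] .
      define f where "f = 1 - e"
      have f: "[f = 0] (mod p)" "[f = 1] (mod m)"
        using cong_diff[OF cong_refl[of 1] e(1)] cong_diff[OF cong_refl[of 1] e(2)] by (auto simp: f_def)
      define u where "u = n * e + f"
      define v where "v = e + n * f"
      have u: "[u = n] (mod p)" "[u = 1] (mod m)"
        unfolding u_def using cong_add[OF cong_mult[OF cong_refl[of n] e(1)] f(1)]
          cong_add[OF cong_mult[OF cong_refl[of n] e(2)] f(2)] by auto
      have v: "[v = 1] (mod p)" "[v = n] (mod m)"
        unfolding v_def using cong_add[OF e(1) cong_mult[OF cong_refl[of n] f(1)]]
          cong_add[OF e(2) cong_mult[OF cong_refl[of n] f(2)]] by auto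
      have vq: "[v = n] (mod q)" if "q \<in> prime_factors k" "q \<noteq> p" for q
      proof -
        have "q dvd m" using that km p by (metis in_prime_factors_iff prime_dvd_mult_iff primes_dvd_imp_eq)
        thus ?thesis using v(2) cong_dvd_modulus by blast
      qed
      have "\<forall>q\<in>prime_factors k - S. [v = 1] (mod q)"
        using vq n v(1) by (metis DiffD1 DiffD2 DiffI cong_trans insertE)
      hence "\<chi> v = of_int (\<Prod>q\<in>S. Legendre v q)" using insert by blast
      also have "(\<Prod>q\<in>S. Legendre v q) = (\<Prod>q\<in>S. Legendre n q)"
      proof (intro prod.cong refl Legendre_cong vq)
        fix q assume "q \<in> S"
        thus "q \<in> prime_factors k" "q \<noteq> p" using insert by auto
      qed
      finally have "\<chi> v = of_int (\<Prod>q\<in>S. Legendre n q)" .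
      moreover have "\<chi> u = of_int (Legendre n p)"
        using local_component[OF p(1) km u(2)] Legendre_cong[OF u(1)] by simp
      moreover have "[n = u * v] (mod k)"
        by (rule crt) (use cong_mult[OF u(1) v(1)] cong_mult[OF u(2) v(2)] in \<open>simp_all add: cong_sym\<close>)
      hence "\<chi> n = \<chi> u * \<chi> v" using cong_eq mult by metis
      ultimately show "\<chi> n = of_int (\<Prod>q\<in>insert p S. Legendre n q)"
        using insert by simp
    qed
  qed
  from this[of "prime_factors k"] show ?thesis by (simp add: jacobi_def)
qed

end

section \<open>Supplementary laws and reciprocity for products of Legendre symbols\<close>

lemma minus_one_power_half:
  fixes p :: int
  assumes "odd p" "p > 0"
  shows "(- 1 :: int) ^ nat ((p - 1) div 2) = (if p mod 4 = 1 then 1 else - 1)"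
proof -
  have "even (nat ((p - 1) div 2)) \<longleftrightarrow> even ((p - 1) div 2)" using assms by (subst even_nat_iff) auto
  also have "\<dots> \<longleftrightarrow> p mod 4 = 1" using assms by presburger
  finally show ?thesis by (simp add: minus_one_power_iff)
qed

lemma prod_odd_primes_bounds:
  fixes S :: "int set"
  assumes "finite S" "\<And>p. p \<in> S \<Longrightarrow> prime p \<and> p > 2"
  shows "odd (\<Prod>S)" "\<Prod>S > 0"
proof -
  have "\<forall>p\<in>S. odd p" using assms(2) prime_odd_int by auto
  with assms(1) show "odd (\<Prod>S)" by (induction S rule: finite_induct) auto
  show "\<Prod>S > 0" using assms(2) by (intro prod_pos) force
qed

text \<open>The class 1 is the subgroup of index 2 in the odd classes modulo 4, so the condition on
  the product multiplies like the signs.\<close>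

lemma prod_Legendre_minus_one:
  fixes S :: "int set"
  assumes "finite S" "\<And>p. p \<in> S \<Longrightarrow> prime p \<and> p > 2"
  shows "(\<Prod>p\<in>S. Legendre (- 1) p) = (if \<Prod>S mod 4 = 1 then 1 else - 1)"
  using assms
proof (induction S rule: finite_induct)
  case (insert p S)
  have p: "odd p" "prime p" "p > 2" using insert prime_odd_int[of p] by auto
  have o: "odd (\<Prod>S)" using prod_odd_primes_bounds(1)[of S] insert by auto
  define x where "x = \<Prod>S"
  have "(p * x) mod 4 = ((p mod 4) * (x mod 4)) mod 4" by (simp add: mod_mult_eq)
  moreover have "p mod 4 = 1 \<or> p mod 4 = 3" "x mod 4 = 1 \<or> x mod 4 = 3"
    using p o unfolding x_def by presburger+
  ultimately have m: "(p * x) mod 4 = 1 \<longleftrightarrow> (p mod 4 = 1 \<longleftrightarrow> x mod 4 = 1)"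
    by (elim disjE) simp_all
  have IH: "(\<Prod>p\<in>S. Legendre (- 1) p) = (if x mod 4 = 1 then 1 else - 1)"
    unfolding x_def using insert by blast
  have L: "Legendre (- 1) p = (if p mod 4 = 1 then 1 else - 1)"
    using p by (simp add: Legendre_minus_one minus_one_power_half)
  have "\<Prod>(insert p S) = p * x" unfolding x_def by (rule prod.insert[OF insert(1,2)])
  thus ?case unfolding \<open>\<Prod>(insert p S) = p * x\<close> unfolding prod.insert[OF insert(1,2)] IH L using m by simp
qed auto

text \<open>The same argument with the subgroup {1, 7} of index 2 in the odd classes modulo
  8.\<close>

lemma prod_Legendre_two:
  fixes S :: "int set"
  assumes "finite S" "\<And>p. p \<in> S \<Longrightarrow> prime p \<and> p > 2"
  shows "(\<Prod>p\<in>S. Legendre 2 p) = (if \<Prod>S mod 8 = 1 \<or> \<Prod>S mod 8 = 7 then 1 else - 1)"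
  using assms
proof (induction S rule: finite_induct)
  case (insert p S)
  have p: "odd p" "prime p" "p > 2" using insert prime_odd_int[of p] by auto
  have o: "odd (\<Prod>S)" using prod_odd_primes_bounds(1)[of S] insert by auto
  define x where "x = \<Prod>S"
  have "(p * x) mod 8 = ((p mod 8) * (x mod 8)) mod 8" by (simp add: mod_mult_eq)
  moreover have "p mod 8 \<in> {1,3,5,7}" "x mod 8 \<in> {1,3,5,7}"
    using p(1) o unfolding x_def insert_iff empty_iff by presburger+
  ultimately have m: "(p * x) mod 8 = 1 \<or> (p * x) mod 8 = 7 \<longleftrightarrow>
      ((p mod 8 = 1 \<or> p mod 8 = 7) \<longleftrightarrow> (x mod 8 = 1 \<or> x mod 8 = 7))"
    unfolding insert_iff empty_iff by (elim disjE) simp_all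
  have IH: "(\<Prod>p\<in>S. Legendre 2 p) = (if x mod 8 = 1 \<or> x mod 8 = 7 then 1 else - 1)"
    unfolding x_def using insert by blast
  have L: "Legendre 2 p = (if p mod 8 = 1 \<or> p mod 8 = 7 then 1 else - 1)"
    using p by (simp add: Legendre_two)
  have "\<Prod>(insert p S) = p * x" unfolding x_def by (rule prod.insert[OF insert(1,2)])
  thus ?case unfolding \<open>\<Prod>(insert p S) = p * x\<close> unfolding prod.insert[OF insert(1,2)] IH L using m by simp
qed auto

lemma prod_Legendre_left:
  fixes q :: int
  assumes "prime q" "q > 2"
  shows "Legendre (\<Prod>p\<in>S. f p) q = (\<Prod>p\<in>S. Legendre (f p) q)"
proof (induction S rule: infinite_finite_induct)
  have "[1\<^sup>2 = 1] (mod q)" by simp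
  hence "QuadRes q 1" unfolding QuadRes_def by blast
  hence *: "Legendre 1 q = 1" using assms by (auto simp: Legendre_def cong_0_iff)
  { case (infinite A) thus ?case using * by simp }
  { case empty thus ?case using * by simp }
qed (auto simp: Legendre_mult[OF assms])

text \<open>The reciprocity sign is expressed through \<open>Legendre (- 1) p\<close>, a form in
  which it can be multiplied over all primes p dividing k.\<close>

lemma quadratic_reciprocity_mod_4:
  fixes p q :: int
  assumes "prime p" "p > 2" "prime q" "q > 2" "p \<noteq> q"
  shows "Legendre q p = (if q mod 4 = 1 then Legendre p q else Legendre (- 1) p * Legendre p q)"
proof -
  have "odd p" "odd q" using assms prime_odd_int by auto
  have ne: "Legendre p q \<noteq> 0"
    using assms primes_dvd_imp_eq[of q p] by (auto simp: Legendre_eq_0_iff)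
  hence sq: "Legendre p q * Legendre p q = 1" using Legendre_values[of p q] by auto
  have "Legendre p q * Legendre q p = (- 1) ^ nat ((p - 1) div 2 * ((q - 1) div 2))"
    by (rule Quadratic_Reciprocity_int) (use assms in auto)
  also have "\<dots> = ((- 1) ^ nat ((p - 1) div 2)) ^ nat ((q - 1) div 2)"
    using assms by (simp add: nat_mult_distrib power_mult)
  also have "\<dots> = Legendre (- 1) p ^ nat ((q - 1) div 2)"
    using assms by (simp add: Legendre_minus_one)
  also have "\<dots> = (if q mod 4 = 1 then 1 else Legendre (- 1) p)"
  proof -
    have "even (nat ((q - 1) div 2)) \<longleftrightarrow> even ((q - 1) div 2)" using assms by (subst even_nat_iff) auto
    also have "\<dots> \<longleftrightarrow> q mod 4 = 1" using \<open>odd q\<close> by presburger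
    finally have e: "even (nat ((q - 1) div 2)) \<longleftrightarrow> q mod 4 = 1" .
    have "Legendre (- 1) p = 1 \<or> Legendre (- 1) p = - 1"
      using assms \<open>odd p\<close> by (simp add: Legendre_minus_one minus_one_power_half)
    thus ?thesis using e by (auto simp: minus_one_power_iff)
  qed
  finally have "Legendre p q * (Legendre p q * Legendre q p)
      = Legendre p q * (if q mod 4 = 1 then 1 else Legendre (- 1) p)" by simp
  thus ?thesis unfolding mult.assoc[symmetric] sq by auto
qed

locale odd_real_primitive_character = real_primitive_character +
  assumes odd: "odd_character \<chi>"
begin

lemma minus_one: "\<chi> (- 1) = - 1"
  using odd one by (simp add: odd_character_def)

lemma prime_factors: "p \<in> prime_factors k \<Longrightarrow> prime p \<and> p > 2"
proof -
  assume p: "p \<in> prime_factors k"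
  hence "prime p" "p dvd k" by auto
  moreover from this have "p \<noteq> 2" using k_odd by auto
  ultimately show ?thesis using prime_ge_2_int[of p] by auto
qed

lemma prod_prime_factors: "\<Prod>(prime_factors k) = k"
proof -
  have "k = (\<Prod>p\<in>prime_factors k. p ^ multiplicity p k)"
    using k_pos Factorial_Ring.prod_prime_factors[of k] by simp
  also have "\<dots> = (\<Prod>p\<in>prime_factors k. p)"
    by (intro prod.cong refl) (use squarefree k_pos in \<open>simp add: squarefree_factorial_semiring'\<close>)
  finally show ?thesis by simp
qed

text \<open>Oddness says that the symbol (-1/k) is -1, which excludes k congruent to 1 modulo
  4.\<close>

lemma k_mod_4: "k mod 4 = 3"
proof -
  have "of_int (jacobi k (- 1)) = (of_int (- 1) :: complex)" using eq_jacobi minus_one by simp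
  hence "jacobi k (- 1) = - 1" by (simp only: of_int_eq_iff)
  hence "k mod 4 \<noteq> 1"
    using prod_Legendre_minus_one[of "prime_factors k"] prime_factors prod_prime_factors
    by (auto simp: jacobi_def split: if_splits)
  thus ?thesis using k_odd by presburger
qed

lemma two: "\<chi> 2 = (if k mod 8 = 7 then 1 else - 1)"
proof -
  have "jacobi k 2 = (if k mod 8 = 1 \<or> k mod 8 = 7 then 1 else - 1)"
    using prod_Legendre_two[of "prime_factors k"] prime_factors prod_prime_factors
    by (simp add: jacobi_def)
  moreover have "k mod 8 \<noteq> 1" using k_mod_4 by presburger
  ultimately show ?thesis by (simp add: eq_jacobi)
qed

text \<open>Reciprocity at every p dividing k turns the product of the (q/p) into (k/q), up to the
  product of the (-1/p) when q is 3 modulo 4. That product is (-1/k) = -1, which then equals (-1/q),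
  so (-k/q) results in both cases.\<close>

lemma eq_Legendre:
  assumes q: "prime q" "q > 2"
  shows "\<chi> q = of_int (Legendre (- k) q)"
proof (cases "q dvd k")
  case True
  hence "\<not> coprime q k" using q by (meson dvd_refl not_coprimeI not_prime_unit)
  moreover have "Legendre (- k) q = 0" using True by (simp add: Legendre_eq_0_iff)
  ultimately show ?thesis using not_coprime by simp
next
  case False
  have j: "jacobi k (- 1) = - 1"
    using prod_Legendre_minus_one[of "prime_factors k"] prime_factors prod_prime_factors k_mod_4
    by (simp add: jacobi_def)
  have "Legendre (- k) q = Legendre (- 1) q * Legendre (\<Prod>(prime_factors k)) q"
    using Legendre_mult[OF q, of "- 1" k] by (simp add: prod_prime_factors)
  also have "\<dots> = Legendre (- 1) q * (\<Prod>p\<in>prime_factors k. Legendre p q)"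
    by (simp add: prod_Legendre_left[OF q, of "\<lambda>x. x", simplified])
  finally have L: "Legendre (- k) q = Legendre (- 1) q * (\<Prod>p\<in>prime_factors k. Legendre p q)" .
  have rec: "Legendre q p = (if q mod 4 = 1 then Legendre p q else Legendre (- 1) p * Legendre p q)"
    if "p \<in> prime_factors k" for p
    by (rule quadratic_reciprocity_mod_4) (use that prime_factors q False in auto)
  have "odd q" using q prime_odd_int by auto
  have "jacobi k q = Legendre (- k) q"
  proof (cases "q mod 4 = 1")
    case True
    have "jacobi k q = (\<Prod>p\<in>prime_factors k. Legendre p q)"
      unfolding jacobi_def by (intro prod.cong refl) (use rec True in auto)
    thus ?thesis using L True q \<open>odd q\<close> by (simp add: Legendre_minus_one minus_one_power_half)
  next
    case False
    have "jacobi k q = (\<Prod>p\<in>prime_factors k. Legendre (- 1) p * Legendre p q)"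
      unfolding jacobi_def by (intro prod.cong refl) (use rec False in auto)
    also have "\<dots> = jacobi k (- 1) * (\<Prod>p\<in>prime_factors k. Legendre p q)"
      by (simp add: prod.distrib jacobi_def)
    finally show ?thesis using L j False q \<open>odd q\<close> by (simp add: Legendre_minus_one minus_one_power_half)
  qed
  thus ?thesis by (simp add: eq_jacobi)
qed

end

section \<open>The sign of the Gauss sum\<close>

text \<open>An injective family of k residues meets every class once. Multiplication by a unit,
  shifted intervals and Chinese remaindering are all instances.\<close>

lemma sum_complete_residues:
  fixes F :: "int \<Rightarrow> 'a :: comm_monoid_add"
  assumes k: "k > 0" and per: "\<And>n. F (n mod k) = F n"
    and A: "finite A" "inj_on (\<lambda>x. h x mod k) A" "card A = nat k"
  shows "(\<Sum>x\<in>A. F (h x)) = sum F {0..<k}"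
proof -
  have "(\<lambda>x. h x mod k) ` A = {0..<k}"
    using k A by (intro card_subset_eq) (auto simp: card_image)
  hence "bij_betw (\<lambda>x. h x mod k) A {0..<k}" using A(2) by (simp add: bij_betw_def)
  from sum.reindex_bij_betw[OF this, of F] show ?thesis by (simp add: per)
qed

lemma sum_residues_mult:
  fixes F :: "int \<Rightarrow> 'a :: comm_monoid_add"
  assumes "k > 0" "\<And>n. F (n mod k) = F n" "coprime a k"
  shows "(\<Sum>x\<in>{0..<k}. F (a * x)) = sum F {0..<k}"
proof (rule sum_complete_residues[where F = F, OF assms(1,2)])
  show "inj_on (\<lambda>x. a * x mod k) {0..<k}"
  proof (rule inj_onI)
    fix x y assume xy: "x \<in> {0..<k}" "y \<in> {0..<k}" "a * x mod k = a * y mod k"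
    hence "[x = y] (mod k)" using assms(3) cong_mult_lcancel[of a k x y] by (simp add: cong_def coprime_commute)
    thus "x = y" using xy by (simp add: cong_def)
  qed
qed auto

lemma sum_residues_shift:
  fixes F :: "int \<Rightarrow> 'a :: comm_monoid_add"
  assumes "k > 0" "\<And>n. F (n mod k) = F n"
  shows "(\<Sum>x\<in>{a..<a + k}. F x) = sum F {0..<k}"
proof (rule sum_complete_residues[where F = F, OF assms])
  show "inj_on (\<lambda>x. x mod k) {a..<a + k}"
  proof (rule inj_onI)
    fix x y assume xy: "x \<in> {a..<a + k}" "y \<in> {a..<a + k}" "x mod k = y mod k"
    hence "k dvd x - y" by (simp add: mod_eq_dvd_iff)
    thus "x = y" using xy zdvd_not_zless[of "x - y" k] zdvd_not_zless[of "y - x" k]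
      by (cases x y rule: linorder_cases) (auto simp: dvd_diff_commute)
  qed
qed auto

lemma sum_residues_translate:
  fixes F :: "int \<Rightarrow> 'a :: comm_monoid_add"
  assumes "k > 0" "\<And>n. F (n mod k) = F n"
  shows "(\<Sum>x\<in>{0..<k}. F (x + a)) = sum F {0..<k}"
proof -
  have "(\<Sum>x\<in>{0..<k}. F (x + a)) = (\<Sum>x\<in>{a..<a + k}. F x)"
    by (rule sum.reindex_bij_witness[of _ "\<lambda>x. x - a" "\<lambda>x. x + a"]) auto
  thus ?thesis using sum_residues_shift[where F = F, OF assms] by simp
qed

lemma sum_residues_crt:
  fixes F :: "int \<Rightarrow> 'a :: comm_monoid_add"
  assumes p: "p > 0" and m: "m > 0" and cop: "coprime p m"
    and per: "\<And>n. F (n mod (p * m)) = F n"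
  shows "sum F {0..<p * m} = (\<Sum>x\<in>{0..<m}. \<Sum>y\<in>{0..<p}. F (p * x + m * y))"
proof -
  have "(\<Sum>z\<in>{0..<m} \<times> {0..<p}. F ((\<lambda>(x, y). p * x + m * y) z)) = sum F {0..<p * m}"
  proof (rule sum_complete_residues[where F = F])
    show "inj_on (\<lambda>z. (case z of (x, y) \<Rightarrow> p * x + m * y) mod (p * m)) ({0..<m} \<times> {0..<p})"
    proof (rule inj_onI, clarsimp)
      fix x y x' y' assume r: "0 \<le> x" "x < m" "0 \<le> y" "y < p" "0 \<le> x'" "x' < m" "0 \<le> y'" "y' < p"
        and eq: "(p * x + m * y) mod (p * m) = (p * x' + m * y') mod (p * m)"
      hence c: "[p * x + m * y = p * x' + m * y'] (mod p * m)" by (simp add: cong_def)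
      have "[m * y + p * x = m * y' + p * x'] (mod p)" using cong_modulus_mult[OF c] by (simp add: add.commute)
      hence "[m * y = m * y'] (mod p)" by (simp add: cong_def)
      hence "[y = y'] (mod p)" using cop by (simp add: cong_mult_lcancel coprime_commute)
      moreover have "[p * x + m * y = p * x' + m * y'] (mod m)" using c by (metis cong_modulus_mult mult.commute)
      hence "[p * x = p * x'] (mod m)" by (simp add: cong_def)
      hence "[x = x'] (mod m)" using cop by (simp add: cong_mult_lcancel coprime_commute)
      ultimately show "x = x' \<and> y = y'" using r by (simp add: cong_def)
    qed
  qed (use p m per in \<open>auto simp: nat_mult_distrib\<close>)
  thus ?thesis by (simp add: sum.cartesian_product split_def)
qed

section \<open>Additive characters and quadratic Gauss sums\<close>

definition ee :: "int \<Rightarrow> int \<Rightarrow> complex" where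
  "ee k n = cis (2 * pi * real_of_int n / real_of_int k)"

lemma ee_add: "ee k (m + n) = ee k m * ee k n"
  by (simp add: ee_def cis_mult ring_distribs add_divide_distrib)

lemma ee_0 [simp]: "ee k 0 = 1"
  by (simp add: ee_def)

lemma ee_multiple: "k \<noteq> 0 \<Longrightarrow> ee k (k * n) = 1"
  using cis_multiple_2pi[of "of_int n"] by (simp add: ee_def mult.assoc)

lemma ee_mod: "k \<noteq> 0 \<Longrightarrow> ee k (n mod k) = ee k n"
  using ee_add[of k "n mod k" "k * (n div k)"] by (simp add: ee_multiple)

lemma ee_cong: "k \<noteq> 0 \<Longrightarrow> [m = n] (mod k) \<Longrightarrow> ee k m = ee k n"
  using ee_mod by (metis cong_def)

lemma ee_cancel: "p \<noteq> 0 \<Longrightarrow> ee (p * m) (p * n) = ee m n"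
  by (simp add: ee_def mult.assoc mult.left_commute[of _ "real_of_int p"])

lemma ee_power: "ee k n ^ i = ee k (int i * n)"
  by (induction i) (simp_all add: ee_add ring_distribs)

lemma ee_eq_1_iff: assumes "k \<noteq> 0" shows "ee k n = 1 \<longleftrightarrow> k dvd n"
proof
  assume "ee k n = 1"
  hence "cos (2 * pi * real_of_int n / real_of_int k) = 1" by (simp add: ee_def complex_eq_iff)
  then obtain i :: int where "2 * pi * real_of_int n / real_of_int k = real_of_int i * 2 * pi"
    by (auto simp: cos_one_2pi_int)
  hence "real_of_int n = real_of_int (i * k)" using assms by (simp add: field_simps)
  hence "n = i * k" by (simp only: of_int_eq_iff)
  thus "k dvd n" by simp
qed (auto simp: ee_multiple assms)

lemma cnj_ee: "cnj (ee k n) = ee k (- n)"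
  by (simp add: ee_def cis_cnj)

lemma sum_ee:
  assumes "k > 0"
  shows "(\<Sum>n\<in>{0..<k}. ee k (b * n)) = (if k dvd b then of_int k else 0)"
proof (cases "k dvd b")
  case True
  hence "ee k (b * n) = 1" for n using assms by (simp add: ee_eq_1_iff)
  thus ?thesis using True assms by simp
next
  case False
  have "(\<Sum>n\<in>{0..<k}. ee k (b * n)) = (\<Sum>i<nat k. ee k b ^ i)"
    by (rule sum.reindex_bij_witness[of _ int nat]) (auto simp: ee_power mult.commute)
  also have "\<dots> = 0"
    using False assms by (subst geometric_sum) (auto simp: ee_eq_1_iff ee_power)
  finally show ?thesis using False by simp
qed

text \<open>Grouping by the value of the square, each j is taken 1 + (j/p) times, and the sum of all
  \<open>ee p (b * j)\<close> vanishes.\<close>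

lemma gauss_sum_prime:
  fixes p :: int
  assumes p: "prime p" "p > 2" and b: "coprime b p"
  shows "(\<Sum>y\<in>{0..<p}. ee p (b * y\<^sup>2)) = (\<Sum>j\<in>{0..<p}. of_int (Legendre j p) * ee p (b * j))"
proof -
  have "(\<Sum>y\<in>{0..<p}. ee p (b * y\<^sup>2))
      = (\<Sum>j\<in>{0..<p}. \<Sum>y\<in>{y\<in>{0..<p}. y\<^sup>2 mod p = j}. ee p (b * y\<^sup>2))"
    by (rule sum.group[symmetric]) (use p in auto)
  also have "\<dots> = (\<Sum>j\<in>{0..<p}. of_int (1 + Legendre j p) * ee p (b * j))"
  proof (rule sum.cong[OF refl])
    fix j assume j: "j \<in> {0..<p}"
    have "(\<Sum>y\<in>{y\<in>{0..<p}. y\<^sup>2 mod p = j}. ee p (b * y\<^sup>2)) = (\<Sum>y\<in>{y\<in>{0..<p}. y\<^sup>2 mod p = j}. ee p (b * j))"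
      by (intro sum.cong refl ee_cong) (use p in \<open>auto simp: cong_def mod_mult_right_eq\<close>)
    also have "\<dots> = of_int (int (card {y\<in>{0..<p}. y\<^sup>2 mod p = j mod p})) * ee p (b * j)"
      using j by simp
    finally show "(\<Sum>y\<in>{y\<in>{0..<p}. y\<^sup>2 mod p = j}. ee p (b * y\<^sup>2)) = of_int (1 + Legendre j p) * ee p (b * j)"
      unfolding card_square_roots[OF p] .
  qed
  also have "\<dots> = (\<Sum>j\<in>{0..<p}. ee p (b * j)) + (\<Sum>j\<in>{0..<p}. of_int (Legendre j p) * ee p (b * j))"
    by (simp add: ring_distribs sum.distrib)
  also have "(\<Sum>j\<in>{0..<p}. ee p (b * j)) = 0"
  proof -
    have "\<not> p dvd b" using b p by (meson dvd_refl not_coprimeI not_prime_unit)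
    thus ?thesis using sum_ee[of p b] p by simp
  qed
  finally show ?thesis by simp
qed

text \<open>Both sides factor under n = p x + m y, since the mixed term of the square is a multiple
  of p m. The factorization changes the multiplier a to a p and a m, which is why a is arbitrary in
  the induction.\<close>

lemma gauss_sum_squarefree:
  fixes S :: "int set"
  assumes "finite S" "\<And>p. p \<in> S \<Longrightarrow> prime p \<and> p > 2" "coprime a (\<Prod>S)"
  shows "(\<Sum>n\<in>{0..<\<Prod>S}. ee (\<Prod>S) (a * n\<^sup>2)) = (\<Sum>j\<in>{0..<\<Prod>S}. of_int (\<Prod>p\<in>S. Legendre j p) * ee (\<Prod>S) (a * j))"
  using assms
proof (induction S arbitrary: a rule: finite_induct)
  case empty
  have "{0..<1::int} = {0}" by auto
  thus ?case by simp
next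
  case (insert p S)
  define m where "m = \<Prod>S"
  have p: "prime p" "p > 2" using insert by auto
  have mpos: "m > 0" unfolding m_def using prod_odd_primes_bounds[of S] insert by auto
  have pm: "\<Prod>(insert p S) = p * m" unfolding m_def by (rule prod.insert[OF insert(1,2)])
  have "coprime p (\<Prod>q\<in>S. q)"
    by (rule prod_coprime_right) (use insert p in \<open>auto intro!: primes_coprime\<close>)
  hence cop: "coprime p m" by (simp add: m_def)
  have ap: "coprime a p" and am: "coprime a m" using insert.prems(2) unfolding pm by auto
  define J where "J j = (\<Prod>q\<in>S. Legendre j q)" for j
  have Jmod: "J (j mod m) = J j" for j unfolding J_def
  proof (intro prod.cong refl Legendre_cong)
    fix q assume q: "q \<in> S"
    have "q dvd m" unfolding m_def by (rule dvd_prodI) (use insert q in auto)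
    thus "[j mod m = j] (mod q)" by (simp add: cong_def mod_mod_cancel)
  qed
  have ppos: "p > 0" "p * m \<noteq> 0" "m \<noteq> 0" "p \<noteq> 0" using p mpos by auto
  have sqm: "n\<^sup>2 mod c = (n mod c)\<^sup>2 mod c" for n c :: int by (simp add: power_mod)
  have "(\<Sum>n\<in>{0..<p * m}. ee (p * m) (a * n\<^sup>2))
      = (\<Sum>x\<in>{0..<m}. \<Sum>y\<in>{0..<p}. ee (p * m) (a * (p * x + m * y)\<^sup>2))"
    by (rule sum_residues_crt[OF ppos(1) mpos cop])
       (intro ee_cong ppos(2) cong_mult cong_refl cong_pow cong_mod_left, simp)
  also have "\<dots> = (\<Sum>x\<in>{0..<m}. \<Sum>y\<in>{0..<p}. ee m (a * p * x\<^sup>2) * ee p (a * m * y\<^sup>2))"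
  proof (intro sum.cong refl)
    fix x y
    have "a * (p * x + m * y)\<^sup>2 = p * (a * p * x\<^sup>2) + m * (a * m * y\<^sup>2) + (p * m) * (2 * a * x * y)"
      by (simp add: algebra_simps power2_eq_square)
    hence "ee (p * m) (a * (p * x + m * y)\<^sup>2) = ee (p * m) (p * (a * p * x\<^sup>2)) * ee (m * p) (m * (a * m * y\<^sup>2))"
      by (simp only: ee_add ee_multiple[OF ppos(2)] mult_1_right mult.commute[of m p])
    thus "ee (p * m) (a * (p * x + m * y)\<^sup>2) = ee m (a * p * x\<^sup>2) * ee p (a * m * y\<^sup>2)"
      by (simp only: ee_cancel[OF ppos(3)] ee_cancel[OF ppos(4)])
  qed
  also have "\<dots> = (\<Sum>x\<in>{0..<m}. ee m (a * p * x\<^sup>2)) * (\<Sum>y\<in>{0..<p}. ee p (a * m * y\<^sup>2))"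
    by (simp add: sum_product)
  also have "(\<Sum>x\<in>{0..<m}. ee m (a * p * x\<^sup>2)) = (\<Sum>x\<in>{0..<m}. of_int (J x) * ee m (a * p * x))"
    unfolding J_def m_def by (rule insert.IH) (use insert am cop in \<open>auto simp: m_def\<close>)
  \<comment> \<open>The square p^2 does not affect the symbols; inserting it lets the substitution
    of x for p x absorb the factor p in the phase.\<close>
  also have "\<dots> = (\<Sum>x\<in>{0..<m}. of_int (J (p * (p * x))) * ee m (a * (p * x)))"
  proof (intro sum.cong refl)
    fix x
    have "Legendre (p * (p * x)) q = Legendre x q" if q: "q \<in> S" for q
    proof -
      have qq: "prime q" "q > 2" "q \<noteq> p" using insert q by auto
      hence "Legendre p q \<noteq> 0" using p by (auto simp: Legendre_eq_0_iff dest: primes_dvd_imp_eq)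
      hence "Legendre p q * Legendre p q = 1" using Legendre_values[of p q] by auto
      thus ?thesis using qq by (simp add: Legendre_mult mult.assoc[symmetric])
    qed
    thus "of_int (J x) * ee m (a * p * x) = of_int (J (p * (p * x))) * ee m (a * (p * x))"
      by (simp add: J_def mult.assoc)
  qed
  also have "\<dots> = (\<Sum>x\<in>{0..<m}. of_int (J (p * x)) * ee m (a * x))"
  proof (rule sum_residues_mult[OF mpos _ cop, where F = "\<lambda>x. of_int (J (p * x)) * ee m (a * x)"])
    fix n
    have "J (p * (n mod m)) = J (p * n)" using Jmod by (metis mod_mult_right_eq)
    moreover have "ee m (a * (n mod m)) = ee m (a * n)" using ee_mod[OF ppos(3)] by (metis mod_mult_right_eq)
    ultimately show "of_int (J (p * (n mod m))) * ee m (a * (n mod m)) = of_int (J (p * n)) * ee m (a * n)" by simp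
  qed
  also have "(\<Sum>y\<in>{0..<p}. ee p (a * m * y\<^sup>2)) = (\<Sum>y\<in>{0..<p}. of_int (Legendre y p) * ee p (a * m * y))"
    by (rule gauss_sum_prime) (use p ap cop in \<open>auto simp: coprime_commute\<close>)
  also have "\<dots> = (\<Sum>y\<in>{0..<p}. of_int (Legendre (m * (m * y)) p) * ee p (a * (m * y)))"
  proof (intro sum.cong refl)
    fix y
    have "\<not> p dvd m" using cop p by (meson dvd_refl not_coprimeI not_prime_unit)
    hence "Legendre m p * Legendre m p = 1" using Legendre_values[of m p] Legendre_eq_0_iff[of m p] by auto
    thus "of_int (Legendre y p) * ee p (a * m * y) = of_int (Legendre (m * (m * y)) p) * ee p (a * (m * y))"
      using p by (simp add: Legendre_mult mult.assoc) (simp add: mult.assoc[symmetric] flip: of_int_mult)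
  qed
  also have "\<dots> = (\<Sum>y\<in>{0..<p}. of_int (Legendre (m * y) p) * ee p (a * y))"
  proof (rule sum_residues_mult[where F = "\<lambda>y. of_int (Legendre (m * y) p) * ee p (a * y)"])
    fix n
    have "Legendre (m * (n mod p)) p = Legendre (m * n) p" by (intro Legendre_cong) (simp add: cong_def mod_mult_right_eq)
    moreover have "ee p (a * (n mod p)) = ee p (a * n)" using ee_mod[OF ppos(4)] by (metis mod_mult_right_eq)
    ultimately show "of_int (Legendre (m * (n mod p)) p) * ee p (a * (n mod p)) = of_int (Legendre (m * n) p) * ee p (a * n)" by simp
  qed (use ppos cop in \<open>auto simp: coprime_commute\<close>)
  also have "(\<Sum>x\<in>{0..<m}. of_int (J (p * x)) * ee m (a * x)) * (\<Sum>y\<in>{0..<p}. of_int (Legendre (m * y) p) * ee p (a * y))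
    = (\<Sum>x\<in>{0..<m}. \<Sum>y\<in>{0..<p}. of_int (Legendre (p * x + m * y) p * J (p * x + m * y)) * ee (p * m) (a * (p * x + m * y)))"
    unfolding sum_product
  proof (intro sum.cong refl)
    fix x y
    have "Legendre (p * x + m * y) p = Legendre (m * y) p" by (intro Legendre_cong) (simp add: cong_def)
    moreover have "J (p * x + m * y) = J (p * x)" using Jmod[of "p * x + m * y"] Jmod[of "p * x"] by simp
    moreover have "ee (p * m) (a * (p * x + m * y)) = ee (p * m) (p * (a * x)) * ee (m * p) (m * (a * y))"
      unfolding mult.commute[of m p] ee_add[symmetric] by (simp add: algebra_simps)
    hence "ee (p * m) (a * (p * x + m * y)) = ee m (a * x) * ee p (a * y)"
      by (simp only: ee_cancel[OF ppos(3)] ee_cancel[OF ppos(4)])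
    ultimately show "of_int (J (p * x)) * ee m (a * x) * (of_int (Legendre (m * y) p) * ee p (a * y))
       = of_int (Legendre (p * x + m * y) p * J (p * x + m * y)) * ee (p * m) (a * (p * x + m * y))"
      by simp
  qed
  also have "\<dots> = (\<Sum>j\<in>{0..<p * m}. of_int (Legendre j p * J j) * ee (p * m) (a * j))"
  proof (rule sum_residues_crt[symmetric, OF ppos(1) mpos cop, where F = "\<lambda>j. of_int (Legendre j p * J j) * ee (p * m) (a * j)"])
    fix n
    have "Legendre (n mod (p * m)) p = Legendre n p" by (intro Legendre_cong) (simp add: cong_def mod_mod_cancel)
    moreover have "J (n mod (p * m)) = J n" using Jmod[of n] Jmod[of "n mod (p * m)"] by (simp add: mod_mod_cancel)
    moreover have "ee (p * m) (a * (n mod (p * m))) = ee (p * m) (a * n)" using ee_mod[OF ppos(2)] by (metis mod_mult_right_eq)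
    ultimately show "of_int (Legendre (n mod (p * m)) p * J (n mod (p * m))) * ee (p * m) (a * (n mod (p * m)))
       = of_int (Legendre n p * J n) * ee (p * m) (a * n)" by simp
  qed
  also have "\<dots> = (\<Sum>j\<in>{0..<p * m}. of_int (\<Prod>q\<in>insert p S. Legendre j q) * ee (p * m) (a * j))"
    using insert by (simp add: J_def)
  finally show ?case unfolding pm .
qed

text \<open>With m = d + n the squares of n cancel and the phase d^2 + 2 d n is linear in n. As k is
  odd, the sum over n survives only for d = 0.\<close>

lemma norm_quadratic_gauss_sum:
  assumes k: "k > 0" "odd k"
  shows "(\<Sum>n\<in>{0..<k}. ee k (n\<^sup>2)) * cnj (\<Sum>n\<in>{0..<k}. ee k (n\<^sup>2)) = of_int k"
proof -
  have k0: "k \<noteq> 0" using k by auto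
  have "(\<Sum>n\<in>{0..<k}. ee k (n\<^sup>2)) * cnj (\<Sum>n\<in>{0..<k}. ee k (n\<^sup>2))
      = (\<Sum>n\<in>{0..<k}. \<Sum>m\<in>{0..<k}. ee k (m\<^sup>2) * ee k (- n\<^sup>2))"
    by (subst sum.swap) (simp add: cnj_ee sum_product)
  also have "\<dots> = (\<Sum>n\<in>{0..<k}. \<Sum>d\<in>{0..<k}. ee k ((d + n)\<^sup>2) * ee k (- n\<^sup>2))"
  proof (rule sum.cong[OF refl])
    fix n
    show "(\<Sum>m\<in>{0..<k}. ee k (m\<^sup>2) * ee k (- n\<^sup>2)) = (\<Sum>d\<in>{0..<k}. ee k ((d + n)\<^sup>2) * ee k (- n\<^sup>2))"
    proof (rule sum_residues_translate[symmetric, OF k(1)])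
      fix i
      have "ee k ((i mod k)\<^sup>2) = ee k (i\<^sup>2)" by (rule ee_cong[OF k0]) (simp add: cong_def power_mod)
      thus "ee k ((i mod k)\<^sup>2) * ee k (- n\<^sup>2) = ee k (i\<^sup>2) * ee k (- n\<^sup>2)" by simp
    qed
  qed
  also have "\<dots> = (\<Sum>n\<in>{0..<k}. \<Sum>d\<in>{0..<k}. ee k (d\<^sup>2) * ee k (2 * d * n))"
    by (intro sum.cong refl) (simp add: ee_add[symmetric] power2_eq_square algebra_simps)
  also have "\<dots> = (\<Sum>d\<in>{0..<k}. ee k (d\<^sup>2) * (\<Sum>n\<in>{0..<k}. ee k (2 * d * n)))"
    by (subst sum.swap) (simp add: sum_distrib_left)
  also have "\<dots> = (\<Sum>d\<in>{0..<k}. if d = 0 then of_int k else 0)"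
  proof (intro sum.cong refl)
    fix d assume d: "d \<in> {0..<k}"
    have "k dvd 2 * d \<longleftrightarrow> k dvd d" using k coprime_dvd_mult_right_iff[of k 2 d] by simp
    also have "\<dots> \<longleftrightarrow> d = 0" using d zdvd_imp_le[of k d] by force
    finally show "ee k (d\<^sup>2) * (\<Sum>n\<in>{0..<k}. ee k (2 * d * n)) = (if d = 0 then of_int k else 0)"
      using sum_ee[OF k(1), of "2 * d"] by simp
  qed
  also have "\<dots> = of_int k" using k by simp
  finally show ?thesis .
qed

section \<open>Lower bound for the imaginary part of the Gauss sum\<close>

lemma abs_sum_telescope_weighted_le:
  fixes A w :: "nat \<Rightarrow> real"
  assumes "\<And>s. \<bar>A s\<bar> \<le> B" "m \<le> M" "m \<ge> 1"
    and "\<And>s. m \<le> s \<Longrightarrow> s < M \<Longrightarrow> w (Suc s) \<le> w s" "w M \<ge> 0"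
  shows "\<bar>\<Sum>s=m..M. (A s - A (s - 1)) * w s\<bar> \<le> 2 * B * w m"
proof -
  \<comment> \<open>Abel summation: the interior costs B times the total variation of the decreasing
    weights, and the boundary terms cost B * w M and B * w m.\<close>
  have "\<bar>(\<Sum>s=m..M. (A s - A (s - 1)) * w s) - A M * w M + A (m - 1) * w m\<bar> \<le> B * (w m - w M)"
    using assms(2,4)
  proof (induction M rule: dec_induct)
    case base
    show ?case by (simp add: algebra_simps)
  next
    case (step n)
    define E where "E = (\<Sum>s=m..n. (A s - A (s - 1)) * w s) - A n * w n + A (m - 1) * w m"
    have "(\<Sum>s=m..Suc n. (A s - A (s - 1)) * w s) - A (Suc n) * w (Suc n) + A (m - 1) * w m
        = E + A n * (w n - w (Suc n))"
      using step.hyps by (simp add: E_def algebra_simps)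
    moreover have "\<bar>E\<bar> \<le> B * (w m - w n)" unfolding E_def by (rule step.IH) (use step.prems in simp)
    moreover have "w (Suc n) \<le> w n" using step by simp
    hence "\<bar>A n * (w n - w (Suc n))\<bar> \<le> B * (w n - w (Suc n))"
      using assms(1)[of n] by (simp add: abs_mult mult_right_mono)
    ultimately show ?case by (simp add: algebra_simps)
  qed
  moreover have "w M \<le> w m" using assms(2,4)
    by (induction M rule: dec_induct) (auto intro: order_trans less_imp_le)
  moreover have "\<bar>A M * w M\<bar> \<le> B * w M" "\<bar>A (m - 1) * w m\<bar> \<le> B * w m"
    using assms(1)[of M] assms(1)[of "m - 1"] assms(5) \<open>w M \<le> w m\<close>
    by (simp_all add: abs_mult mult_right_mono)
  ultimately show ?thesis by (simp add: algebra_simps)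
qed

text \<open>Concavity of the sine on [0, pi], applied to the chord that starts at the
  origin.\<close>

lemma sin_chord:
  fixes a t :: real
  assumes "0 \<le> a" "a \<le> pi" "0 \<le> t" "t \<le> 1"
  shows "t * sin a \<le> sin (t * a)"
proof -
  have "convex_on {0..pi} (\<lambda>x. - sin x)"
  proof (rule f''_ge0_imp_convex[where f' = "\<lambda>x. - cos x" and f'' = sin])
    show "0 \<le> sin x" if "x \<in> {0..pi}" for x using that by (simp add: sin_ge_zero)
  qed (auto intro!: derivative_eq_intros)
  from convex_onD[OF this assms(3,4), of 0 a] assms show ?thesis by simp
qed

lemma jordan_sin:
  fixes x :: real
  assumes "0 \<le> x" "x \<le> pi / 2"
  shows "2 / pi * x \<le> sin x"
  using sin_chord[of "pi / 2" "2 / pi * x"] assms by (simp add: field_simps)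

lemma jordan_cos:
  fixes x :: real
  assumes "0 \<le> x" "x \<le> pi / 2"
  shows "1 - 2 / pi * x \<le> cos x"
proof -
  have "2 / pi * (pi / 2 - x) \<le> sin (pi / 2 - x)" by (rule jordan_sin) (use assms in auto)
  moreover have "2 / pi * (pi / 2 - x) = 1 - 2 / pi * x" by (simp add: right_diff_distrib)
  ultimately show ?thesis by (simp add: sin_diff)
qed

text \<open>The imaginary part of \<open>i\<^sup>e exp(\<pi>is\<^sup>2/(2K))\<close>, where \<open>e\<close> is the parity of \<open>s\<close>.\<close>

definition gauss_im :: "real \<Rightarrow> nat \<Rightarrow> real" where
  "gauss_im K s = (if even s then sin (pi * (real s)\<^sup>2 / (2 * K)) else cos (pi * (real s)\<^sup>2 / (2 * K)))"

text \<open>All angles lie in [0, pi/2], so the terms are nonnegative. By Jordan's inequalities the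
  terms at 2i + 1 and 2i + 2 are at least 1 - (2i + 1)^2 / K and (2i + 2)^2 / K, so each such pair
  contributes at least 1.\<close>

lemma gauss_im_head:
  assumes K: "K > 0" and n: "(real n)\<^sup>2 \<le> K"
  shows "(\<Sum>s=1..n. gauss_im K s) \<ge> real (n div 2)"
proof -
  have b: "0 \<le> pi * (real s)\<^sup>2 / (2 * K) \<and> pi * (real s)\<^sup>2 / (2 * K) \<le> pi / 2" if "s \<le> n" for s
  proof -
    have "(real s)\<^sup>2 \<le> (real n)\<^sup>2" using that by (intro power_mono) auto
    hence "(real s)\<^sup>2 \<le> K" using n by linarith
    thus ?thesis using K by (simp add: field_simps)
  qed
  have e: "gauss_im K s \<ge> (real s)\<^sup>2 / K" if "s \<le> n" "even s" for s
    using jordan_sin[of "pi * (real s)\<^sup>2 / (2 * K)"] b[OF that(1)] that K by (simp add: gauss_im_def)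
  have o: "gauss_im K s \<ge> 1 - (real s)\<^sup>2 / K" if "s \<le> n" "odd s" for s
    using jordan_cos[of "pi * (real s)\<^sup>2 / (2 * K)"] b[OF that(1)] that K by (simp add: gauss_im_def)
  have nn: "gauss_im K s \<ge> 0" if "s \<le> n" for s
    using b[OF that] unfolding gauss_im_def by (auto intro!: sin_ge_zero cos_ge_zero)
  have pairs: "(\<Sum>s=1..2*i. gauss_im K s) \<ge> real i" if "2 * i \<le> n" for i
    using that
  proof (induction i)
    case (Suc i)
    have "gauss_im K (2 * i + 1) \<ge> 1 - (real (2 * i + 1))\<^sup>2 / K" using Suc.prems by (intro o) auto
    moreover have "gauss_im K (2 * i + 2) \<ge> (real (2 * i + 2))\<^sup>2 / K" using Suc.prems by (intro e) auto
    moreover have "(real (2 * i + 1))\<^sup>2 / K \<le> (real (2 * i + 2))\<^sup>2 / K"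
      using K by (intro divide_right_mono power_mono) auto
    ultimately have "gauss_im K (2 * i + 1) + gauss_im K (2 * i + 2) \<ge> 1" by linarith
    thus ?case using Suc by simp
  qed simp
  have "real (n div 2) \<le> (\<Sum>s=1..2*(n div 2). gauss_im K s)" by (rule pairs) simp
  also have "\<dots> \<le> (\<Sum>s=1..n. gauss_im K s)" by (intro sum_mono2) (auto intro: nn)
  finally show ?thesis .
qed

text \<open>The terms telescope in steps of two after multiplication by \<open>2 * sin (pi * s / K)\<close>.\<close>

lemma gauss_im_tail:
  assumes K: "K > 0" and m: "1 \<le> m" "m \<le> M" "2 * real M \<le> K"
  shows "\<bar>\<Sum>s=m..M. gauss_im K s\<bar> \<le> 2 / sin (pi * real m / K)"
proof -
  \<comment> \<open>As (s + 1)^2 - 1 = s^2 + 2s and (s - 1)^2 - 1 = s^2 - 2s, the phases of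
    \<open>D\<close> at s + 1 and s - 1 are that of s shifted by pi s / K up and down; the
    difference of the two is the term times 2 sin (pi s / K).\<close>
  define D where "D t = (if even t then sin (pi * ((real t)\<^sup>2 - 1) / (2 * K)) else - cos (pi * ((real t)\<^sup>2 - 1) / (2 * K)))" for t :: nat
  \<comment> \<open>Adding neighbours converts telescoping in steps of two into steps of one, at the
    price of the bound 2.\<close>
  define A where "A t = D (Suc t) + D t" for t
  define w where "w s = 1 / (2 * sin (pi * real s / K))" for s :: nat
  have D1: "\<bar>D t\<bar> \<le> 1" for t by (simp add: D_def)
  have "\<bar>A t\<bar> \<le> 2" for t using D1[of t] D1[of "Suc t"] unfolding A_def by linarith
  note A2 = this
  have pos: "sin (pi * real s / K) > 0" if "m \<le> s" "s \<le> M" for s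
  proof (rule sin_gt_zero)
    show "0 < pi * real s / K" using K m that by simp
    have "real s < K" using m that K by linarith
    thus "pi * real s / K < pi" using K by (simp add: field_simps)
  qed
  have mono: "w (Suc s) \<le> w s" if s: "m \<le> s" "s < M" for s
  proof -
    have "sin (pi * real s / K) \<le> sin (pi * real (Suc s) / K)"
    proof (rule sin_monotone_2pi_le)
      have "0 \<le> pi * real s / K" using K by simp
      moreover have "- (pi / 2) \<le> 0" by simp
      ultimately show "- (pi / 2) \<le> pi * real s / K" by linarith
      show "pi * real s / K \<le> pi * real (Suc s) / K" using K by (intro divide_right_mono mult_left_mono) auto
      have "2 * real (Suc s) \<le> K" using m s by (smt (verit) Suc_leI of_nat_mono)
      hence "pi * (2 * real (Suc s)) \<le> pi * K" by (intro mult_left_mono) auto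
      thus "pi * real (Suc s) / K \<le> pi / 2" using K by (simp add: field_simps)
    qed
    thus ?thesis unfolding w_def using pos[of s] s by (intro divide_left_mono) auto
  qed
  have "gauss_im K s = (A s - A (s - 1)) * w s" if s: "m \<le> s" "s \<le> M" for s
  proof -
    define x where "x = pi * (real s)\<^sup>2 / (2 * K)"
    define y where "y = pi * real s / K"
    have "s \<ge> 1" using s m by simp
    then obtain r where r: "s = Suc r" by (cases s) auto
    have ep: "pi * ((real (Suc s))\<^sup>2 - 1) / (2 * K) = x + y"
      using K by (simp add: x_def y_def field_simps power2_eq_square)
    have em: "pi * ((real r)\<^sup>2 - 1) / (2 * K) = x - y"
      using K by (simp add: x_def y_def r field_simps power2_eq_square)
    have "A s - A (s - 1) = D (Suc s) - D r" by (simp add: A_def r)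
    also have "\<dots> = 2 * sin y * gauss_im K s"
      unfolding D_def ep em gauss_im_def x_def[symmetric]
      by (simp add: r sin_add sin_diff cos_add cos_diff)
    also have "2 * sin y * gauss_im K s * w s = gauss_im K s"
      using pos[OF s] by (simp add: w_def y_def)
    finally show ?thesis by simp
  qed
  hence "(\<Sum>s=m..M. gauss_im K s) = (\<Sum>s=m..M. (A s - A (s - 1)) * w s)"
    by (intro sum.cong) auto
  also have "\<bar>\<dots>\<bar> \<le> 2 * 2 * w m"
    by (rule abs_sum_telescope_weighted_le) (use A2 m mono pos[of M] in \<open>auto simp: w_def\<close>)
  finally show ?thesis by (simp add: w_def)
qed

text \<open>The sum is split at n = floor (sqrt K), where the angle reaches about pi / 2. With the
  bounds for head and tail it remains to see that 4 / sin (pi (n + 1) / K) < 2 (n div 2) + sqrt K.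
  Chord estimates give this from 16 on; 7, 11 and 15 are the only smaller moduli in the right
  class.\<close>

lemma gauss_im_sum_lower:
  fixes k :: int
  assumes k: "k \<ge> 7" "k mod 4 = 3"
  shows "2 * (\<Sum>s=1..nat ((k - 1) div 2). gauss_im (of_int k) s) > - sqrt (of_int k)"
proof -
  define K where "K = real_of_int k"
  define n where "n = nat \<lfloor>sqrt K\<rfloor>"
  define M where "M = nat ((k - 1) div 2)"
  have K7: "K \<ge> 7" using k by (simp add: K_def)
  have "int n = \<lfloor>sqrt K\<rfloor>" using K7 by (simp add: n_def)
  hence n1: "real n \<le> sqrt K" "sqrt K < real n + 1" by linarith+
  have n2: "(real n)\<^sup>2 \<le> K" using power_mono[OF n1(1), of 2] K7 by simp
  have n3: "K < (real n + 1)\<^sup>2" using power_strict_mono[OF n1(2), of 2] K7 by simp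
  have nk: "(int n)\<^sup>2 \<le> k" using n2 unfolding K_def by (metis of_int_le_iff of_int_of_nat_eq of_int_power)
  have nk': "k < (int n + 1)\<^sup>2" 
  proof -
    have "real_of_int k < real_of_int ((int n + 1)\<^sup>2)" using n3 unfolding K_def by simp
    thus ?thesis by (simp only: of_int_less_iff)
  qed
  have nge2: "n \<ge> 2"
  proof (rule ccontr)
    assume "\<not> n \<ge> 2"
    hence "int n + 1 \<le> 2" by simp
    hence "(int n + 1)\<^sup>2 \<le> 2\<^sup>2" by (intro power_mono) auto
    thus False using nk' k by simp
  qed
  have nM: "n + 1 \<le> M"
  proof -
    have "2 * (int n + 1) \<le> k - 1"
    proof (cases "n = 2")
      case False
      hence "int n \<ge> 3" using nge2 by simp
      hence "int n * 3 \<le> (int n)\<^sup>2" by (simp add: power2_eq_square)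
      hence "3 * int n \<le> k" using nk by simp
      thus ?thesis using \<open>int n \<ge> 3\<close> k by presburger
    qed (use k in simp)
    hence "int n + 1 \<le> (k - 1) div 2" by simp
    thus ?thesis unfolding M_def by linarith
  qed
  have M2: "2 * real M \<le> K"
  proof -
    have "2 * int M \<le> k" using k unfolding M_def by simp
    thus ?thesis unfolding K_def by (metis of_int_le_iff of_int_mult of_int_numeral of_int_of_nat_eq)
  qed
  have head: "(\<Sum>s=1..n. gauss_im K s) \<ge> real (n div 2)" using gauss_im_head[of K n] n2 K7 by simp
  have tail: "\<bar>\<Sum>s=n+1..M. gauss_im K s\<bar> \<le> 2 / sin (pi * real (n + 1) / K)"
    by (rule gauss_im_tail) (use K7 nM M2 in auto)
  have half: "pi * real (n + 1) / K \<le> pi / 2"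
  proof -
    have "real (n + 1) \<le> real M" using nM by (simp only: of_nat_le_iff)
    hence "2 * real (n + 1) \<le> K" by (intro order_trans[OF mult_left_mono M2]) auto
    hence "pi * (2 * real (n + 1)) \<le> pi * K" by (intro mult_left_mono) auto
    thus ?thesis using K7 by (simp add: field_simps)
  qed
  have sinlow: "sin (pi * real (n + 1) / K) \<ge> sin x" if "0 \<le> x" "x \<le> pi * real (n + 1) / K" for x
  proof (rule sin_monotone_2pi_le)
    have "- (pi / 2) \<le> 0" by simp
    thus "- (pi / 2) \<le> x" using that by linarith
  qed (use that half in auto)
  have main: "4 / sin (pi * real (n + 1) / K) < 2 * real (n div 2) + sqrt K"
  proof (cases "k \<ge> 16")
    case True
    have s4: "sqrt K \<ge> 4" using True by (intro real_le_rsqrt) (simp add: K_def)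
    have "4 / sqrt K \<le> 1" using s4 K7 by (simp add: divide_le_eq_1)
    \<comment> \<open>The chord of the sine up to pi / 4, evaluated at pi / sqrt K.\<close>
    hence "4 / sqrt K * sin (pi / 4) \<le> sin (4 / sqrt K * (pi / 4))"
      by (intro sin_chord) (use K7 in auto)
    hence "4 / sqrt K * (sqrt 2 / 2) \<le> sin (pi / sqrt K)" using s4 by (simp add: sin_45)
    also have "\<dots> \<le> sin (pi * real (n + 1) / K)"
    proof (rule sinlow)
      have "sqrt K * sqrt K = K" using K7 by simp
      hence "pi / sqrt K = pi * sqrt K / K" using s4 K7 by (simp add: field_simps)
      also have "\<dots> \<le> pi * real (n + 1) / K" using n1 K7 by (intro divide_right_mono mult_left_mono) auto
      finally show "pi / sqrt K \<le> pi * real (n + 1) / K" .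
    qed (use K7 in auto)
    finally have low: "2 * sqrt 2 / sqrt K \<le> sin (pi * real (n + 1) / K)" by simp
    have "4 / sin (pi * real (n + 1) / K) \<le> 4 / (2 * sqrt 2 / sqrt K)"
      by (rule frac_le[OF _ order_refl _ low]) (use K7 in auto)
    also have "\<dots> = sqrt 2 * sqrt K" using s4 real_div_sqrt[of 2] by (simp add: field_simps)
    also have "\<dots> < 1.5 * sqrt K"
    proof (rule mult_strict_right_mono)
      show "sqrt 2 < 1.5" by (rule real_less_lsqrt) (auto simp: power2_eq_square)
    qed (use K7 in auto)
    \<comment> \<open>The loss of 2 covers both roundings: 2 (n div 2) >= n - 1 and n > sqrt K -
      1.\<close>
    also have "\<dots> \<le> 2 * sqrt K - 2" using s4 by simp
    also have "\<dots> \<le> 2 * real (n div 2) + sqrt K"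
    proof -
      have "int n \<le> 2 * int (n div 2) + 1" by presburger
      hence "real n \<le> 2 * real (n div 2) + 1" by linarith
      thus ?thesis using n1 by linarith
    qed
    finally show ?thesis .
  next
    case False
    hence "k = 7 \<or> k = 8 \<or> k = 9 \<or> k = 10 \<or> k = 11 \<or> k = 12 \<or> k = 13 \<or> k = 14 \<or> k = 15" using k by auto
    hence kk: "k = 7 \<or> k = 11 \<or> k = 15" using k(2) by auto
    have nn: "n = (if k = 7 then 2 else 3)"
    proof -
      have "\<not> n \<ge> 4"
      proof
        assume "n \<ge> 4"
        hence "(4::int)\<^sup>2 \<le> (int n)\<^sup>2" by (intro power_mono) auto
        thus False using nk False by simp
      qed
      hence "n = 2 \<or> n = 3" using nge2 by auto
      thus ?thesis using kk nk nk' by auto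
    qed
    hence nd: "n div 2 = 1" by simp
    \<comment> \<open>The angles 3 pi / 7 and 4 pi / 11 exceed pi / 3, and 8 / sqrt 3 < 4.62 < 2 +
      sqrt 7.\<close>
    have third: ?thesis if "k = 7 \<or> k = 11"
    proof -
      have "sin (pi / 3) \<le> sin (pi * real (n + 1) / K)"
        by (rule sinlow) (use that nn in \<open>auto simp: K_def field_simps\<close>)
      hence low: "sqrt 3 / 2 \<le> sin (pi * real (n + 1) / K)" by (simp add: sin_60)
      have "4 / sin (pi * real (n + 1) / K) \<le> 4 / (sqrt 3 / 2)"
        by (rule frac_le[OF _ order_refl _ low]) auto
      also have "\<dots> < 4.62"
      proof -
        have "sqrt 3 > 1.732" by (rule real_less_rsqrt) (simp add: power2_eq_square)
        thus ?thesis by (simp add: field_simps)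
      qed
      also have "4.62 < 2 + sqrt K"
      proof -
        have "sqrt K > 2.64" by (rule real_less_rsqrt) (use K7 in \<open>simp add: power2_eq_square\<close>)
        thus ?thesis by simp
      qed
      finally show ?thesis by (simp add: nd)
    qed
    \<comment> \<open>The angle 4 pi / 15 is only slightly larger than pi / 4, which suffices
      because 8 / sqrt 2 < 5.68 < 2 + sqrt 15.\<close>
    have quarter: ?thesis if "k = 15"
    proof -
      have "sin (pi / 4) \<le> sin (pi * real (n + 1) / K)"
        by (rule sinlow) (use that nn in \<open>auto simp: K_def field_simps\<close>)
      hence low: "sqrt 2 / 2 \<le> sin (pi * real (n + 1) / K)" by (simp add: sin_45)
      have "4 / sin (pi * real (n + 1) / K) \<le> 4 / (sqrt 2 / 2)"
        by (rule frac_le[OF _ order_refl _ low]) auto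
      also have "\<dots> < 5.68"
      proof -
        have "sqrt 2 > 1.414" by (rule real_less_rsqrt) (simp add: power2_eq_square)
        thus ?thesis by (simp add: field_simps)
      qed
      also have "5.68 < 2 + sqrt K"
      proof -
        have "sqrt K > 3.8" by (rule real_less_rsqrt) (use that in \<open>simp add: K_def power2_eq_square\<close>)
        thus ?thesis by simp
      qed
      finally show ?thesis by (simp add: nd)
    qed
    show ?thesis using kk third quarter by blast
  qed
  have "(\<Sum>s=1..M. gauss_im K s) = (\<Sum>s=1..n. gauss_im K s) + (\<Sum>s=n+1..M. gauss_im K s)"
    using sum.ub_add_nat[of 1 n "gauss_im K" "M - n"] nM by simp
  thus ?thesis using head tail main unfolding K_def M_def by (simp add: abs_le_iff)
qed

text \<open>Substituting \<open>n = s / 2\<close> modulo \<open>k\<close> moves both stationary points of the phase to \<open>s = 0\<close>.\<close>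

lemma Im_quadratic_gauss_sum:
  assumes k: "k > 0" "k mod 4 = 3"
  shows "Im (\<Sum>n\<in>{0..<k}. ee k (n\<^sup>2)) = 2 * (\<Sum>s=1..nat ((k - 1) div 2). gauss_im (of_int k) s)"
proof -
  \<comment> \<open>The inverse of 2 modulo k.\<close>
  define h where "h = (k + 1) div 2"
  define M where "M = nat ((k - 1) div 2)"
  have h: "2 * h = k + 1" using k unfolding h_def by presburger
  have "odd k" using k by presburger
  hence M: "k = 2 * int M + 1" using k unfolding M_def by (auto elim!: oddE)
  have cop: "coprime h k"
  proof (rule coprimeI)
    fix c assume "c dvd h" "c dvd k"
    hence "c dvd 2 * h - k" by (intro dvd_diff dvd_mult)
    thus "is_unit c" using h by simp
  qed
  have per: "ee k ((n mod k)\<^sup>2) = ee k (n\<^sup>2)" for n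
    by (rule ee_cong) (use k in \<open>auto simp: cong_def power_mod\<close>)
  have per2: "ee k ((h * (n mod k))\<^sup>2) = ee k ((h * n)\<^sup>2)" for n
    using per[of "h * n"] per[of "h * (n mod k)"] by (simp add: mod_mult_right_eq)
  have "(\<Sum>n\<in>{0..<k}. ee k (n\<^sup>2)) = (\<Sum>s\<in>{0..<k}. ee k ((h * s)\<^sup>2))"
    by (rule sum_residues_mult[where F = "\<lambda>n. ee k (n\<^sup>2)", symmetric, OF k(1) per cop])
  also have "\<dots> = (\<Sum>s\<in>{- int M..<- int M + k}. ee k ((h * s)\<^sup>2))"
    by (rule sum_residues_shift[where F = "\<lambda>n. ee k ((h * n)\<^sup>2)", symmetric, OF k(1) per2])
  also have "{- int M..<- int M + k} = {- int M..int M}" using M by auto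
  finally have S: "(\<Sum>n\<in>{0..<k}. ee k (n\<^sup>2)) = (\<Sum>s\<in>{- int M..int M}. ee k ((h * s)\<^sup>2))" .
  define g where "g s = Im (ee k ((h * s)\<^sup>2))" for s
  have g: "g (int s) = gauss_im (of_int k) s" for s
  proof -
    obtain j where j: "k = 4 * j + 3" using k by (metis mult_div_mod_eq mult.commute add.commute)
    have h2: "h = 2 * j + 2" using h j by simp
    define x where "x = pi * (real s)\<^sup>2 / (2 * real_of_int k)"
    have kk: "real_of_int k \<noteq> 0" using k by simp
    show ?thesis
    proof (cases "even s")
      case True
      then obtain r where r: "s = 2 * r" by auto
      have "ee k ((h * int s)\<^sup>2) = ee k (k * ((k + 2) * (int r)\<^sup>2) + (int r)\<^sup>2)"
        by (simp add: r j h2 power2_eq_square algebra_simps)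
      also have "\<dots> = ee k ((int r)\<^sup>2)" using k by (simp add: ee_add ee_multiple)
      also have "\<dots> = cis x" using kk by (simp add: ee_def x_def r field_simps power2_eq_square)
      finally show ?thesis using True by (simp add: g_def gauss_im_def x_def)
    next
      case False
      then obtain r where r: "s = 2 * r + 1" by (elim oddE)
      \<comment> \<open>Here h^2 = (j + 1) (k + 1), and the remainder r (r + 1) + j + 1 is (s^2 + k)
        / 4; its part k / 4 produces the quarter turn for odd s.\<close>
      have e: "(h * int s)\<^sup>2 = k * ((k + 2) * (int r * (int r + 1)) + j + 1) + int r * (int r + 1) + j + 1"
        by (simp add: r j h2 power2_eq_square algebra_simps)
      have "ee k ((h * int s)\<^sup>2) = ee k (int r * (int r + 1) + j + 1)"
        unfolding e using k by (simp add: ee_add ee_multiple add.assoc)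
      also have "\<dots> = cis (x + pi / 2)"
      proof -
        have "2 * pi * real_of_int (int r * (int r + 1) + j + 1) / real_of_int k = x + pi / 2"
          using kk by (simp add: x_def r j field_simps power2_eq_square)
        thus ?thesis by (simp add: ee_def)
      qed
      finally show ?thesis using False by (simp add: g_def gauss_im_def x_def sin_add)
    qed
  qed
  have gm: "g (- s) = g s" for s by (simp add: g_def)
  have "Im (\<Sum>s\<in>{- int M..int M}. ee k ((h * s)\<^sup>2)) = (\<Sum>s\<in>{- int M..int M}. g s)"
    by (simp add: g_def)
  also have "\<dots> = (\<Sum>s\<in>{- int M..-1} \<union> {0} \<union> {1..int M}. g s)"
    by (rule arg_cong[where f = "sum g"]) auto
  also have "\<dots> = (\<Sum>s\<in>{- int M..-1}. g s) + g 0 + (\<Sum>s\<in>{1..int M}. g s)"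
    by (subst sum.union_disjoint; (subst sum.union_disjoint)?) auto
  also have "(\<Sum>s\<in>{- int M..-1}. g s) = (\<Sum>s\<in>{1..int M}. g s)"
    by (rule sum.reindex_bij_witness[of _ uminus uminus]) (auto simp: gm)
  also have "(\<Sum>s\<in>{1..int M}. g s) = (\<Sum>s=1..M. gauss_im (of_int k) s)"
    by (rule sum.reindex_bij_witness[of _ int nat]) (auto simp: g[symmetric])
  also have "g 0 = 0" by (simp add: g_def)
  finally show ?thesis unfolding S M_def[symmetric] by simp
qed

context odd_real_primitive_character
begin

lemma quadratic_gauss_sum_eq:
  "(\<Sum>n\<in>{0..<k}. ee k (n\<^sup>2)) = (\<Sum>j\<in>{0..<k}. \<chi> j * ee k j)"
  using gauss_sum_squarefree[of "prime_factors k" 1] prime_factors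
  by (simp add: prod_prime_factors eq_jacobi jacobi_def)

lemma sum_chi_sin:
  assumes "k \<ge> 7"
  shows "(\<Sum>j\<in>{0..<k}. \<chi> j * of_real (sin (2 * pi * of_int j / of_int k))) = of_real (sqrt (of_int k))"
proof -
  define G where "G = (\<Sum>j\<in>{0..<k}. \<chi> j * ee k j)"
  define T where "T = (\<Sum>j\<in>{0..<k}. of_int (jacobi k j) * sin (2 * pi * of_int j / of_int k))"
  have per: "\<chi> (n mod k) * ee k (n mod k) = \<chi> n * ee k n" for n
    using cong_eq[of "n mod k" n] k_pos by (simp add: ee_mod cong_def)
  have "coprime (-1) k" by simp
  from sum_residues_mult[where F = "\<lambda>n. \<chi> n * ee k n", OF k_pos per this]
  have "G = (\<Sum>j\<in>{0..<k}. \<chi> (- j) * ee k (- j))" by (simp add: G_def)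
  also have "\<dots> = - (\<Sum>j\<in>{0..<k}. \<chi> j * cnj (ee k j))"
    using odd by (simp add: odd_character_def cnj_ee sum_negf)
  finally have "2 * G = G - (\<Sum>j\<in>{0..<k}. \<chi> j * cnj (ee k j))" by simp
  also have "\<dots> = (\<Sum>j\<in>{0..<k}. \<chi> j * (ee k j - cnj (ee k j)))"
    by (simp add: G_def right_diff_distrib sum_subtractf)
  also have "\<dots> = (\<Sum>j\<in>{0..<k}. 2 * (\<i> * of_real (of_int (jacobi k j) * sin (2 * pi * of_int j / of_int k))))"
    by (intro sum.cong refl) (simp add: eq_jacobi ee_def complex_eq_iff)
  also have "\<dots> = 2 * (\<i> * of_real T)"
    by (simp add: T_def sum_distrib_left)
  finally have GT: "G = \<i> * of_real T" by simp
  have "of_real (T\<^sup>2) = G * cnj G" by (simp add: GT power2_eq_square complex_eq_iff)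
  also have "\<dots> = of_real (of_int k)"
    using norm_quadratic_gauss_sum[OF k_pos k_odd] by (simp add: quadratic_gauss_sum_eq G_def)
  finally have "T\<^sup>2 = of_int k" by (simp only: of_real_eq_iff)
  hence "T = sqrt (of_int k) \<or> T = - sqrt (of_int k)"
    using k_pos by (metis abs_if real_sqrt_abs minus_minus)
  moreover have "Im G > - sqrt (of_int k)"
    using gauss_im_sum_lower[OF assms k_mod_4] Im_quadratic_gauss_sum[OF k_pos k_mod_4]
    by (simp add: quadratic_gauss_sum_eq G_def)
  hence "T > - sqrt (of_int k)" by (simp add: GT)
  ultimately have "T = sqrt (of_int k)" by auto
  moreover have "(\<Sum>j\<in>{0..<k}. \<chi> j * of_real (sin (2 * pi * of_int j / of_int k))) = of_real T"
    by (simp add: T_def eq_jacobi)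
  ultimately show ?thesis by simp
qed

end

section \<open>Counting roots of the norm form modulo integers\<close>

text \<open>With \<open>N = (k + 1) / 4\<close> and \<open>\<omega> = (1 + \<surd>-k) / 2\<close>, the polynomial \<open>x\<^sup>2 + x + N\<close> is the norm of \<open>x + \<omega>\<close>.\<close>

definition form_roots :: "int \<Rightarrow> nat \<Rightarrow> int set" where
  "form_roots N a = {x\<in>{0..<int a}. int a dvd x\<^sup>2 + x + N}"

lemma finite_form_roots [simp]: "finite (form_roots N a)"
  by (rule finite_subset[of _ "{0..<int a}"]) (auto simp: form_roots_def)

lemma form_mod_dvd: "a dvd b \<Longrightarrow> a dvd (x mod b)\<^sup>2 + x mod b + N \<longleftrightarrow> a dvd x\<^sup>2 + x + N" for a b x N :: int
proof -
  assume "a dvd b"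
  hence "[x mod b = x] (mod a)" by (simp add: cong_def mod_mod_cancel)
  hence "[(x mod b)\<^sup>2 + x mod b + N = x\<^sup>2 + x + N] (mod a)" by (intro cong_add cong_pow cong_refl)
  thus ?thesis by (rule cong_dvd_iff)
qed

lemma form_roots_1 [simp]: "form_roots N (Suc 0) = {0}"
  by (auto simp: form_roots_def)

lemma card_form_roots_mult:
  assumes cop: "coprime a b" and pos: "a > 0" "b > 0"
  shows "card (form_roots N (a * b)) = card (form_roots N a) * card (form_roots N b)"
proof -
  have cop': "coprime (int a) (int b)" using cop by simp
  have "bij_betw (\<lambda>x. (x mod int a, x mod int b)) (form_roots N (a * b)) (form_roots N a \<times> form_roots N b)"
    unfolding bij_betw_def
  proof
    show "inj_on (\<lambda>x. (x mod int a, x mod int b)) (form_roots N (a * b))"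
    proof (rule inj_onI)
      fix x y assume x: "x \<in> form_roots N (a * b)" and y: "y \<in> form_roots N (a * b)"
        and "(x mod int a, x mod int b) = (y mod int a, y mod int b)"
      hence "[x = y] (mod int a)" "[x = y] (mod int b)" by (simp_all add: cong_def)
      hence "[x = y] (mod int a * int b)" using coprime_cong_mult cop' by blast
      thus "x = y" using x y by (simp add: cong_def form_roots_def)
    qed
    show "(\<lambda>x. (x mod int a, x mod int b)) ` form_roots N (a * b) = form_roots N a \<times> form_roots N b"
    proof (intro equalityI subsetI)
      fix z assume "z \<in> (\<lambda>x. (x mod int a, x mod int b)) ` form_roots N (a * b)"
      then obtain x where x: "x \<in> form_roots N (a * b)" "z = (x mod int a, x mod int b)" by auto
      have "int a dvd x\<^sup>2 + x + N" "int b dvd x\<^sup>2 + x + N"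
        using x(1) dvd_mult_left dvd_mult_right by (auto simp: form_roots_def)
      thus "z \<in> form_roots N a \<times> form_roots N b"
        using pos x by (auto simp: form_roots_def form_mod_dvd)
    next
      fix z assume z: "z \<in> form_roots N a \<times> form_roots N b"
      then obtain u v where uv: "z = (u, v)" "u \<in> form_roots N a" "v \<in> form_roots N b" by auto
      obtain w where w: "[w = u] (mod int a)" "[w = v] (mod int b)"
        using binary_chinese_remainder_int[OF cop'] by blast
      define x where "x = w mod (int a * int b)"
      have xa: "x mod int a = u" "x mod int b = v"
        using w uv by (simp_all add: x_def mod_mod_cancel cong_def form_roots_def)
      have "int a dvd x\<^sup>2 + x + N" "int b dvd x\<^sup>2 + x + N"
        using uv xa form_mod_dvd[of "int a" "int a" x N] form_mod_dvd[of "int b" "int b" x N]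
        by (auto simp: form_roots_def)
      hence "int a * int b dvd x\<^sup>2 + x + N" using cop' by (simp add: divides_mult)
      hence "x \<in> form_roots N (a * b)" using pos by (simp add: form_roots_def x_def)
      thus "z \<in> (\<lambda>x. (x mod int a, x mod int b)) ` form_roots N (a * b)"
        using xa uv by force
    qed
  qed
  thus ?thesis by (simp add: bij_betw_same_card card_cartesian_product)
qed

text \<open>The discriminant of the quadratic is \<open>1 - 4 * N\<close>, so its roots are simple here and lift uniquely.\<close>

lemma card_form_roots_lift:
  assumes p: "prime p" and disc: "\<not> int p dvd 1 - 4 * N" and e: "e \<ge> 1"
  shows "card (form_roots N (p ^ Suc e)) = card (form_roots N (p ^ e))"
proof -
  have p': "prime (int p)" using p by simp
  have p0: "int p > 0" using p prime_gt_0_nat by simp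
  \<comment> \<open>If p divided both x^2 + x + N and its derivative 2x + 1, it would divide the
    discriminant.\<close>
  have simple: "\<not> int p dvd 2 * x + 1" if "int p dvd x\<^sup>2 + x + N" for x
  proof
    assume "int p dvd 2 * x + 1"
    hence "int p dvd (2 * x + 1) * (2 * x + 1) - 4 * (x\<^sup>2 + x + N)"
      using that by (intro dvd_diff dvd_mult)
    also have "(2 * x + 1) * (2 * x + 1) - 4 * (x\<^sup>2 + x + N) = 1 - 4 * N"
      by (simp add: power2_eq_square algebra_simps)
    finally show False using disc by simp
  qed
  have pe: "int p dvd int p ^ e" using e by (simp add: dvd_power)
  have "bij_betw (\<lambda>x. x mod int p ^ e) (form_roots N (p ^ Suc e)) (form_roots N (p ^ e))"
    unfolding bij_betw_def
  proof
    show "inj_on (\<lambda>x. x mod int p ^ e) (form_roots N (p ^ Suc e))"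
    proof (rule inj_onI)
      fix x y assume x: "x \<in> form_roots N (p ^ Suc e)" and y: "y \<in> form_roots N (p ^ Suc e)"
        and "x mod int p ^ e = y mod int p ^ e"
      hence "int p ^ e dvd x - y" by (simp add: mod_eq_dvd_iff)
      hence pd: "int p dvd x - y" using pe dvd_trans by blast
      have "int p ^ Suc e dvd x\<^sup>2 + x + N" "int p ^ Suc e dvd y\<^sup>2 + y + N"
        using x y by (simp_all add: form_roots_def)
      moreover from this have px: "int p dvd x\<^sup>2 + x + N" by (metis dvd_mult_left power_Suc)
      ultimately have "int p ^ Suc e dvd (x\<^sup>2 + x + N) - (y\<^sup>2 + y + N)" by (intro dvd_diff)
      also have "(x\<^sup>2 + x + N) - (y\<^sup>2 + y + N) = (x + y + 1) * (x - y)"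
        by (simp add: power2_eq_square algebra_simps)
      finally have d: "int p ^ Suc e dvd (x + y + 1) * (x - y)" .
      have "\<not> int p dvd x + y + 1"
      proof
        assume "int p dvd x + y + 1"
        hence "int p dvd (x + y + 1) + (x - y)" using pd by (rule dvd_add)
        hence "int p dvd 2 * x + 1" by (simp add: algebra_simps)
        thus False using simple[OF px] by simp
      qed
      hence "coprime (int p ^ Suc e) (x + y + 1)"
        using p' by (intro coprime_power_left_iff[THEN iffD2] disjI1) (simp add: prime_imp_coprime)
      hence "int p ^ Suc e dvd x - y" using d by (simp add: coprime_dvd_mult_right_iff)
      hence "x mod int p ^ Suc e = y mod int p ^ Suc e" by (simp only: mod_eq_dvd_iff)
      thus "x = y" using x y by (simp add: form_roots_def)
    qed
    show "(\<lambda>x. x mod int p ^ e) ` form_roots N (p ^ Suc e) = form_roots N (p ^ e)"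
    proof (intro equalityI subsetI)
      fix z assume "z \<in> (\<lambda>x. x mod int p ^ e) ` form_roots N (p ^ Suc e)"
      then obtain x where x: "x \<in> form_roots N (p ^ Suc e)" "z = x mod int p ^ e" by auto
      have "int p ^ e dvd int p ^ Suc e" by simp
      hence "int p ^ e dvd x\<^sup>2 + x + N" using x(1) dvd_trans by (auto simp: form_roots_def)
      thus "z \<in> form_roots N (p ^ e)" using x p0 by (simp add: form_roots_def form_mod_dvd)
    next
      fix x assume x: "x \<in> form_roots N (p ^ e)"
      then obtain c where c: "x\<^sup>2 + x + N = int p ^ e * c" by (auto simp: form_roots_def)
      have "int p dvd x\<^sup>2 + x + N" unfolding c using pe by (rule dvd_mult2)
      hence "coprime (2 * x + 1) (int p)" using simple p' by (simp add: prime_imp_coprime coprime_commute)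
      then obtain i where i: "[(2 * x + 1) * i = 1] (mod int p)" using cong_solve_coprime_int by blast
      \<comment> \<open>Newton's step: i inverts the derivative modulo p, so x + p^e t cancels the
        term p^e c modulo the next power of p.\<close>
      define t where "t = - c * i"
      have "[c + t * (2 * x + 1) = c + (- c) * 1] (mod int p)"
        using cong_add[OF cong_refl[of c] cong_mult[OF cong_refl[of "- c"] i]]
        by (simp add: t_def algebra_simps)
      hence d1: "int p dvd c + t * (2 * x + 1)" by (simp add: cong_0_iff)
      define y where "y = x + int p ^ e * t"
      have "y\<^sup>2 + y + N = (x\<^sup>2 + x + N) + int p ^ e * (t * (2 * x + 1)) + int p ^ e * (int p ^ e * t\<^sup>2)"
        by (simp add: y_def power2_eq_square algebra_simps)
      also have "\<dots> = int p ^ e * ((c + t * (2 * x + 1)) + int p ^ e * t\<^sup>2)"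
        unfolding c by (simp add: algebra_simps)
      finally have "y\<^sup>2 + y + N = int p ^ e * ((c + t * (2 * x + 1)) + int p ^ e * t\<^sup>2)" .
      moreover have "int p dvd (c + t * (2 * x + 1)) + int p ^ e * t\<^sup>2" using d1 pe by simp
      ultimately have "int p ^ Suc e dvd y\<^sup>2 + y + N" by (simp add: mult.commute[of "int p"] mult_dvd_mono)
      hence "y mod int p ^ Suc e \<in> form_roots N (p ^ Suc e)"
        using p0 form_mod_dvd[of "int p ^ Suc e" "int p ^ Suc e" y N] by (simp add: form_roots_def)
      moreover have "(y mod int p ^ Suc e) mod int p ^ e = x"
        using x by (simp add: mod_mod_cancel y_def form_roots_def)
      ultimately show "x \<in> (\<lambda>x. x mod int p ^ e) ` form_roots N (p ^ Suc e)" by force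
    qed
  qed
  thus ?thesis by (rule bij_betw_same_card)
qed

lemma card_form_roots_power:
  assumes "prime p" "\<not> int p dvd 1 - 4 * N"
  shows "card (form_roots N (p ^ Suc e)) = card (form_roots N p)"
proof (induction e)
  case (Suc e)
  thus ?case using card_form_roots_lift[OF assms, of "Suc e"] by simp
qed simp

text \<open>In (2x + 1)^2 = 4 (x^2 + x + N) + (1 - 4N) a root modulo p^2 makes p divide 2x + 1,
  hence p^2 divide the discriminant.\<close>

lemma form_roots_ramified:
  assumes p: "prime p" "int p dvd 1 - 4 * N" "\<not> (int p)\<^sup>2 dvd 1 - 4 * N" and e: "e \<ge> 2"
  shows "form_roots N (p ^ e) = {}"
proof (rule ccontr)
  assume "form_roots N (p ^ e) \<noteq> {}"
  then obtain x where x: "int p ^ e dvd x\<^sup>2 + x + N" by (auto simp: form_roots_def)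
  have "(int p)\<^sup>2 dvd int p ^ e" using e by (rule le_imp_power_dvd)
  hence d: "(int p)\<^sup>2 dvd 4 * (x\<^sup>2 + x + N)" using x dvd_trans dvd_mult by blast
  have eq: "(2 * x + 1)\<^sup>2 = 4 * (x\<^sup>2 + x + N) + (1 - 4 * N)" by (simp add: power2_eq_square algebra_simps)
  have "int p dvd 4 * (x\<^sup>2 + x + N)" using d by (metis dvd_mult_left power2_eq_square)
  hence "int p dvd (2 * x + 1)\<^sup>2" unfolding eq using p(2) by (rule dvd_add)
  hence "int p dvd 2 * x + 1" using p(1) by (simp add: prime_dvd_power_iff)
  hence "(int p)\<^sup>2 dvd (2 * x + 1)\<^sup>2" by (rule dvd_power_same)
  hence "(int p)\<^sup>2 dvd (2 * x + 1)\<^sup>2 - 4 * (x\<^sup>2 + x + N)" using d by (rule dvd_diff)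
  thus False using p(3) eq by simp
qed

lemma card_form_roots_two: "card (form_roots N 2) = (if even N then 2 else 0)"
proof -
  have "form_roots N 2 = (if even N then {0, 1} else {})"
    by (auto simp: form_roots_def power2_eq_square) 
  thus ?thesis by simp
qed

text \<open>Completing the square: x corresponds to the square root 2x + 1 of the
  discriminant.\<close>

lemma card_form_roots_prime:
  assumes p: "prime p" "p > 2"
  shows "int (card (form_roots N p)) = 1 + Legendre (1 - 4 * N) (int p)"
proof -
  have p': "prime (int p)" "int p > 2" using p by auto
  have "odd p" using p prime_odd_nat by auto
  hence c2: "coprime 2 (int p)" by simp
  have c4: "coprime (4::int) (int p)" using c2 coprime_power_left_iff[of "2::int" 2 "int p"] by simp
  have iff: "int p dvd x\<^sup>2 + x + N \<longleftrightarrow> (2 * x + 1)\<^sup>2 mod int p = (1 - 4 * N) mod int p" for x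
  proof -
    have "int p dvd x\<^sup>2 + x + N \<longleftrightarrow> int p dvd 4 * (x\<^sup>2 + x + N)"
      using coprime_dvd_mult_right_iff[of "int p" 4 "x\<^sup>2 + x + N"] c4 by (simp only: coprime_commute)
    also have "4 * (x\<^sup>2 + x + N) = (2 * x + 1)\<^sup>2 - (1 - 4 * N)" by (simp add: power2_eq_square algebra_simps)
    finally show ?thesis by (simp only: mod_eq_dvd_iff)
  qed
  have "bij_betw (\<lambda>x. (2 * x + 1) mod int p) (form_roots N p) {y\<in>{0..<int p}. y\<^sup>2 mod int p = (1 - 4 * N) mod int p}"
    unfolding bij_betw_def
  proof
    show "inj_on (\<lambda>x. (2 * x + 1) mod int p) (form_roots N p)"
    proof (rule inj_onI)
      fix x y assume x: "x \<in> form_roots N p" and y: "y \<in> form_roots N p"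
        and "(2 * x + 1) mod int p = (2 * y + 1) mod int p"
      hence "int p dvd (2 * x + 1) - (2 * y + 1)" by (simp only: mod_eq_dvd_iff)
      also have "(2 * x + 1) - (2 * y + 1) = 2 * (x - y)" by simp
      finally have "int p dvd x - y" using coprime_dvd_mult_right_iff[of "int p" 2 "x - y"] c2 by (simp only: coprime_commute)
      hence "x mod int p = y mod int p" by (simp add: mod_eq_dvd_iff)
      thus "x = y" using x y by (simp add: form_roots_def)
    qed
    show "(\<lambda>x. (2 * x + 1) mod int p) ` form_roots N p = {y\<in>{0..<int p}. y\<^sup>2 mod int p = (1 - 4 * N) mod int p}"
    proof (intro equalityI subsetI)
      fix z assume "z \<in> (\<lambda>x. (2 * x + 1) mod int p) ` form_roots N p"
      thus "z \<in> {y\<in>{0..<int p}. y\<^sup>2 mod int p = (1 - 4 * N) mod int p}"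
        using p' iff by (auto simp: form_roots_def power_mod)
    next
      fix y assume y: "y \<in> {y\<in>{0..<int p}. y\<^sup>2 mod int p = (1 - 4 * N) mod int p}"
      obtain i where i: "[2 * i = 1] (mod int p)" using cong_solve_coprime_int[OF c2] by blast
      define x where "x = (i * (y - 1)) mod int p"
      have "[x = i * (y - 1)] (mod int p)" by (simp add: x_def cong_def)
      hence "[2 * x + 1 = 2 * (i * (y - 1)) + 1] (mod int p)" by (intro cong_add cong_mult cong_refl)
      also have "[2 * (i * (y - 1)) + 1 = 1 * (y - 1) + 1] (mod int p)"
        unfolding mult.assoc[symmetric] by (intro cong_add cong_mult cong_refl i)
      finally have xy: "(2 * x + 1) mod int p = y" using y by (simp add: cong_def)
      hence "(2 * x + 1)\<^sup>2 mod int p = (1 - 4 * N) mod int p" using y by (metis (mono_tags, lifting) mem_Collect_eq power_mod)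
      hence "x \<in> form_roots N p" using iff p' by (simp add: form_roots_def x_def)
      thus "y \<in> (\<lambda>x. (2 * x + 1) mod int p) ` form_roots N p" using xy by force
    qed
  qed
  hence "card (form_roots N p) = card {y\<in>{0..<int p}. y\<^sup>2 mod int p = (1 - 4 * N) mod int p}"
    by (rule bij_betw_same_card)
  thus ?thesis using card_square_roots[OF p'] by simp
qed

section \<open>Multiplicativity of the ideal count\<close>

lemma gcd_mult_gcd_coprime:
  fixes c u v :: nat
  assumes "coprime u v" "c dvd u * v"
  shows "gcd c u * gcd c v = c"
proof (rule dvd_antisym)
  obtain a b where ab: "c = a * b" "a dvd u" "b dvd v" using division_decomp[OF assms(2)] by auto
  have "a dvd gcd c u" "b dvd gcd c v" using ab by auto
  thus "c dvd gcd c u * gcd c v" unfolding ab(1) by (rule mult_dvd_mono)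
  have "coprime (gcd c u) (gcd c v)" using assms(1) by (rule coprime_divisors[OF gcd_dvd2 gcd_dvd2])
  thus "gcd c u * gcd c v dvd c" by (simp add: divides_mult)
qed

text \<open>The two factors of c are its gcds with u and v. The case e = 2 serves
  \<open>form_count\<close>, the case e = 1 ordinary divisor sums.\<close>

lemma sum_coprime_divisor_pairs:
  fixes u v :: nat and f :: "nat \<Rightarrow> 'a :: comm_monoid_add"
  assumes cop: "coprime u v" and e: "e > 0"
  shows "(\<Sum>c | c ^ e dvd u * v. f c) = (\<Sum>(c1, c2)\<in>{c. c ^ e dvd u} \<times> {c. c ^ e dvd v}. f (c1 * c2))"
proof (rule sum.reindex_bij_witness[of _ "\<lambda>(c1, c2). c1 * c2" "\<lambda>c. (gcd c u, gcd c v)"])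
  fix c assume "c \<in> {c. c ^ e dvd u * v}"
  hence c: "c ^ e dvd u * v" by simp
  have "c dvd c ^ e" using e by (simp add: dvd_power)
  hence "c dvd u * v" using c dvd_trans by blast
  thus "(case (gcd c u, gcd c v) of (c1, c2) \<Rightarrow> c1 * c2) = c" "(case (gcd c u, gcd c v) of (c1, c2) \<Rightarrow> f (c1 * c2)) = f c"
    using gcd_mult_gcd_coprime[OF cop] by auto
  have "gcd c u ^ e dvd u * v" "gcd c v ^ e dvd u * v" using c dvd_power_same[of "gcd c u" c e] dvd_power_same[of "gcd c v" c e] dvd_trans by auto
  moreover have "coprime (gcd c u ^ e) v" "coprime (gcd c v ^ e) u"
    using coprime_divisors[OF gcd_dvd2 dvd_refl cop, of c] coprime_divisors[OF gcd_dvd2 dvd_refl, of v u c] cop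
    by (auto simp: coprime_commute)
  ultimately show "(gcd c u, gcd c v) \<in> {c. c ^ e dvd u} \<times> {c. c ^ e dvd v}"
    by (auto simp: coprime_dvd_mult_left_iff coprime_dvd_mult_right_iff)
next
  fix z assume "z \<in> {c. c ^ e dvd u} \<times> {c. c ^ e dvd v}"
  then obtain a b where z: "z = (a, b)" "a ^ e dvd u" "b ^ e dvd v" by auto
  have ab: "a dvd u" "b dvd v" using z e dvd_power[of e a] dvd_power[of e b] dvd_trans by blast+
  have "coprime a v" "coprime b u" using cop ab by (auto intro: coprime_divisors coprime_imp_coprime dvd_trans simp: coprime_commute)
  hence "coprime b u" "coprime a v" by auto
  hence "gcd (a * b) u = gcd a u" "gcd (a * b) v = gcd b v"
    by (metis gcd_mult_left_right_cancel coprime_commute, metis gcd_mult_left_left_cancel coprime_commute)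
  thus "(gcd (case z of (c1, c2) \<Rightarrow> c1 * c2) u, gcd (case z of (c1, c2) \<Rightarrow> c1 * c2) v) = z"
    using z ab by (simp add: gcd_nat.absorb1)
  show "(case z of (c1, c2) \<Rightarrow> c1 * c2) \<in> {c. c ^ e dvd u * v}"
    using z by (simp add: power_mult_distrib mult_dvd_mono)
qed

text \<open>The number of ideals \<open>c (a \<int> + (x + \<omega>) \<int>)\<close> of norm \<open>c\<^sup>2 a = n\<close>.\<close>

definition form_count :: "int \<Rightarrow> nat \<Rightarrow> nat" where
  "form_count N n = (\<Sum>c | c\<^sup>2 dvd n. card (form_roots N (n div c\<^sup>2)))"

lemma finite_square_divisors: "n > 0 \<Longrightarrow> finite {c :: nat. c\<^sup>2 dvd n}"
  by (rule finite_subset[OF _ finite_divisors_nat[of n]]) (auto simp: power2_eq_square dvd_mult_left)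

lemma form_count_mult:
  assumes cop: "coprime u v" and pos: "u > 0" "v > 0"
  shows "form_count N (u * v) = form_count N u * form_count N v"
proof -
  have "form_count N (u * v) = (\<Sum>(a, b)\<in>{c. c\<^sup>2 dvd u} \<times> {c. c\<^sup>2 dvd v}. card (form_roots N ((u * v) div (a * b)\<^sup>2)))"
    unfolding form_count_def by (rule sum_coprime_divisor_pairs[OF cop]) simp
  also have "\<dots> = (\<Sum>(a, b)\<in>{c. c\<^sup>2 dvd u} \<times> {c. c\<^sup>2 dvd v}. card (form_roots N (u div a\<^sup>2)) * card (form_roots N (v div b\<^sup>2)))"
  proof (intro sum.cong refl, clarify)
    fix a b assume ab: "a\<^sup>2 dvd u" "b\<^sup>2 dvd v"
    have "(u * v) div (a * b)\<^sup>2 = (u div a\<^sup>2) * (v div b\<^sup>2)"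
      using ab by (simp add: power_mult_distrib div_mult_div_if_dvd)
    moreover have "coprime (u div a\<^sup>2) (v div b\<^sup>2)"
    proof (rule coprime_divisors[OF _ _ cop])
      show "u div a\<^sup>2 dvd u" using dvd_div_mult_self[OF ab(1)] dvd_triv_left by metis
      show "v div b\<^sup>2 dvd v" using dvd_div_mult_self[OF ab(2)] dvd_triv_left by metis
    qed
    moreover have "u div a\<^sup>2 > 0" "v div b\<^sup>2 > 0" using dvd_div_mult_self[OF ab(1)] dvd_div_mult_self[OF ab(2)] pos by (auto intro!: Nat.gr0I)
    ultimately show "card (form_roots N ((u * v) div (a * b)\<^sup>2)) = card (form_roots N (u div a\<^sup>2)) * card (form_roots N (v div b\<^sup>2))"
      by (simp add: card_form_roots_mult)
  qed
  also have "\<dots> = form_count N u * form_count N v"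
    by (simp add: form_count_def sum_product sum.cartesian_product)
  finally show ?thesis .
qed

lemma form_count_prime_power:
  assumes p: "prime p"
  shows "form_count N (p ^ e) = (\<Sum>i\<le>e div 2. card (form_roots N (p ^ (e - 2 * i))))"
proof -
  have p1: "p > 1" using p prime_gt_1_nat by auto
  have "(\<Sum>c | c\<^sup>2 dvd p ^ e. card (form_roots N (p ^ e div c\<^sup>2))) = (\<Sum>c\<in>(\<lambda>i. p ^ i) ` {..e div 2}. card (form_roots N (p ^ e div c\<^sup>2)))"
  proof (rule sum.cong)
    show "{c. c\<^sup>2 dvd p ^ e} = (\<lambda>i. p ^ i) ` {..e div 2}"
    proof (intro equalityI subsetI)
      fix c assume "c \<in> {c. c\<^sup>2 dvd p ^ e}"
      hence c: "c\<^sup>2 dvd p ^ e" by simp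
      hence "c dvd p ^ e" by (simp add: power2_eq_square dvd_mult_left)
      then obtain i where i: "c = p ^ i" using divides_primepow_nat[OF p] by auto
      hence "p ^ (2 * i) dvd p ^ e" using c by (simp add: power_mult[symmetric] mult.commute)
      hence "2 * i \<le> e" using p1 power_dvd_imp_le by blast
      thus "c \<in> (\<lambda>i. p ^ i) ` {..e div 2}" using i by auto
    next
      fix c assume "c \<in> (\<lambda>i. p ^ i) ` {..e div 2}"
      then obtain i where "c = p ^ i" "2 * i \<le> e" by auto
      thus "c \<in> {c. c\<^sup>2 dvd p ^ e}" by (simp add: power_mult[symmetric] mult.commute[of i] le_imp_power_dvd)
    qed
  qed simp
  also have "\<dots> = (\<Sum>i\<le>e div 2. card (form_roots N (p ^ e div (p ^ i)\<^sup>2)))"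
    using p1 by (subst sum.reindex) (auto simp: inj_on_def power_inject_exp)
  also have "\<dots> = (\<Sum>i\<le>e div 2. card (form_roots N (p ^ (e - 2 * i))))"
  proof (intro sum.cong refl)
    fix i assume "i \<in> {..e div 2}"
    hence "2 * i \<le> e" by auto
    hence "p ^ e div (p ^ i)\<^sup>2 = p ^ (e - 2 * i)"
      using p1 by (simp add: power_mult[symmetric] mult.commute[of i] power_diff)
    thus "card (form_roots N (p ^ e div (p ^ i)\<^sup>2)) = card (form_roots N (p ^ (e - 2 * i)))" by simp
  qed
  finally show ?thesis by (simp add: form_count_def)
qed

section \<open>The ideal count as a divisor sum of the character\<close>

context odd_real_primitive_character
begin

definition root_offset :: int where "root_offset = (k + 1) div 4"

lemma four_root_offset: "4 * root_offset = k + 1"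
  using k_mod_4 unfolding root_offset_def by presburger

lemma jacobi_mult: "jacobi k (m * n) = jacobi k m * jacobi k n"
proof -
  have "complex_of_int (jacobi k (m * n)) = of_int (jacobi k m * jacobi k n)"
    using mult by (simp add: eq_jacobi)
  thus ?thesis by (simp only: of_int_eq_iff)
qed

lemma jacobi_one: "jacobi k 1 = 1"
proof -
  have "complex_of_int (jacobi k 1) = of_int 1" using one by (simp add: eq_jacobi)
  thus ?thesis by (simp only: of_int_eq_iff)
qed

lemma jacobi_power: "jacobi k (m ^ i) = jacobi k m ^ i"
  by (induction i) (auto simp: jacobi_mult jacobi_one)

lemma jacobi_values: "jacobi k n \<in> {-1, 0, 1}"
proof (cases "coprime n k")
  case True
  hence "complex_of_int (jacobi k n) = of_int 1 \<or> complex_of_int (jacobi k n) = of_int (-1)"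
    using sign[of n] by (simp add: eq_jacobi)
  thus ?thesis by (simp only: of_int_eq_iff) auto
next
  case False
  thus ?thesis using not_coprime[of n] by (simp add: eq_jacobi)
qed

lemma jacobi_eq_0_iff: "jacobi k n = 0 \<longleftrightarrow> \<not> coprime n k"
  using not_coprime[of n] nonzero[of n] by (auto simp: eq_jacobi)

text \<open>Modulo 2 there are two roots or none according to the parity of N, that is, according to
  k being 7 or 3 modulo 8, which is the law for \<chi>(2). For odd p the discriminant -k enters
  through \<open>eq_Legendre\<close>.\<close>

lemma card_roots_prime:
  assumes p: "prime p"
  shows "int (card (form_roots root_offset p)) = 1 + jacobi k (int p)"
proof (cases "p = 2")
  case True
  have "even root_offset \<longleftrightarrow> k mod 8 = 7" using four_root_offset k_mod_4 by presburger
  moreover have "complex_of_int (jacobi k 2) = of_int (if k mod 8 = 7 then 1 else - 1)"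
    using two by (simp add: eq_jacobi)
  hence "jacobi k 2 = (if k mod 8 = 7 then 1 else - 1)" by (simp only: of_int_eq_iff)
  ultimately show ?thesis using True by (simp add: card_form_roots_two)
next
  case False
  hence p2: "p > 2" using p prime_ge_2_nat[of p] by simp
  have "complex_of_int (jacobi k (int p)) = of_int (Legendre (- k) (int p))"
    using eq_Legendre[of "int p"] p p2 by (simp add: eq_jacobi)
  hence "jacobi k (int p) = Legendre (- k) (int p)" by (simp only: of_int_eq_iff)
  moreover have "1 - 4 * root_offset = - k" using four_root_offset by simp
  ultimately show ?thesis using card_form_roots_prime[OF p p2, of root_offset] by simp
qed

text \<open>The count is 2 or 0. It is written as the increment of the geometric sum of \<chi>(p)^i
  from e to e + 2, because the count of ideals of norm p^(e + 2) exceeds that of norm p^e by the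
  number of roots.\<close>

lemma card_roots_prime_power:
  assumes p: "prime p"
  shows "int (card (form_roots root_offset (p ^ (e + 2)))) = jacobi k (int p) ^ (e + 1) + jacobi k (int p) ^ (e + 2)"
proof -
  have disc: "1 - 4 * root_offset = - k" using four_root_offset by simp
  have p': "prime (int p)" using p by simp
  show ?thesis
  proof (cases "int p dvd k")
    case True
    hence "\<not> coprime (int p) k" using p' by (meson dvd_refl not_coprimeI not_prime_unit)
    hence j: "jacobi k (int p) = 0" by (simp add: jacobi_eq_0_iff)
    have "\<not> (int p)\<^sup>2 dvd - k" using squarefreeD[OF squarefree, of "int p"] p' not_prime_unit by auto
    hence "form_roots root_offset (p ^ (e + 2)) = {}"
      by (intro form_roots_ramified) (use p True disc in auto)
    thus ?thesis unfolding \<open>form_roots root_offset (p ^ (e + 2)) = {}\<close> using j by simp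
  next
    case False
    hence "coprime (int p) k" using p' by (simp add: prime_imp_coprime)
    hence j: "jacobi k (int p) = 1 \<or> jacobi k (int p) = - 1" using jacobi_values[of "int p"] jacobi_eq_0_iff by auto
    have "card (form_roots root_offset (p ^ Suc (e + 1))) = card (form_roots root_offset p)"
      by (rule card_form_roots_power) (use p False disc in auto)
    hence "int (card (form_roots root_offset (p ^ (e + 2)))) = 1 + jacobi k (int p)"
      using card_roots_prime[OF p] by simp
    thus ?thesis using j by (auto simp: minus_one_power_iff)
  qed
qed

lemma form_count_prime_power_eq:
  assumes p: "prime p"
  shows "int (form_count root_offset (p ^ e)) = (\<Sum>i\<le>e. jacobi k (int p) ^ i)"
proof (induction e rule: nat_induct2)
  case 0
  show ?case by (simp add: form_count_prime_power[OF p] del: power_0) simp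
next
  case 1
  show ?case using card_roots_prime[OF p] using form_count_prime_power[OF p, of root_offset 1] by simp
next
  case (step e)
  have "form_count root_offset (p ^ (e + 2)) = (\<Sum>i\<le>Suc (e div 2). card (form_roots root_offset (p ^ (e + 2 - 2 * i))))"
    using form_count_prime_power[OF p, of root_offset "e + 2"] by simp
  also have "\<dots> = card (form_roots root_offset (p ^ (e + 2))) + form_count root_offset (p ^ e)"
    unfolding sum.atMost_Suc_shift form_count_prime_power[OF p] by simp
  finally show ?case using step card_roots_prime_power[OF p, of e] by simp
qed

lemma form_count_eq:
  assumes "n > 0"
  shows "int (form_count root_offset n) = (\<Sum>d | d dvd n. jacobi k (int d))"
  using assms
proof (induction n rule: less_induct)
  case (less n)
  show ?case
  proof (cases "n = 1")
    case True
    have "{c :: nat. c\<^sup>2 dvd 1} = {1}" by auto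
    thus ?thesis using True by (simp add: form_count_def jacobi_one)
  next
    case False
    then obtain p where p: "prime p" "p dvd n" using prime_factor_nat by blast
    obtain m where m: "\<not> p dvd m" "n = p ^ multiplicity p n * m"
      using multiplicity_decompose'[of n p] less.prems p not_prime_unit by (metis less_numeral_extra(3) mult.commute)
    define e where "e = multiplicity p n"
    have e: "n = p ^ e * m" using m by (simp add: e_def)
    have e0: "e > 0" using p less.prems by (simp add: e_def prime_multiplicity_gt_zero_iff prime_imp_prime_elem)
    have m0: "m > 0" using e less.prems by (cases m) auto
    have p1: "p > 1" using p prime_gt_1_nat by auto
    have "1 < p ^ e" by (rule one_less_power[OF p1 e0])
    hence mn: "m < n" using e m0 by simp
    have cop: "coprime (p ^ e) m" using p m by (simp add: prime_imp_coprime)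
    have "int (form_count root_offset n) = int (form_count root_offset (p ^ e)) * int (form_count root_offset m)"
      unfolding e using form_count_mult[OF cop _ m0] p1 by simp
    also have "\<dots> = (\<Sum>i\<le>e. jacobi k (int p) ^ i) * (\<Sum>d | d dvd m. jacobi k (int d))"
      unfolding form_count_prime_power_eq[OF p(1)] less.IH[OF mn m0] ..
    also have "(\<Sum>i\<le>e. jacobi k (int p) ^ i) = (\<Sum>d | d dvd p ^ e. jacobi k (int d))"
    proof -
      have "{d. d dvd p ^ e} = (\<lambda>i. p ^ i) ` {..e}"
        using divides_primepow_nat[OF p(1)] by (auto simp: le_imp_power_dvd)
      hence "(\<Sum>d | d dvd p ^ e. jacobi k (int d)) = (\<Sum>i\<le>e. jacobi k (int (p ^ i)))"
        using p1 by (subst \<open>{d. d dvd p ^ e} = _\<close>, subst sum.reindex) (auto simp: inj_on_def power_inject_exp)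
      thus ?thesis by (simp add: jacobi_power)
    qed
    also have "\<dots> * (\<Sum>d | d dvd m. jacobi k (int d)) = (\<Sum>(a, b)\<in>{d. d dvd p ^ e} \<times> {d. d dvd m}. jacobi k (int (a * b)))"
      by (simp add: sum_product sum.cartesian_product jacobi_mult)
    also have "\<dots> = (\<Sum>d | d dvd n. jacobi k (int d))"
      using sum_coprime_divisor_pairs[OF cop, of 1 "\<lambda>d. jacobi k (int d)"] by (simp add: e)
    finally show ?thesis .
  qed
qed

end

section \<open>The ring of integers\<close>

text \<open>Every power of the denominator q divides D; with q >= 2 the power of exponent D would
  give 2^D <= D.\<close>

lemma int_if_bounded_denominators:
  fixes r :: real
  assumes r: "r \<in> \<rat>" and D: "D > 0" and pow: "\<And>j. of_int D * r ^ j \<in> \<int>"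
  shows "r \<in> \<int>"
proof -
  obtain p q where pq: "q > 0" "coprime p q" "r = of_int p / of_int q" using r by (rule Rats_cases')
  have dv: "q ^ j dvd D" for j
  proof -
    obtain m where "of_int D * r ^ j = of_int m" using pow[of j] by (auto elim: Ints_cases)
    hence "of_int D * of_int p ^ j = (of_int m * of_int q ^ j :: real)" using pq by (simp add: power_divide field_simps)
    hence "real_of_int (D * p ^ j) = real_of_int (m * q ^ j)" by simp
    hence "D * p ^ j = m * q ^ j" by (simp only: of_int_eq_iff)
    hence "q ^ j dvd D * p ^ j" by simp
    moreover have "coprime (q ^ j) (p ^ j)" using pq(2) by (simp add: coprime_commute)
    ultimately show ?thesis by (simp add: coprime_dvd_mult_left_iff)
  qed
  have "q = 1"
  proof (rule ccontr)
    assume "q \<noteq> 1"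
    hence "q \<ge> 2" using pq by simp
    hence "2 ^ nat D \<le> q ^ nat D" by (intro power_mono) auto
    also have "q ^ nat D \<le> D" using dv D by (intro zdvd_imp_le) auto
    finally have "2 ^ nat D \<le> D" .
    moreover have "int (nat D) < int (2 ^ nat D)" using less_exp[of "nat D"] by (simp only: of_nat_less_iff)
    ultimately show False using D by simp
  qed
  thus ?thesis using pq by simp
qed

lemma int_subgroup_generator:
  fixes A :: "int set"
  assumes diff: "\<And>x y. x \<in> A \<Longrightarrow> y \<in> A \<Longrightarrow> x - y \<in> A" and a: "a \<in> A" "a \<noteq> 0"
  obtains c where "c > 0" "A = range (\<lambda>n. c * n)"
proof -
  have 0: "0 \<in> A" using diff[OF a(1) a(1)] by simp
  have neg: "- x \<in> A" if "x \<in> A" for x using diff[OF 0 that] by simp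
  have plus: "x + y \<in> A" if "x \<in> A" "y \<in> A" for x y using diff[OF that(1) neg[OF that(2)]] by simp
  define c where "c = (LEAST n::nat. n > 0 \<and> int n \<in> A)"
  have "\<bar>a\<bar> \<in> A" using a neg[OF a(1)] by (simp add: abs_if)
  hence "nat \<bar>a\<bar> > 0 \<and> int (nat \<bar>a\<bar>) \<in> A" using a by simp
  hence c: "c > 0 \<and> int c \<in> A" unfolding c_def by (rule LeastI)
  have least: "c \<le> n" if "n > 0" "int n \<in> A" for n unfolding c_def using that by (intro Least_le) simp
  have natm: "int c * int n \<in> A" for n
  proof (induction n)
    case (Suc n)
    thus ?case using plus[of "int c * int n" "int c"] c by (simp add: algebra_simps)
  qed (simp add: 0)
  have multi: "int c * n \<in> A" for n
  proof (cases "n \<ge> 0")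
    case True
    thus ?thesis using natm[of "nat n"] by simp
  next
    case False
    thus ?thesis using neg[OF natm[of "nat (- n)"]] by simp
  qed
  have "A \<subseteq> range (\<lambda>n. int c * n)"
  proof
    fix x assume x: "x \<in> A"
    have "x mod int c = x - int c * (x div int c)" by (simp add: minus_mult_div_eq_mod)
    hence m: "x mod int c \<in> A" using diff[OF x multi] by simp
    have "x mod int c = 0"
    proof (rule ccontr)
      assume "x mod int c \<noteq> 0"
      moreover have "x mod int c \<ge> 0" "x mod int c < int c" using c by auto
      ultimately have "nat (x mod int c) > 0" "int (nat (x mod int c)) \<in> A" "nat (x mod int c) < c" using m by auto
      thus False using least[of "nat (x mod int c)"] by linarith
    qed
    hence "x = int c * (x div int c)" by (simp add: minus_mod_eq_mult_div[symmetric])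
    thus "x \<in> range (\<lambda>n. int c * n)" by blast
  qed
  thus ?thesis using that[of "int c"] c multi by auto
qed

locale imaginary_quadratic =
  fixes k :: int
  assumes k_ge: "k \<ge> 7" and k_mod: "k mod 4 = 3" and k_squarefree: "squarefree k"
begin

definition "offset = (k + 1) div 4"

lemma offset: "4 * offset = k + 1" using k_mod unfolding offset_def by presburger

definition "rk = sqrt (real_of_int k)"

lemma rk: "rk > 0" "rk * rk = real_of_int k" "rk\<^sup>2 = real_of_int k" using k_ge by (auto simp: rk_def)

text \<open>\<open>elt u v\<close> is \<open>u + v \<omega>\<close> with \<open>\<omega> = (1 + \<surd>-k) / 2\<close>.\<close>

definition elt :: "int \<Rightarrow> int \<Rightarrow> complex" where
  "elt u v = Complex (of_int u + of_int v / 2) (of_int v * rk / 2)"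

lemma elt_eq_iff: "elt u v = elt u' v' \<longleftrightarrow> u = u' \<and> v = v'"
  using rk by (auto simp: elt_def)

lemma elt_0: "elt 0 0 = 0" and elt_1: "elt 1 0 = 1"
  by (simp_all add: elt_def complex_eq_iff)

lemma elt_eq_0_iff: "elt u v = 0 \<longleftrightarrow> u = 0 \<and> v = 0"
  using elt_eq_iff[of u v 0 0] by (simp add: elt_0)

lemma elt_add: "elt u v + elt u' v' = elt (u + u') (v + v')"
  and elt_diff: "elt u v - elt u' v' = elt (u - u') (v - v')"
  and elt_minus: "- elt u v = elt (- u) (- v)"
  by (simp_all add: elt_def complex_eq_iff algebra_simps add_divide_distrib diff_divide_distrib)

lemma offset_real: "real_of_int k = 4 * real_of_int offset - 1"
proof -
  have "real_of_int (4 * offset) = real_of_int (k + 1)" using offset by (simp only:)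
  thus ?thesis by simp
qed

text \<open>The multiplication rule of \<omega>^2 = \<omega> - \<open>offset\<close>.\<close>

lemma elt_mult: "elt u v * elt u' v' = elt (u * u' - offset * (v * v')) (u * v' + v * u' + v * v')"
proof (rule complex_eqI)
  have "(of_int v * rk / 2) * (of_int v' * rk / 2) = of_int v * of_int v' * (rk * rk) / 4"
    by (simp add: field_simps)
  hence e: "(of_int v * rk / 2) * (of_int v' * rk / 2) = of_int v * of_int v' * (4 * real_of_int offset - 1) / 4"
    unfolding rk(2) offset_real .
  have "Re (elt u v * elt u' v') = (of_int u + of_int v / 2) * (of_int u' + of_int v' / 2) - (of_int v * rk / 2) * (of_int v' * rk / 2)"
    by (simp add: elt_def)
  also have "\<dots> = Re (elt (u * u' - offset * (v * v')) (u * v' + v * u' + v * v'))"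
    unfolding e by (simp add: elt_def field_simps)
  finally show "Re (elt u v * elt u' v') = Re (elt (u * u' - offset * (v * v')) (u * v' + v * u' + v * v'))" .
qed (simp add: elt_def field_simps)

lemma cnj_elt: "cnj (elt u v) = elt (u + v) (- v)"
  by (simp add: elt_def complex_eq_iff)

lemma norm_elt: "(cmod (elt u v))\<^sup>2 = of_int (u\<^sup>2 + u * v + offset * v\<^sup>2)"
proof -
  have "(cmod (elt u v))\<^sup>2 = (of_int u + of_int v / 2)\<^sup>2 + (of_int v)\<^sup>2 * rk\<^sup>2 / 4"
    by (simp add: elt_def cmod_power2 power_mult_distrib power_divide)
  also have "\<dots> = of_int (u\<^sup>2 + u * v + offset * v\<^sup>2)"
    using offset_real rk(3) by (simp add: power2_eq_square) (simp add: field_simps)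
  finally show ?thesis .
qed

definition ints :: "complex set" where "ints = {elt u v | u v. True}"

lemma elt_in_ints [simp]: "elt u v \<in> ints" by (auto simp: ints_def)

lemma ints_closed: "x \<in> ints \<Longrightarrow> y \<in> ints \<Longrightarrow> x + y \<in> ints" "x \<in> ints \<Longrightarrow> y \<in> ints \<Longrightarrow> x * y \<in> ints"
  "x \<in> ints \<Longrightarrow> - x \<in> ints" "0 \<in> ints" "1 \<in> ints"
  unfolding ints_def using elt_0 elt_1 by (auto simp: elt_add elt_mult elt_minus) metis+

lemma csqrt_minus_k: "csqrt (of_int (- k)) = \<i> * of_real rk"
  using k_ge by (simp add: rk_def complex_eq_iff)

lemma ints_algebraic: "algebraic_int (elt u v)"
proof -
  \<comment> \<open>Trace and norm of the element, which give its monic equation.\<close>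
  define t n where "t = 2 * u + v" and "n = u\<^sup>2 + u * v + offset * v\<^sup>2"
  define p :: "complex poly" where "p = [:of_int n, - of_int t, 1:]"
  have sq: "elt u v * elt u v = elt (u * u - offset * (v * v)) (2 * (u * v) + v * v)"
    by (simp add: elt_mult algebra_simps)
  have "of_int n = elt n 0" "of_int t = elt t 0" by (simp_all add: elt_def complex_eq_iff)
  hence "poly p (elt u v) = elt n 0 - elt t 0 * elt u v + elt u v * elt u v"
    by (simp add: p_def algebra_simps)
  also have "\<dots> = 0" unfolding elt_mult elt_add elt_diff elt_eq_0_iff
    by (simp add: t_def n_def power2_eq_square algebra_simps)
  finally have "poly p (elt u v) = 0" .
  moreover have "lead_coeff p = 1" by (simp add: p_def)
  moreover have "\<forall>i. poly.coeff p i \<in> \<int>" by (auto simp: p_def coeff_pCons split: nat.splits)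
  ultimately show ?thesis by (intro algebraic_int.intros)
qed

lemma elt_in_field: "elt u v \<in> quadratic_field (- k)"
proof -
  have "elt u v = of_rat (of_int u + of_int v / 2) + of_rat (of_int v / 2) * csqrt (of_int (- k))"
    unfolding csqrt_minus_k by (simp add: elt_def complex_eq_iff of_rat_add of_rat_divide)
  thus ?thesis unfolding quadratic_field_def using Rats_of_rat by blast
qed

text \<open>The powers of an algebraic integer of the field have bounded denominators, hence so do the
  powers of its norm, which is therefore an integer.\<close>

lemma field_powers_bounded_denominator:
  assumes z: "z \<in> quadratic_field (- k)" "algebraic_int z"
  obtains D :: int where "D > 0" "\<And>j. of_int D * z ^ j \<in> ints"
proof -
  obtain x y where xy: "x \<in> \<rat>" "y \<in> \<rat>" "z = x + y * csqrt (of_int (- k))"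
    using z(1) by (auto simp: quadratic_field_def)
  obtain x1 x2 where x: "x2 > 0" "x = of_int x1 / of_int x2" using xy(1) by (rule Rats_cases') blast
  obtain y1 y2 where y: "y2 > 0" "y = of_int y1 / of_int y2" using xy(2) by (rule Rats_cases') blast
  define b where "b = x2 * y2"
  have b: "b > 0" using x y by (simp add: b_def)
  have "x * of_int x2 = of_int x1" "y * of_int y2 = of_int y1" using x y by auto
  moreover have "of_int b * z = (x * of_int x2) * of_int y2 + (y * of_int y2) * of_int x2 * csqrt (of_int (- k))"
    unfolding b_def xy(3) by (simp add: algebra_simps)
  ultimately have "of_int b * z = of_int (x1 * y2) + of_int (y1 * x2) * (\<i> * of_real rk)"
    by (simp only: csqrt_minus_k of_int_mult)
  also have "\<dots> = elt (x1 * y2 - y1 * x2) (2 * (y1 * x2))"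
    by (simp add: elt_def complex_eq_iff)
  finally have bz: "of_int b * z \<in> ints" by simp
  have of_int: "of_int n \<in> ints" for n
  proof -
    have "of_int n = elt n 0" by (simp add: elt_def complex_eq_iff)
    thus ?thesis by simp
  qed
  have pw: "(of_int b * z) ^ i \<in> ints" for i
    by (induction i) (auto intro: ints_closed bz)
  obtain p where p: "poly (map_poly of_int p) z = 0" "lead_coeff p = 1"
    using z(2) unfolding algebraic_int_altdef_ipoly by blast
  define d where "d = degree p"
  have deg: "degree (map_poly of_int p :: complex poly) = d" unfolding d_def by (rule degree_map_poly) auto
  have "(\<Sum>i\<le>d. of_int (poly.coeff p i) * z ^ i) = 0"
    using p(1) by (simp add: poly_altdef deg coeff_map_poly)
  hence "(\<Sum>i<d. of_int (poly.coeff p i) * z ^ i) + of_int (poly.coeff p d) * z ^ d = 0"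
    by (simp only: lessThan_Suc_atMost[symmetric] sum.lessThan_Suc)
  moreover have "poly.coeff p d = 1" using p(2) by (simp add: d_def)
  ultimately have "z ^ d + (\<Sum>i<d. of_int (poly.coeff p i) * z ^ i) = 0" by (simp add: add.commute)
  hence zd: "z ^ d = - (\<Sum>i<d. of_int (poly.coeff p i) * z ^ i)" by (simp only: eq_neg_iff_add_eq_0)
  \<comment> \<open>The factor b^d clears the denominators of all powers below d. From d on, the
    monic equation rewrites z^j by lower powers with integer coefficients, so the same factor still
    suffices.\<close>
  have "of_int (b ^ d) * z ^ j \<in> ints" for j
  proof (induction j rule: less_induct)
    case (less j)
    show ?case
    proof (cases "j < d")
      case True
      have "of_int (b ^ d) * z ^ j = of_int (b ^ (d - j)) * (of_int b * z) ^ j"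
        using True by (simp add: power_mult_distrib power_add[symmetric])
      also have "\<dots> \<in> ints" by (intro ints_closed(2) of_int pw)
      finally show ?thesis .
    next
      case False
      have sumc: "sum f S \<in> ints" if "\<And>i. i \<in> S \<Longrightarrow> f i \<in> ints" for f :: "nat \<Rightarrow> complex" and S
        using that by (induction S rule: infinite_finite_induct) (auto intro: ints_closed)
      have "z ^ j = z ^ (j - d) * z ^ d" using False by (simp add: power_add[symmetric])
      also have "\<dots> = - (\<Sum>i<d. of_int (poly.coeff p i) * z ^ (j - d + i))"
        by (simp add: zd sum_distrib_left power_add ac_simps)
      finally have "of_int (b ^ d) * z ^ j = - (\<Sum>i<d. of_int (poly.coeff p i) * (of_int (b ^ d) * z ^ (j - d + i)))"
        by (simp add: sum_distrib_left ac_simps)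
      also have "\<dots> \<in> ints"
        by (intro ints_closed(3) sumc ints_closed(2) of_int less.IH) (use False in auto)
      finally show ?thesis .
    qed
  qed
  thus ?thesis using that[of "b ^ d"] b by simp
qed

lemma square_cmod_int_if_bounded:
  assumes r: "(cmod z)\<^sup>2 \<in> \<rat>" and D: "D > 0" "\<And>j. of_int D * z ^ j \<in> ints"
  shows "(cmod z)\<^sup>2 \<in> \<int>"
proof (rule int_if_bounded_denominators[OF r])
  show "D\<^sup>2 > 0" using D by simp
  fix j
  obtain u v where "of_int D * z ^ j = elt u v" using D(2)[of j] by (auto simp: ints_def)
  hence "(cmod (of_int D * z ^ j))\<^sup>2 \<in> \<int>" by (simp add: norm_elt del: of_int_add of_int_mult of_int_power)
  thus "of_int (D\<^sup>2) * (cmod z)\<^sup>2 ^ j \<in> \<int>"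
    by (simp add: norm_mult norm_power power_mult_distrib power_mult[symmetric] mult.commute)
qed

lemma rational_square_k:
  fixes s :: real
  assumes s: "s \<in> \<rat>" and i: "real_of_int k * s\<^sup>2 \<in> \<int>"
  shows "s \<in> \<int>"
proof -
  obtain p q where pq: "q > 0" "coprime p q" "s = of_int p / of_int q" using s by (rule Rats_cases')
  obtain m where "real_of_int k * s\<^sup>2 = of_int m" using i by (auto elim: Ints_cases)
  hence "real_of_int (k * p\<^sup>2) = real_of_int (m * q\<^sup>2)" using pq by (simp add: power_divide field_simps)
  hence "k * p\<^sup>2 = m * q\<^sup>2" by (simp only: of_int_eq_iff)
  hence "q\<^sup>2 dvd k * p\<^sup>2" by simp
  moreover have "coprime (q\<^sup>2) (p\<^sup>2)" using pq(2) by (simp add: coprime_commute)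
  ultimately have "q\<^sup>2 dvd k" by (simp add: coprime_dvd_mult_left_iff)
  hence "q dvd 1" using squarefreeD[OF k_squarefree] by blast
  thus ?thesis using pq by simp
qed

text \<open>Write z = X + Y sqrt(-k). By the binomial theorem z + 1 inherits the bounded
  denominators, so the norms of z and z + 1 are integers and their difference yields the trace 2X.
  Then k (2Y)^2 is an integer, and as k is squarefree 2Y is one too. Since k is odd, integrality of
  the norm forces 2X and 2Y to have the same parity.\<close>

lemma algebraic_int_in_ints:
  assumes z: "z \<in> quadratic_field (- k)" "algebraic_int z"
  shows "z \<in> ints"
proof -
  obtain x y where xy: "x \<in> \<rat>" "y \<in> \<rat>" "z = x + y * csqrt (of_int (- k))"
    using z(1) by (auto simp: quadratic_field_def)
  obtain x1 x2 where x: "x = of_int x1 / of_int x2" using xy(1) by (rule Rats_cases') blast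
  obtain y1 y2 where y: "y = of_int y1 / of_int y2" using xy(2) by (rule Rats_cases') blast
  define X Y where "X = real_of_int x1 / real_of_int x2" and "Y = real_of_int y1 / real_of_int y2"
  have XY: "X \<in> \<rat>" "Y \<in> \<rat>" by (auto simp: X_def Y_def)
  have "x = of_real X" "y = of_real Y"
    by (simp_all add: X_def Y_def x y)
  hence zXY: "z = Complex X (Y * rk)" unfolding xy(3) csqrt_minus_k by (simp add: complex_eq_iff)
  obtain D where D: "D > 0" "\<And>j. of_int D * z ^ j \<in> ints"
    using field_powers_bounded_denominator[OF z] by blast
  have n: "(cmod (z + of_int e))\<^sup>2 = (X + of_int e)\<^sup>2 + of_int k * Y\<^sup>2" for e :: int
    using rk by (simp add: zXY cmod_power2 power_mult_distrib)
  have sumc: "sum f S \<in> ints" if "\<And>i. i \<in> S \<Longrightarrow> f i \<in> ints" for f :: "nat \<Rightarrow> complex" and S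
    using that by (induction S rule: infinite_finite_induct) (auto intro: ints_closed)
  have D1: "of_int D * (z + 1) ^ j \<in> ints" for j
  proof -
    have "(z + 1) ^ j = (\<Sum>i\<le>j. of_nat (j choose i) * z ^ i)" using binomial_ring[of z 1 j] by simp
    hence "of_int D * (z + 1) ^ j = (\<Sum>i\<le>j. of_nat (j choose i) * (of_int D * z ^ i))"
      by (simp add: sum_distrib_left mult.left_commute)
    also have "\<dots> \<in> ints"
    proof (rule sumc, rule ints_closed(2)[OF _ D(2)])
      fix i
      have "of_nat (j choose i) = elt (int (j choose i)) 0" by (simp add: elt_def complex_eq_iff)
      thus "of_nat (j choose i) \<in> ints" by simp
    qed
    finally show ?thesis .
  qed
  have i0: "X\<^sup>2 + of_int k * Y\<^sup>2 \<in> \<int>"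
    using square_cmod_int_if_bounded[OF _ D] n[of 0] XY by (simp add: Rats_add Rats_mult Rats_power)
  have i1: "(X + 1)\<^sup>2 + of_int k * Y\<^sup>2 \<in> \<int>"
    using square_cmod_int_if_bounded[OF _ D(1) D1] n[of 1] XY by (simp add: Rats_add Rats_mult Rats_power)
  have "2 * X = ((X + 1)\<^sup>2 + of_int k * Y\<^sup>2) - (X\<^sup>2 + of_int k * Y\<^sup>2) - 1"
    by (simp add: power2_eq_square algebra_simps)
  also have "\<dots> \<in> \<int>" by (intro Ints_diff i0 i1 Ints_1)
  finally obtain t where t: "2 * X = of_int t" by (auto elim: Ints_cases)
  have "real_of_int k * (2 * Y)\<^sup>2 = 4 * (X\<^sup>2 + of_int k * Y\<^sup>2) - (2 * X)\<^sup>2"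
    by (simp add: power2_eq_square algebra_simps)
  also have "\<dots> \<in> \<int>" unfolding t using i0 by (intro Ints_diff Ints_mult) auto
  finally have ks: "real_of_int k * (2 * Y)\<^sup>2 \<in> \<int>" .
  have "2 * Y \<in> \<int>" by (rule rational_square_k[OF _ ks]) (use XY in auto)
  then obtain s where s: "2 * Y = of_int s" by (auto elim: Ints_cases)
  obtain n where "X\<^sup>2 + of_int k * Y\<^sup>2 = of_int n" using i0 by (auto elim: Ints_cases)
  hence "(2 * X)\<^sup>2 + of_int k * (2 * Y)\<^sup>2 = 4 * of_int n" by (simp add: power2_eq_square algebra_simps)
  hence "real_of_int (t\<^sup>2 + k * s\<^sup>2) = real_of_int (4 * n)" unfolding t s by simp
  hence tn: "t\<^sup>2 + k * s\<^sup>2 = 4 * n" by (simp only: of_int_eq_iff)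
  have "odd k" using k_mod by presburger
  have "even (t\<^sup>2 + k * s\<^sup>2)" unfolding tn by simp
  hence "even (t - s)" using \<open>odd k\<close> by auto
  then obtain u where u: "t = s + 2 * u" by (metis dvd_def diff_add_cancel add.commute)
  have "X = of_int u + of_int s / 2" "Y = of_int s / 2" using t s u by auto
  hence "z = elt u s" by (simp add: zXY elt_def)
  thus ?thesis by simp
qed

lemma carrier_eq: "carrier (quadratic_integers (- k)) = ints"
proof -
  have "x \<in> quadratic_field (- k) \<and> algebraic_int x" if "x \<in> ints" for x
    using that elt_in_field ints_algebraic by (auto simp: ints_def)
  thus ?thesis using algebraic_int_in_ints by (auto simp: quadratic_integers_def)
qed

abbreviation "R \<equiv> quadratic_integers (- k)"

lemma R_simps: "mult R = (*)" "one R = 1" "zero R = 0" "add R = (+)" "carrier R = ints"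
  using carrier_eq by (simp_all add: quadratic_integers_def)

lemma cring_R: "cring R"
proof (rule cringI)
  show "abelian_group R"
  proof (rule abelian_groupI)
    fix x assume "x \<in> carrier R"
    thus "\<exists>y\<in>carrier R. y \<oplus>\<^bsub>R\<^esub> x = \<zero>\<^bsub>R\<^esub>" using ints_closed(3) by (intro bexI[of _ "- x"]) (auto simp: R_simps)
  qed (auto simp: R_simps intro: ints_closed)
  show "comm_monoid R" by (rule comm_monoidI) (auto simp: R_simps intro: ints_closed)
qed (auto simp: R_simps ring_distribs)

lemma ideal_iff:
  "ideal I R \<longleftrightarrow> I \<subseteq> ints \<and> 0 \<in> I \<and> (\<forall>x\<in>I. \<forall>y\<in>I. x + y \<in> I) \<and> (\<forall>x\<in>I. \<forall>r\<in>ints. r * x \<in> I)"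
proof
  assume "ideal I R"
  then interpret ideal I R .
  show "I \<subseteq> ints \<and> 0 \<in> I \<and> (\<forall>x\<in>I. \<forall>y\<in>I. x + y \<in> I) \<and> (\<forall>x\<in>I. \<forall>r\<in>ints. r * x \<in> I)"
    using a_subset additive_subgroup.zero_closed[OF additive_subgroup_axioms]
      additive_subgroup.a_closed[OF additive_subgroup_axioms] I_l_closed by (auto simp: R_simps)
next
  assume *: "I \<subseteq> ints \<and> 0 \<in> I \<and> (\<forall>x\<in>I. \<forall>y\<in>I. x + y \<in> I) \<and> (\<forall>x\<in>I. \<forall>r\<in>ints. r * x \<in> I)"
  interpret cring R by (rule cring_R)
  show "ideal I R"
  proof (rule idealI)
    show "ring R" by (rule ring_axioms)
    have inv: "inv\<^bsub>add_monoid R\<^esub> x = - x" if "x \<in> ints" for x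
    proof -
      have "\<ominus>\<^bsub>R\<^esub> x = - x"
        by (rule minus_equality[of "- x" x]) (use that ints_closed(3) in \<open>auto simp: R_simps\<close>)
      thus ?thesis by (simp add: a_inv_def)
    qed
    show "subgroup I (add_monoid R)"
    proof
      fix x assume x: "x \<in> I"
      have "- 1 \<in> ints" using ints_closed(3,5) by blast
      hence "- 1 * x \<in> I" using * x by blast
      thus "inv\<^bsub>add_monoid R\<^esub> x \<in> I" using inv[of x] * x by auto
    qed (use * in \<open>auto simp: R_simps\<close>)
  qed (use * in \<open>auto simp: R_simps mult.commute\<close>)
qed

lemma nonzero_ideals_iff: "I \<in> nonzero_ideals R \<longleftrightarrow> ideal I R \<and> I \<noteq> {0}"
  by (simp add: nonzero_ideals_def R_simps)

lemma l_coset_R: "a <#\<^bsub>R\<^esub> I = (*) a ` I"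
  by (auto simp: l_coset_def R_simps)

end

section \<open>Ideals and ideal classes\<close>

context imaginary_quadratic
begin

text \<open>\<open>idl (c, a, x)\<close> is the ideal \<open>c (a \<int> + (x + \<omega>) \<int>)\<close>, of norm \<open>c\<^sup>2 a\<close>.\<close>

definition idl :: "nat \<times> nat \<times> int \<Rightarrow> complex set" where
  "idl = (\<lambda>(c, a, x). {elt (int c * (int a * m + x * n)) (int c * n) | m n. True})"

text \<open>Normal forms: every nonzero ideal is \<open>idl t\<close> for exactly one such triple.
  Divisibility of x^2 + x + N by a makes the lattice stable under \<omega>, and reducing x modulo a
  makes the basis unique.\<close>

definition triples :: "(nat \<times> nat \<times> int) set" where
  "triples = {(c, a, x). c > 0 \<and> a > 0 \<and> x \<in> form_roots offset a}"

definition tnorm :: "nat \<times> nat \<times> int \<Rightarrow> nat" where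
  "tnorm = (\<lambda>(c, a, x). c\<^sup>2 * a)"

lemma triples_cofactor:
  assumes "(c, a, x) \<in> triples"
  obtains b where "x\<^sup>2 + x + offset = int a * b"
  using assms by (auto simp: triples_def form_roots_def)

lemma idl_ideal:
  assumes t: "t \<in> triples"
  shows "idl t \<in> nonzero_ideals R"
proof -
  obtain c a x where tt: "t = (c, a, x)" by (cases t)
  have ca: "c > 0" "a > 0" using t by (auto simp: tt triples_def)
  obtain b where b: "x\<^sup>2 + x + offset = int a * b" using triples_cofactor t tt by blast
  have "r * z \<in> idl t" if z: "z \<in> idl t" and r: "r \<in> ints" for z r
  proof -
    obtain m n where z': "z = elt (int c * (int a * m + x * n)) (int c * n)" using z by (auto simp: idl_def tt)
    obtain p q where r': "r = elt p q" using r by (auto simp: ints_def)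
    \<comment> \<open>The coordinates of the product in the basis a, x + \<omega>: n' is its
      \<omega>-coordinate, and M is what remains after x^2 + x + N = a b is used.\<close>
    define M n' where "M = p * m - x * q * m - q * n * b" and "n' = p * n + q * (int a * m + x * n) + q * n"
    have "int a * M + x * n' = p * (int a * m + x * n) + q * n * (x\<^sup>2 + x - int a * b)"
      by (simp add: M_def n'_def power2_eq_square algebra_simps)
    also have "x\<^sup>2 + x - int a * b = - offset" using b by simp
    finally have M: "int a * M + x * n' = p * (int a * m + x * n) - offset * (q * n)"
      by (simp add: algebra_simps)
    have "r * z = elt (int c * (int a * M + x * n')) (int c * n')"
      unfolding M by (simp add: r' z' elt_mult elt_eq_iff n'_def algebra_simps)
    thus ?thesis by (auto simp: idl_def tt)
  qed
  moreover have "z + z' \<in> idl t" if zz: "z \<in> idl t" "z' \<in> idl t" for z z'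
  proof -
    obtain m n where z: "z = elt (int c * (int a * m + x * n)) (int c * n)" using zz by (auto simp: idl_def tt)
    obtain m' n' where z': "z' = elt (int c * (int a * m' + x * n')) (int c * n')" using zz by (auto simp: idl_def tt)
    have "z + z' = elt (int c * (int a * (m + m') + x * (n + n'))) (int c * (n + n'))"
      by (simp add: z z' elt_add algebra_simps)
    thus ?thesis unfolding idl_def tt prod.case by blast
  qed
  moreover have "0 \<in> idl t"
  proof -
    have "0 = elt (int c * (int a * 0 + x * 0)) (int c * 0)" by (simp add: elt_0)
    thus ?thesis unfolding idl_def tt prod.case by blast
  qed
  moreover have "idl t \<subseteq> ints" by (auto simp: idl_def tt)
  ultimately have "ideal (idl t) R" unfolding ideal_iff by blast
  moreover have "elt (int c * (int a * 1 + x * 0)) (int c * 0) \<in> idl t"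
    unfolding idl_def tt prod.case by blast
  hence "idl t \<noteq> {0}" using ca elt_eq_0_iff by auto
  ultimately show ?thesis by (simp add: nonzero_ideals_iff)
qed

text \<open>Hermite normal form: c generates the \<omega>-coordinates of I and g its rational
  integers. Multiplication by \<omega> shows that c divides g and also the other coordinate of an
  element with \<omega>-coordinate c, so c can be factored out.\<close>

lemma idl_surj:
  assumes "I \<in> nonzero_ideals R"
  obtains t where "t \<in> triples" "I = idl t"
proof -
  have I: "I \<subseteq> ints" "0 \<in> I" "\<And>x y. x \<in> I \<Longrightarrow> y \<in> I \<Longrightarrow> x + y \<in> I" "\<And>x r. x \<in> I \<Longrightarrow> r \<in> ints \<Longrightarrow> r * x \<in> I"
    and I0: "I \<noteq> {0}"
    using assms unfolding nonzero_ideals_iff ideal_iff by blast+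
  have diff: "x - y \<in> I" if "x \<in> I" "y \<in> I" for x y
  proof -
    have "- 1 \<in> ints" using ints_closed(3,5) by blast
    hence "- 1 * y \<in> I" using I(4)[OF that(2)] by blast
    from I(3)[OF that(1) this] show ?thesis by simp
  qed
  have smult: "elt (n * u) (n * v) \<in> I" if "elt u v \<in> I" for n u v
    using I(4)[OF that, of "elt n 0"] by (simp add: elt_mult)
  obtain z where z: "z \<in> I" "z \<noteq> 0" using I0 I(2) by blast
  obtain u v where uv: "z = elt u v" using z(1) I(1) by (auto simp: ints_def)
  define A where "A = {v. \<exists>u. elt u v \<in> I}"
  define B where "B = {u. elt u 0 \<in> I}"
  \<comment> \<open>The norm of z, a nonzero integer in I; it makes both coordinate groups
    nontrivial.\<close>
  define nz where "nz = u\<^sup>2 + u * v + offset * v\<^sup>2"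
  have "cnj z * z = elt nz 0"
    by (simp add: uv cnj_elt elt_mult elt_eq_iff nz_def power2_eq_square algebra_simps)
  moreover have "cnj z * z \<in> I" using I(4)[OF z(1), of "cnj z"] by (simp add: uv cnj_elt)
  ultimately have nB: "elt nz 0 \<in> I" by simp
  have nz: "nz \<noteq> 0"
  proof
    assume "nz = 0"
    hence "(cmod z)\<^sup>2 = 0" unfolding uv norm_elt nz_def[symmetric] by simp
    thus False using z by simp
  qed
  have "elt 0 1 * elt nz 0 = elt 0 nz" by (simp add: elt_mult)
  hence nA: "elt 0 nz \<in> I" using I(4)[OF nB, of "elt 0 1"] by simp
  obtain c where c: "c > 0" "A = range (\<lambda>n. c * n)"
  proof (rule int_subgroup_generator[of A nz])
    fix x y assume "x \<in> A" "y \<in> A"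
    thus "x - y \<in> A" using diff elt_diff unfolding A_def by fastforce
  qed (use nA nz in \<open>auto simp: A_def\<close>)
  obtain g where g: "g > 0" "B = range (\<lambda>n. g * n)"
  proof (rule int_subgroup_generator[of B nz])
    fix x y assume "x \<in> B" "y \<in> B"
    thus "x - y \<in> B" using diff elt_diff unfolding B_def by fastforce
  qed (use nB nz in \<open>auto simp: B_def\<close>)
  have "g * 1 \<in> B" unfolding g(2) by (rule rangeI)
  hence gI: "elt g 0 \<in> I" by (simp add: B_def)
  have "elt 0 1 * elt g 0 = elt 0 g" by (simp add: elt_mult)
  hence "elt 0 g \<in> I" using I(4)[OF gI, of "elt 0 1"] by simp
  hence "g \<in> A" by (auto simp: A_def)
  then obtain a where a: "g = c * a" using c by auto
  have apos: "a > 0" using a g c by (simp add: zero_less_mult_iff)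
  have "c * 1 \<in> A" unfolding c(2) by (rule rangeI)
  then obtain u0 where u0: "elt u0 c \<in> I" by (auto simp: A_def)
  have "elt 0 1 * elt u0 c = elt (- offset * c) (u0 + c)" by (simp add: elt_mult)
  hence "elt (- offset * c) (u0 + c) \<in> I" using I(4)[OF u0, of "elt 0 1"] by simp
  hence "u0 + c \<in> A" by (auto simp: A_def)
  then obtain y where "u0 + c = c * y" using c by auto
  hence u0': "u0 = c * (y - 1)" by (simp add: algebra_simps)
  define x where "x = (y - 1) mod a"
  have ym: "y - 1 = a * ((y - 1) div a) + x" by (simp add: x_def)
  have cx: "elt (c * x) c \<in> I"
  proof -
    define q where "q = (y - 1) div a"
    have "y - 1 = a * q + x" using ym by (simp add: q_def)
    hence "u0 - q * g = c * x" unfolding u0' a by (simp add: algebra_simps)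
    moreover have "elt u0 c - elt (q * g) (q * 0) \<in> I" by (rule diff[OF u0 smult[OF gI]])
    ultimately show ?thesis by (simp add: elt_diff)
  qed
  have ca: "elt (c * a) 0 \<in> I" using gI a by simp
  \<comment> \<open>Multiplying by the conjugate of x + \<omega> puts c times the norm of x +
    \<omega> into I, whence a divides that norm.\<close>
  have "elt (x + 1) (- 1) * elt (c * x) c = elt (c * (x\<^sup>2 + x + offset)) 0"
    by (simp add: elt_mult elt_eq_iff power2_eq_square algebra_simps)
  hence "elt (c * (x\<^sup>2 + x + offset)) 0 \<in> I" using I(4)[OF cx, of "elt (x + 1) (- 1)"] by simp
  hence "c * (x\<^sup>2 + x + offset) \<in> B" by (simp add: B_def)
  then obtain b where "c * (x\<^sup>2 + x + offset) = c * a * b" using g a by auto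
  hence b: "x\<^sup>2 + x + offset = a * b" using c(1) by simp
  define t where "t = (nat c, nat a, x)"
  have "x \<in> form_roots offset (nat a)" using b apos by (simp add: form_roots_def x_def)
  hence tT: "t \<in> triples" using c apos by (simp add: t_def triples_def)
  have it: "idl t = {elt (c * (a * m + x * n)) (c * n) | m n. True}" using c apos by (simp add: idl_def t_def)
  have "I = idl t"
  proof (intro equalityI subsetI)
    fix w assume w: "w \<in> I"
    then obtain p q where pq: "w = elt p q" using I(1) by (auto simp: ints_def)
    hence "q \<in> A" using w by (auto simp: A_def)
    then obtain n where n: "q = c * n" using c by auto
    have "elt p q - elt (n * (c * x)) (n * c) \<in> I" using diff[OF w smult[OF cx]] pq by simp
    hence "p - n * (c * x) \<in> B" by (simp add: elt_diff n B_def mult.commute)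
    then obtain m where "p - n * (c * x) = c * a * m" using g a by auto
    hence "p = c * (a * m + x * n)" by (simp add: algebra_simps)
    thus "w \<in> idl t" unfolding it using pq n by blast
  next
    fix w assume "w \<in> idl t"
    then obtain m n where w: "w = elt (c * (a * m + x * n)) (c * n)" unfolding it by blast
    have "elt (m * (c * a)) (m * 0) + elt (n * (c * x)) (n * c) \<in> I" by (intro I(3) smult ca cx)
    moreover have "elt (m * (c * a)) (m * 0) + elt (n * (c * x)) (n * c) = w"
      by (simp add: w elt_add elt_eq_iff algebra_simps)
    ultimately show "w \<in> I" by simp
  qed
  thus ?thesis using that tT by blast
qed

text \<open>The triple is recovered from the set: c from the \<omega>-coordinates, c a from the
  rational integers, and x modulo a from an element with \<omega>-coordinate c.\<close>

lemma idl_inj: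
  assumes t: "t \<in> triples" and t': "t' \<in> triples" and eq: "idl t = idl t'"
  shows "t = t'"
proof -
  obtain c a x where tt: "t = (c, a, x)" by (cases t)
  obtain c' a' x' where tt': "t' = (c', a', x')" by (cases t')
  have pos: "c > 0" "a > 0" "c' > 0" "a' > 0" "0 \<le> x" "x < int a" "0 \<le> x'" "x' < int a'"
    using t t' by (auto simp: tt tt' triples_def form_roots_def)
  have key: "int c' dvd int c \<and> int c' * int a' dvd int c * int a \<and> elt (int c * x) (int c) \<in> idl (c', a', x')"
    if "idl (c, a, x) \<subseteq> idl (c', a', x')" for c a x c' a' x'
  proof -
    have "elt (int c * (int a * 0 + x * 1)) (int c * 1) \<in> idl (c, a, x)" unfolding idl_def prod.case by blast
    hence 1: "elt (int c * x) (int c) \<in> idl (c', a', x')" using that by auto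
    have "elt (int c * (int a * 1 + x * 0)) (int c * 0) \<in> idl (c, a, x)" unfolding idl_def prod.case by blast
    hence "elt (int c * int a) 0 \<in> idl (c', a', x')" using that by auto
    then obtain m n where "int c * int a = int c' * (int a' * m + x' * n)" "0 = int c' * n" by (auto simp: idl_def elt_eq_iff)
    hence "int c' * int a' dvd int c * int a" by (cases "c' = 0") auto
    moreover obtain m' n' where "int c = int c' * n'" using 1 by (auto simp: idl_def elt_eq_iff)
    hence "int c' dvd int c" by simp
    ultimately show ?thesis using 1 by simp
  qed
  have k1: "int c' dvd int c" "int c' * int a' dvd int c * int a" "elt (int c * x) (int c) \<in> idl (c', a', x')"
    using key[of c a x c' a' x'] eq unfolding tt tt' by auto
  have k2: "int c dvd int c'" "int c * int a dvd int c' * int a'"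
    using key[of c' a' x' c a x] eq unfolding tt tt' by auto
  have cc: "c = c'" using k1(1) k2(1) by (simp add: dvd_antisym)
  have "c * a = c' * a'" using k1(2) k2(2) by (metis dvd_antisym int_dvd_int_iff of_nat_mult)
  hence aa: "a = a'" using cc pos by simp
  obtain m n where mn: "int c * x = int c' * (int a' * m + x' * n)" "int c = int c' * n"
    using k1(3) by (auto simp: idl_def elt_eq_iff)
  have "n = 1" using mn(2) cc pos by simp
  hence "x = int a * m + x'" using mn(1) cc aa pos by simp
  hence "x mod int a = x' mod int a" by simp
  hence "x = x'" using pos aa by simp
  thus ?thesis using cc aa tt tt' by simp
qed

definition lat :: "complex \<Rightarrow> complex \<Rightarrow> complex set" where
  "lat z1 z2 = {of_int m * z1 + of_int n * z2 | m n. True}"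

text \<open>\<open>Im (cnj z1 * z2)\<close> is the signed area of a fundamental cell. Passing to a
  sublattice multiplies it by an integer determinant, here nonzero.\<close>

lemma lat_area_le:
  assumes sub: "lat w1 w2 \<subseteq> lat z1 z2" and nz: "Im (cnj w1 * w2) \<noteq> 0"
  shows "\<bar>Im (cnj z1 * z2)\<bar> \<le> \<bar>Im (cnj w1 * w2)\<bar>"
proof -
  have "of_int 1 * w1 + of_int 0 * w2 \<in> lat w1 w2" "of_int 0 * w1 + of_int 1 * w2 \<in> lat w1 w2"
    unfolding lat_def by blast+
  hence "w1 \<in> lat z1 z2" "w2 \<in> lat z1 z2" using sub by auto
  then obtain p q r s where w: "w1 = of_int p * z1 + of_int q * z2" "w2 = of_int r * z1 + of_int s * z2"
    unfolding lat_def by blast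
  have e: "Im (cnj w1 * w2) = of_int (p * s - q * r) * Im (cnj z1 * z2)"
    by (simp add: w algebra_simps)
  have "p * s - q * r \<noteq> 0"
  proof
    assume "p * s - q * r = 0"
    hence "Im (cnj w1 * w2) = 0" unfolding e by simp
    thus False using nz by simp
  qed
  hence "1 \<le> \<bar>p * s - q * r\<bar>" by simp
  hence "1 \<le> \<bar>real_of_int (p * s - q * r)\<bar>" by (metis of_int_1_le_iff of_int_abs)
  from mult_right_mono[OF this, of "\<bar>Im (cnj z1 * z2)\<bar>"] show ?thesis unfolding e abs_mult by simp
qed

lemma lat_area_eq:
  assumes "lat w1 w2 = lat z1 z2" "Im (cnj w1 * w2) \<noteq> 0" "Im (cnj z1 * z2) \<noteq> 0"
  shows "\<bar>Im (cnj z1 * z2)\<bar> = \<bar>Im (cnj w1 * w2)\<bar>"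
  using lat_area_le[of w1 w2 z1 z2] lat_area_le[of z1 z2 w1 w2] assms by auto

lemma idl_lat: "idl (c, a, x) = lat (of_nat (c * a)) (of_nat c * elt x 1)"
proof -
  have "elt (int c * (int a * m + x * n)) (int c * n) = of_int m * of_nat (c * a) + of_int n * (of_nat c * elt x 1)" for m n
    by (simp add: elt_def complex_eq_iff algebra_simps)
  thus ?thesis by (simp add: idl_def lat_def)
qed

lemma scale_lat: "(*) l ` lat z1 z2 = lat (l * z1) (l * z2)"
proof -
  have "l * (of_int m * z1 + of_int n * z2) = of_int m * (l * z1) + of_int n * (l * z2)" for m n
    by (simp add: algebra_simps)
  thus ?thesis unfolding lat_def by (auto simp: image_iff) metis+
qed

lemma area_idl: "Im (cnj (of_nat (c * a)) * (of_nat c * elt x 1)) = real (tnorm (c, a, x)) * rk / 2"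
  by (simp add: elt_def tnorm_def power2_eq_square)

lemma tnorm_pos: "t \<in> triples \<Longrightarrow> tnorm t > 0"
  by (auto simp: triples_def tnorm_def)

text \<open>The norm is a covolume up to the constant \<open>rk / 2\<close>, and multiplication by l
  scales areas by the square of the modulus of l.\<close>

lemma tnorm_scale:
  assumes t: "t \<in> triples" and t': "t' \<in> triples" and eq: "idl t' = (*) l ` idl t" and l: "l \<noteq> 0"
  shows "real (tnorm t') = (cmod l)\<^sup>2 * real (tnorm t)"
proof -
  obtain c a x where tt: "t = (c, a, x)" by (cases t)
  obtain c' a' x' where tt': "t' = (c', a', x')" by (cases t')
  define z1 z2 where "z1 = complex_of_nat (c * a)" and "z2 = of_nat c * elt x 1"
  have sc: "Im (cnj (l * z1) * (l * z2)) = (cmod l)\<^sup>2 * (real (tnorm t) * rk / 2)"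
  proof -
    have "cnj (l * z1) * (l * z2) = (l * cnj l) * (cnj z1 * z2)" by simp
    also have "l * cnj l = of_real ((cmod l)\<^sup>2)" by (rule complex_norm_square[symmetric])
    finally have "Im (cnj (l * z1) * (l * z2)) = Im (of_real ((cmod l)\<^sup>2) * (cnj z1 * z2))" by (rule arg_cong)
    also have "\<dots> = (cmod l)\<^sup>2 * Im (cnj z1 * z2)" unfolding times_complex.sel by simp
    finally have "Im (cnj (l * z1) * (l * z2)) = (cmod l)\<^sup>2 * Im (cnj z1 * z2)" .
    thus ?thesis using area_idl[of c a x] by (simp add: z1_def z2_def tt)
  qed
  have e: "lat (of_nat (c' * a')) (of_nat c' * elt x' 1) = lat (l * z1) (l * z2)"
    using eq by (simp only: tt tt' idl_lat scale_lat z1_def z2_def)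
  have "real (tnorm t') * rk / 2 > 0" using tnorm_pos[OF t'] rk by simp
  moreover have p2: "(cmod l)\<^sup>2 * (real (tnorm t) * rk / 2) > 0" using tnorm_pos[OF t] rk l by simp
  ultimately have "\<bar>(cmod l)\<^sup>2 * (real (tnorm t) * rk / 2)\<bar> = \<bar>real (tnorm t') * rk / 2\<bar>"
    using lat_area_eq[OF e] area_idl[of c' a' x'] sc by (simp only: tt')
  thus ?thesis using rk p2 by simp
qed

lemma scale_ideal:
  assumes J: "J \<in> nonzero_ideals R" and l: "l \<noteq> 0" and sub: "(*) l ` J \<subseteq> ints"
  shows "(*) l ` J \<in> nonzero_ideals R"
proof -
  have J': "J \<subseteq> ints" "0 \<in> J" "\<And>x y. x \<in> J \<Longrightarrow> y \<in> J \<Longrightarrow> x + y \<in> J" "\<And>x r. x \<in> J \<Longrightarrow> r \<in> ints \<Longrightarrow> r * x \<in> J"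
    and J0: "J \<noteq> {0}"
    using J unfolding nonzero_ideals_iff ideal_iff by blast+
  have "ideal ((*) l ` J) R" unfolding ideal_iff
  proof (intro conjI ballI)
    show "0 \<in> (*) l ` J" using J'(2) by force
    show "x + y \<in> (*) l ` J" if "x \<in> (*) l ` J" "y \<in> (*) l ` J" for x y
      using that J'(3) by (auto simp: ring_distribs[symmetric])
    show "r * x \<in> (*) l ` J" if "x \<in> (*) l ` J" "r \<in> ints" for x r
      using that J'(4) by (auto simp: mult.left_commute)
  qed (use sub in auto)
  moreover obtain j where "j \<in> J" "j \<noteq> 0" using J0 J'(2) by blast
  hence "l * j \<in> (*) l ` J" "l * j \<noteq> 0" using l by auto
  hence "(*) l ` J \<noteq> {0}" by blast
  ultimately show ?thesis by (simp add: nonzero_ideals_iff)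
qed

text \<open>From a I = b J the scalar is b / a. Conversely, for a nonzero j in J both j and l j lie
  in the ring, and j I = (l j) J.\<close>

lemma class_rel_iff:
  assumes I: "I \<in> nonzero_ideals R" and J: "J \<in> nonzero_ideals R"
  shows "(I, J) \<in> ideal_class_rel R \<longleftrightarrow> (\<exists>l. l \<noteq> 0 \<and> I = (*) l ` J)"
proof
  assume "(I, J) \<in> ideal_class_rel R"
  then obtain a b where ab: "a \<noteq> 0" "b \<noteq> 0" "(*) a ` I = (*) b ` J"
    by (auto simp: ideal_class_rel_def R_simps l_coset_R)
  have "I = (*) (inverse a) ` ((*) a ` I)" using ab(1) by (simp add: image_image mult.assoc[symmetric])
  also have "\<dots> = (*) (b / a) ` J" unfolding ab(3) by (simp add: image_image divide_inverse mult_ac)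
  finally show "\<exists>l. l \<noteq> 0 \<and> I = (*) l ` J" using ab by (intro exI[of _ "b / a"]) auto
next
  assume "\<exists>l. l \<noteq> 0 \<and> I = (*) l ` J"
  then obtain l where l: "l \<noteq> 0" "I = (*) l ` J" by blast
  have Js: "J \<subseteq> ints" "0 \<in> J" "J \<noteq> {0}" using J unfolding nonzero_ideals_iff ideal_iff by blast+
  have Is: "I \<subseteq> ints" using I unfolding nonzero_ideals_iff ideal_iff by blast
  obtain j where j: "j \<in> J" "j \<noteq> 0" using Js by blast
  have "l * j \<in> ints" using Is l j by auto
  moreover have "j \<in> ints" using j Js by auto
  moreover have "(*) j ` I = (*) (l * j) ` J" by (simp add: l(2) image_image mult_ac)
  ultimately have "\<exists>a\<in>ints - {0}. \<exists>b\<in>ints - {0}. (*) a ` I = (*) b ` J"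
    using l j by (intro bexI[of _ j] bexI[of _ "l * j"]) auto
  thus "(I, J) \<in> ideal_class_rel R"
    using I J by (simp add: ideal_class_rel_def R_simps l_coset_R)
qed

lemma equiv_class_rel: "equiv (nonzero_ideals R) (ideal_class_rel R)"
proof (rule equivI)
  show sub: "ideal_class_rel R \<subseteq> nonzero_ideals R \<times> nonzero_ideals R" by (auto simp: ideal_class_rel_def)
  show "refl_on (nonzero_ideals R) (ideal_class_rel R)"
  proof (rule refl_onI)
    fix I assume "I \<in> nonzero_ideals R"
    thus "(I, I) \<in> ideal_class_rel R" by (subst class_rel_iff) (auto intro!: exI[of _ 1])
  qed
  show "sym (ideal_class_rel R)" by (auto simp: sym_def ideal_class_rel_def)
  show "trans (ideal_class_rel R)"
  proof (rule transI)
    fix I J L assume IJ: "(I, J) \<in> ideal_class_rel R" and JL: "(J, L) \<in> ideal_class_rel R"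
    have n: "I \<in> nonzero_ideals R" "J \<in> nonzero_ideals R" "L \<in> nonzero_ideals R" using IJ JL sub by auto
    obtain l where l: "l \<noteq> 0" "I = (*) l ` J" using IJ class_rel_iff n by auto
    obtain l' where l': "l' \<noteq> 0" "J = (*) l' ` L" using JL class_rel_iff n by auto
    have "I = (*) (l * l') ` L" unfolding l(2) l'(2) by (simp add: image_image mult_ac)
    moreover have "l * l' \<noteq> 0" using l l' by simp
    ultimately have "\<exists>l. l \<noteq> 0 \<and> I = (*) l ` L" by blast
    thus "(I, L) \<in> ideal_class_rel R" using class_rel_iff n by blast
  qed
qed

text \<open>The values of \<open>lam (c, a, x)\<close> form the inverse \<open>(a \<int> + (x + cnj \<omega>) \<int>) / (c a)\<close> of the ideal \<open>idl (c, a, x)\<close>.\<close>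

definition lam :: "nat \<times> nat \<times> int \<Rightarrow> int \<times> int \<Rightarrow> complex" where
  "lam = (\<lambda>(c, a, x) (n, m). elt (int a * m + n * (x + 1)) (- n) / of_nat (c * a))"

text \<open>The products of a and x + \<omega> with a and x + \<open>cnj\<close> \<omega> are all
  divisible by a, the critical one being the norm a b of x + \<omega>.\<close>

lemma lam_scale_sub:
  assumes t: "t \<in> triples"
  shows "(*) (lam t z) ` idl t \<subseteq> ints"
proof
  obtain c a x where tt: "t = (c, a, x)" by (cases t)
  obtain n m where z: "z = (n, m)" by (cases z)
  have ca: "c > 0" "a > 0" using t by (auto simp: tt triples_def)
  obtain b where b: "x\<^sup>2 + x + offset = int a * b" using triples_cofactor t tt by blast
  fix w assume "w \<in> (*) (lam t z) ` idl t"
  then obtain m' n' where w: "w = lam t z * elt (int c * (int a * m' + x * n')) (int c * n')"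
    by (auto simp: idl_def tt)
  define P where "P = elt (int a * m + n * (x + 1)) (- n)"
  have c1: "elt (int c * u) (int c * v) = of_nat c * elt u v" for u v c
    by (simp add: elt_def complex_eq_iff algebra_simps)
  define Q where "Q = elt (m' * (int a * m + n * (x + 1)) + n' * (m * x + n * b)) (- m' * n + n' * m)"
  have "P * elt (int a * m' + x * n') n' = elt (int a * (m' * (int a * m + n * (x + 1)) + n' * (m * x + n * b))) (int a * (- m' * n + n' * m))"
  proof -
    have "(int a * m + n * (x + 1)) * (int a * m' + x * n') - offset * (- n * n')
       = int a * (m' * (int a * m + n * (x + 1)) + n' * m * x) + n * n' * (x\<^sup>2 + x + offset)"
      by (simp add: power2_eq_square algebra_simps)
    also have "\<dots> = int a * (m' * (int a * m + n * (x + 1)) + n' * (m * x + n * b))"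
      unfolding b by (simp add: algebra_simps)
    finally have "(int a * m + n * (x + 1)) * (int a * m' + x * n') - offset * (- n * n')
       = int a * (m' * (int a * m + n * (x + 1)) + n' * (m * x + n * b))" .
    moreover have "(int a * m + n * (x + 1)) * n' + - n * (int a * m' + x * n') + - n * n' = int a * (- m' * n + n' * m)"
      by (simp add: algebra_simps)
    ultimately show ?thesis unfolding P_def elt_mult by (simp only:)
  qed
  also have "\<dots> = of_nat a * Q" unfolding Q_def by (rule c1)
  finally have PQ: "P * elt (int a * m' + x * n') n' = of_nat a * Q" .
  have "w = (P / of_nat (c * a)) * (of_nat c * elt (int a * m' + x * n') n')"
    unfolding w c1 by (simp add: lam_def tt z P_def)
  also have "\<dots> = (P * elt (int a * m' + x * n') n') / of_nat a" using ca by simp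
  also have "\<dots> = Q" unfolding PQ using ca by simp
  finally show "w \<in> ints" by (simp add: Q_def)
qed

text \<open>The image of the generator c a gives the numerator u + v \<omega>; integrality of the
  image of c (x + \<omega>) then fixes u modulo a in terms of v.\<close>

lemma lam_exists:
  assumes t: "t \<in> triples" and sub: "(*) l ` idl t \<subseteq> ints"
  obtains z where "l = lam t z"
proof -
  obtain c a x where tt: "t = (c, a, x)" by (cases t)
  have ca: "c > 0" "a > 0" using t by (auto simp: tt triples_def)
  have c1: "elt (int c * u) (int c * v) = of_nat c * elt u v" for u v c
    by (simp add: elt_def complex_eq_iff algebra_simps)
  have "elt (int c * (int a * 1 + x * 0)) (int c * 0) \<in> idl t" unfolding idl_def tt prod.case by blast
  hence "l * elt (int c * (int a * 1 + x * 0)) (int c * 0) \<in> ints" using sub by blast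
  moreover have "elt (int c * (int a * 1 + x * 0)) (int c * 0) = of_nat (c * a)"
    by (simp add: elt_def complex_eq_iff)
  ultimately obtain u v where uv: "l * of_nat (c * a) = elt u v" by (auto simp: ints_def)
  have "elt (int c * (int a * 0 + x * 1)) (int c * 1) \<in> idl t" unfolding idl_def tt prod.case by blast
  hence "l * elt (int c * (int a * 0 + x * 1)) (int c * 1) \<in> ints" using sub by blast
  then obtain s r where "l * elt (int c * (int a * 0 + x * 1)) (int c * 1) = elt s r" by (auto simp: ints_def)
  hence sr: "l * (of_nat c * elt x 1) = elt s r" unfolding c1 by simp
  have "elt u v * elt x 1 = of_nat a * (l * (of_nat c * elt x 1))" unfolding uv[symmetric] by (simp add: ac_simps)
  also have "\<dots> = elt (int a * s) (int a * r)" unfolding sr c1 ..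
  finally have "u * 1 + v * x + v * 1 = int a * r" unfolding elt_mult elt_eq_iff by simp
  hence "u = int a * r + (- v) * (x + 1)" by (simp add: algebra_simps)
  hence "elt u v = elt (int a * r + (- v) * (x + 1)) (- (- v))" by simp
  hence "l = lam t (- v, r)" unfolding lam_def tt prod.case using uv ca
    by (simp add: nonzero_eq_divide_eq)
  thus ?thesis by (rule that)
qed

lemma lam_eq_iff:
  assumes t: "t \<in> triples"
  shows "lam t z = lam t z' \<longleftrightarrow> z = z'"
proof -
  obtain c a x where tt: "t = (c, a, x)" by (cases t)
  have ca: "c > 0" "a > 0" using t by (auto simp: tt triples_def)
  thus ?thesis by (cases z; cases z') (auto simp: lam_def tt elt_eq_iff)
qed

lemma lam_minus: "lam t (- z) = - lam t z"
proof -
  obtain c a x where tt: "t = (c, a, x)" by (cases t)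
  obtain n m where z: "z = (n, m)" by (cases z)
  have "elt (int a * (- m) + (- n) * (x + 1)) (- (- n)) = - elt (int a * m + n * (x + 1)) (- n)"
    by (simp add: elt_minus algebra_simps)
  thus ?thesis by (simp add: lam_def tt z)
qed

lemma lam_0: "lam t 0 = 0"
  by (cases t) (simp add: lam_def zero_prod_def elt_0)

text \<open>The norm of the numerator contains a factor a because x^2 + x + N = a b. What remains is
  a binary quadratic form of discriminant (2x + 1)^2 - 4 a b = -k.\<close>

lemma lam_norm:
  assumes t: "(c, a, x) \<in> triples" and b: "x\<^sup>2 + x + offset = int a * b"
  shows "(cmod (lam (c, a, x) (n, m)))\<^sup>2 * real (tnorm (c, a, x)) = of_int (int a * m\<^sup>2 + (2 * x + 1) * m * n + b * n\<^sup>2)"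
proof -
  have ca: "c > 0" "a > 0" using t by (auto simp: triples_def)
  have "(int a * m + n * (x + 1))\<^sup>2 + (int a * m + n * (x + 1)) * (- n) + offset * (- n)\<^sup>2
     = int a * (int a * m\<^sup>2 + (2 * x + 1) * m * n) + n\<^sup>2 * (x\<^sup>2 + x + offset)"
    by (simp add: power2_eq_square algebra_simps)
  also have "\<dots> = int a * (int a * m\<^sup>2 + (2 * x + 1) * m * n + b * n\<^sup>2)"
    unfolding b by (simp add: algebra_simps)
  finally have "(cmod (elt (int a * m + n * (x + 1)) (- n)))\<^sup>2 = real a * of_int (int a * m\<^sup>2 + (2 * x + 1) * m * n + b * n\<^sup>2)"
    unfolding norm_elt by simp
  thus ?thesis using ca
    by (simp add: lam_def norm_divide norm_mult power_divide power_mult_distrib tnorm_def power2_eq_square)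
qed

text \<open>Such an \<open>e\<close> is an eigenvalue of an integer matrix, hence integral, and it preserves covolumes.\<close>

lemma unit_of_stable:
  assumes t: "t \<in> triples" and st: "(*) e ` idl t = idl t" and e: "e \<noteq> 0"
  shows "e = 1 \<or> e = - 1"
proof -
  obtain c a x where tt: "t = (c, a, x)" by (cases t)
  have ca: "c > 0" "a > 0" using t by (auto simp: tt triples_def)
  define z1 z2 where "z1 = complex_of_nat (c * a)" and "z2 = of_nat c * elt x 1"
  have L: "idl t = lat z1 z2" by (simp only: tt idl_lat z1_def z2_def)
  have z1: "z1 \<noteq> 0" using ca by (simp add: z1_def)
  have "of_int 1 * z1 + of_int 0 * z2 \<in> lat z1 z2" "of_int 0 * z1 + of_int 1 * z2 \<in> lat z1 z2"
    unfolding lat_def by blast+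
  hence "e * z1 \<in> lat z1 z2" "e * z2 \<in> lat z1 z2" using st unfolding L by auto
  then obtain p q r s where pq: "e * z1 = of_int p * z1 + of_int q * z2" and rs: "e * z2 = of_int r * z1 + of_int s * z2"
    unfolding lat_def by blast
  \<comment> \<open>Multiplication by e acts on the basis by an integer matrix; this is its
    characteristic equation.\<close>
  have "z1 * (e * e - (of_int p + of_int s) * e + (of_int p * of_int s - of_int q * of_int r))
      = e * (e * z1) - (of_int p + of_int s) * (e * z1) + (of_int p * of_int s - of_int q * of_int r) * z1"
    by (simp add: algebra_simps)
  also have "\<dots> = 0" unfolding pq ring_distribs mult.left_commute[of e] pq rs by (simp add: algebra_simps)
  finally have ch: "e * e - (of_int p + of_int s) * e + (of_int p * of_int s - of_int q * of_int r) = 0"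
    using z1 by simp
  define P :: "complex poly" where "P = [:of_int (p * s - q * r), - of_int (p + s), 1:]"
  have "poly P e = 0" using ch by (simp add: P_def algebra_simps)
  moreover have "lead_coeff P = 1" by (simp add: P_def)
  moreover have "\<forall>i. poly.coeff P i \<in> \<int>" by (auto simp: P_def coeff_pCons split: nat.splits)
  ultimately have alg: "algebraic_int e" by (intro algebraic_int.intros)
  have "e = (of_int p * z1 + of_int q * z2) / z1" using pq z1 by (simp add: field_simps)
  also have "\<dots> = elt (int c * (int a * p + x * q)) (int c * q) / of_nat (c * a)"
    by (simp add: z1_def z2_def elt_def complex_eq_iff algebra_simps)
  finally have ee: "e = elt (int c * (int a * p + x * q)) (int c * q) / of_nat (c * a)" .
  have "e \<in> quadratic_field (- k)"
  proof -
    obtain X Y where "X \<in> \<rat>" "Y \<in> \<rat>" "elt (int c * (int a * p + x * q)) (int c * q) = X + Y * csqrt (of_int (- k))"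
      using elt_in_field unfolding quadratic_field_def by blast
    hence "e = X / of_nat (c * a) + Y / of_nat (c * a) * csqrt (of_int (- k))"
      unfolding ee by (simp add: add_divide_distrib)
    moreover have "X / of_nat (c * a) \<in> \<rat>" "Y / of_nat (c * a) \<in> \<rat>" using \<open>X \<in> \<rat>\<close> \<open>Y \<in> \<rat>\<close> by auto
    ultimately show ?thesis unfolding quadratic_field_def by blast
  qed
  from algebraic_int_in_ints[OF this alg] obtain u v where uv: "e = elt u v" by (auto simp: ints_def)
  have "real (tnorm t) = (cmod e)\<^sup>2 * real (tnorm t)" by (rule tnorm_scale[OF t t _ e]) (simp add: st)
  hence "(cmod e)\<^sup>2 = 1" using tnorm_pos[OF t] by simp
  hence "real_of_int (u\<^sup>2 + u * v + offset * v\<^sup>2) = real_of_int 1" unfolding uv norm_elt by simp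
  hence n1: "u\<^sup>2 + u * v + offset * v\<^sup>2 = 1" by (simp only: of_int_eq_iff)
  have "(2 * u + v)\<^sup>2 + k * v\<^sup>2 = 4 * (u\<^sup>2 + u * v) + (k + 1) * v\<^sup>2"
    by (simp add: power2_eq_square algebra_simps)
  also have "\<dots> = 4 * (u\<^sup>2 + u * v + offset * v\<^sup>2)" unfolding offset[symmetric] by (simp add: algebra_simps)
  finally have n4: "(2 * u + v)\<^sup>2 + k * v\<^sup>2 = 4" using n1 by simp
  \<comment> \<open>The equation (2u + v)^2 + k v^2 = 4 leaves no room for v once k exceeds 4; for k
    = 3 it would admit four further units.\<close>
  have v0: "v = 0"
  proof (rule ccontr)
    assume "v \<noteq> 0"
    hence "v\<^sup>2 \<ge> 1" by (simp add: int_one_le_iff_zero_less)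
    hence "k * 1 \<le> k * v\<^sup>2" using k_ge by (intro mult_left_mono) auto
    thus False using n4 k_ge zero_le_power2[of "2 * u + v"] by linarith
  qed
  hence "u\<^sup>2 = 1" using n1 by simp
  hence "u = 1 \<or> u = - 1" by (simp add: power2_eq_1_iff)
  thus ?thesis using v0 uv elt_1 elt_minus[of 1 0] by auto
qed

lemma finite_triples_norm: "n > 0 \<Longrightarrow> finite {t \<in> triples. tnorm t = n}"
  and card_triples_norm: "n > 0 \<Longrightarrow> card {t \<in> triples. tnorm t = n} = form_count offset n"
proof -
  assume n: "n > 0"
  define S where "S = Sigma {c. c\<^sup>2 dvd n} (\<lambda>c. form_roots offset (n div c\<^sup>2))"
  have finS: "finite S" unfolding S_def using finite_square_divisors[OF n] by auto
  have eq: "{t \<in> triples. tnorm t = n} = (\<lambda>(c, x). (c, n div c\<^sup>2, x)) ` S"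
  proof (intro equalityI subsetI)
    fix t assume t: "t \<in> {t \<in> triples. tnorm t = n}"
    obtain c a x where tt: "t = (c, a, x)" by (cases t)
    have "c > 0" "x \<in> form_roots offset a" "n = c\<^sup>2 * a" using t by (auto simp: tt triples_def tnorm_def)
    hence "(c, x) \<in> S" "t = (\<lambda>(c, x). (c, n div c\<^sup>2, x)) (c, x)" by (auto simp: S_def tt)
    thus "t \<in> (\<lambda>(c, x). (c, n div c\<^sup>2, x)) ` S" by blast
  next
    fix t assume "t \<in> (\<lambda>(c, x). (c, n div c\<^sup>2, x)) ` S"
    then obtain c x where cx: "c\<^sup>2 dvd n" "x \<in> form_roots offset (n div c\<^sup>2)" "t = (c, n div c\<^sup>2, x)" by (auto simp: S_def)
    have nn: "c\<^sup>2 * (n div c\<^sup>2) = n" using cx(1) by simp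
    hence "c > 0" "n div c\<^sup>2 > 0" using n by (auto intro!: Nat.gr0I)
    thus "t \<in> {t \<in> triples. tnorm t = n}" using cx nn by (simp add: triples_def tnorm_def)
  qed
  show "finite {t \<in> triples. tnorm t = n}" unfolding eq using finS by simp
  have "card {t \<in> triples. tnorm t = n} = card S" unfolding eq by (rule card_image) (auto simp: inj_on_def)
  also have "\<dots> = form_count offset n" unfolding S_def form_count_def
    by (rule card_SigmaI) (use finite_square_divisors[OF n] in auto)
  finally show "card {t \<in> triples. tnorm t = n} = form_count offset n" .
qed

text \<open>The norm form attached to the class of \<open>idl t\<close>, of discriminant -k; the
  variables come in the order of \<open>lam\<close>, with m belonging to the basis vector a.\<close>

definition class_form :: "nat \<times> nat \<times> int \<Rightarrow> int \<times> int \<Rightarrow> int" where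
  "class_form = (\<lambda>(c, a, x) (n, m). int a * m\<^sup>2 + (2 * x + 1) * m * n + ((x\<^sup>2 + x + offset) div int a) * n\<^sup>2)"

lemma class_form_norm:
  assumes t: "t \<in> triples"
  shows "(cmod (lam t z))\<^sup>2 * real (tnorm t) = of_int (class_form t z)"
proof -
  obtain c a x where tt: "t = (c, a, x)" by (cases t)
  obtain n m where z: "z = (n, m)" by (cases z)
  obtain b where b: "x\<^sup>2 + x + offset = int a * b" using triples_cofactor t tt by blast
  have "a > 0" using t by (auto simp: tt triples_def)
  thus ?thesis using lam_norm[OF t[unfolded tt] b, of n m] by (simp add: class_form_def tt z b)
qed

text \<open>The ideals equivalent to a given \<open>J\<close> are the \<open>l * J\<close> with \<open>l\<close> in the inverse of \<open>J\<close>, where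
  \<open>l\<close> is determined up to sign.\<close>

lemma card_class_norm:
  assumes t: "t \<in> triples" and n: "n > 0"
  shows "finite {z. class_form t z = int n}"
    and "card {z. class_form t z = int n} = 2 * card {t' \<in> triples. tnorm t' = n \<and> (idl t', idl t) \<in> ideal_class_rel R}"
proof -
  define B where "B = {t' \<in> triples. tnorm t' = n \<and> (idl t', idl t) \<in> ideal_class_rel R}"
  define S where "S = {z. class_form t z = int n}"
  define fib where "fib t' = {z \<in> S. (*) (lam t z) ` idl t = idl t'}" for t'
  have finB: "finite B" by (rule finite_subset[OF _ finite_triples_norm[OF n]]) (auto simp: B_def)
  have Jn: "idl t \<in> nonzero_ideals R" by (rule idl_ideal[OF t])
  have lam0: "lam t z \<noteq> 0" if "z \<in> S" for z
    using class_form_norm[OF t, of z] that n by (auto simp: S_def)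
  have inS: "z \<in> S \<longleftrightarrow> tnorm t' = n" if "idl t' = (*) (lam t z) ` idl t" "t' \<in> triples" "lam t z \<noteq> 0" for z t'
  proof -
    have "real (tnorm t') = of_int (class_form t z)"
      using tnorm_scale[OF t that(2,1,3)] class_form_norm[OF t, of z] by simp
    hence "real_of_int (int (tnorm t')) = real_of_int (class_form t z)" by simp
    hence "int (tnorm t') = class_form t z" by (simp only: of_int_eq_iff)
    thus ?thesis unfolding S_def by auto
  qed
  have fib2: "card (fib t') = 2 \<and> finite (fib t')" if t': "t' \<in> B" for t'
  proof -
    have t'T: "t' \<in> triples" "tnorm t' = n" using t' by (auto simp: B_def)
    obtain l where l: "l \<noteq> 0" "idl t' = (*) l ` idl t"
      using t' class_rel_iff[OF idl_ideal[OF t'T(1)] Jn] by (auto simp: B_def)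
    have "idl t' \<subseteq> ints" using idl_ideal[OF t'T(1)] unfolding nonzero_ideals_iff ideal_iff by blast
    hence "(*) l ` idl t \<subseteq> ints" using l by simp
    then obtain z0 where z0: "l = lam t z0" by (rule lam_exists[OF t])
    have z0S: "z0 \<in> S" using inS[of t' z0] l t'T z0 by simp
    have z0n: "z0 \<noteq> 0" using lam0[OF z0S] lam_0[of t] by auto
    have neq: "z0 \<noteq> - z0"
    proof
      assume "z0 = - z0"
      hence "lam t z0 = - lam t z0" using lam_minus[of t z0] by simp
      thus False using lam0[OF z0S] by simp
    qed
    have jm: "(*) (- l) ` idl t = idl t'"
    proof -
      have "- 1 \<in> ints" using ints_closed(3,5) by blast
      have neg: "- w \<in> idl t" if "w \<in> idl t" for w
      proof -
        have "- 1 * w \<in> idl t" using Jn that \<open>- 1 \<in> ints\<close> unfolding nonzero_ideals_iff ideal_iff by blast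
        thus ?thesis by simp
      qed
      show ?thesis unfolding l(2)
      proof (intro equalityI subsetI)
        fix w assume "w \<in> (*) (- l) ` idl t"
        then obtain y where "y \<in> idl t" "w = - l * y" by auto
        hence "w = l * (- y)" "- y \<in> idl t" using neg by auto
        thus "w \<in> (*) l ` idl t" by blast
      next
        fix w assume "w \<in> (*) l ` idl t"
        then obtain y where "y \<in> idl t" "w = l * y" by auto
        hence "w = - l * (- y)" "- y \<in> idl t" using neg by auto
        thus "w \<in> (*) (- l) ` idl t" by blast
      qed
    qed
    \<comment> \<open>Two multipliers with the same image differ by a factor that fixes
      \<open>idl t\<close>, hence by a sign.\<close>
    have "fib t' = {z0, - z0}"
    proof (intro equalityI subsetI)
      fix z assume z: "z \<in> fib t'"
      hence zS: "z \<in> S" "(*) (lam t z) ` idl t = (*) l ` idl t" using l by (auto simp: fib_def)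
      define e where "e = l / lam t z"
      have e: "e \<noteq> 0" using l lam0[OF zS(1)] by (simp add: e_def)
      have "(*) e ` idl t = (*) (inverse (lam t z)) ` ((*) l ` idl t)"
        by (simp add: image_image e_def divide_inverse mult_ac)
      also have "\<dots> = idl t" unfolding zS(2)[symmetric] using lam0[OF zS(1)] by (simp add: image_image mult.assoc[symmetric])
      finally have "e = 1 \<or> e = - 1" using unit_of_stable[OF t _ e] by blast
      hence "lam t z = lam t z0 \<or> lam t z = lam t (- z0)"
        using lam0[OF zS(1)] unfolding e_def z0 lam_minus by (auto simp: field_simps)
      thus "z \<in> {z0, - z0}" unfolding lam_eq_iff[OF t] by simp
    next
      fix z assume "z \<in> {z0, - z0}"
      hence "(*) (lam t z) ` idl t = idl t'" "lam t z \<noteq> 0" using l jm z0 lam_minus[of t z0] by auto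
      thus "z \<in> fib t'" using inS[of t' z] t'T by (auto simp: fib_def)
    qed
    thus ?thesis using neq by simp
  qed
  have SU: "S = (\<Union>t'\<in>B. fib t')"
  proof (intro equalityI subsetI)
    fix z assume z: "z \<in> S"
    have id: "(*) (lam t z) ` idl t \<in> nonzero_ideals R"
      by (rule scale_ideal[OF Jn lam0[OF z] lam_scale_sub[OF t]])
    then obtain t' where t': "t' \<in> triples" "(*) (lam t z) ` idl t = idl t'" by (rule idl_surj)
    have "tnorm t' = n" using inS[of t' z] t' lam0[OF z] z by simp
    moreover have "(idl t', idl t) \<in> ideal_class_rel R"
      using class_rel_iff[OF idl_ideal[OF t'(1)] Jn] t'(2) lam0[OF z] by metis
    ultimately have "t' \<in> B" using t' by (simp add: B_def)
    thus "z \<in> (\<Union>t'\<in>B. fib t')" using z t' by (auto simp: fib_def)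
  qed (auto simp: fib_def)
  show "finite {z. class_form t z = int n}" using finB fib2 SU by (simp add: S_def)
  have "card S = (\<Sum>t'\<in>B. card (fib t'))" unfolding SU
  proof (rule card_UN_disjoint[OF finB])
    show "\<forall>i\<in>B. \<forall>j\<in>B. i \<noteq> j \<longrightarrow> fib i \<inter> fib j = {}"
      using idl_inj by (auto simp: fib_def B_def)
  qed (use fib2 in auto)
  also have "\<dots> = 2 * card B" using fib2 by simp
  finally show "card {z. class_form t z = int n} = 2 * card {t' \<in> triples. tnorm t' = n \<and> (idl t', idl t) \<in> ideal_class_rel R}"
    by (simp add: S_def B_def)
qed

end

section \<open>Theta series of binary quadratic forms\<close>

lemma integrable_gauss: "(\<lambda>t :: real. exp (- t\<^sup>2)) integrable_on {a..b}"
  by (intro integrable_continuous_interval continuous_intros)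

definition gauss_integral :: "real \<Rightarrow> real" where
  "gauss_integral x = integral {0..x} (\<lambda>t. exp (- t\<^sup>2))"

lemma gauss_integral_increment:
  assumes "0 \<le> x" "x \<le> y"
  shows "exp (- y\<^sup>2) * (y - x) \<le> gauss_integral y - gauss_integral x"
    and "gauss_integral y - gauss_integral x \<le> exp (- x\<^sup>2) * (y - x)"
proof -
  have "gauss_integral x + integral {x..y} (\<lambda>t. exp (- t\<^sup>2)) = gauss_integral y"
    unfolding gauss_integral_def by (rule Henstock_Kurzweil_Integration.integral_combine) (use assms integrable_gauss in auto)
  hence eq: "gauss_integral y - gauss_integral x = integral {x..y} (\<lambda>t. exp (- t\<^sup>2))" by simp
  have "integral {x..y} (\<lambda>t. exp (- y\<^sup>2)) \<le> integral {x..y} (\<lambda>t. exp (- t\<^sup>2))"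
    by (rule integral_le) (use assms integrable_gauss in \<open>auto intro!: power_mono\<close>)
  thus "exp (- y\<^sup>2) * (y - x) \<le> gauss_integral y - gauss_integral x" using assms by (simp add: eq mult.commute)
  have "integral {x..y} (\<lambda>t. exp (- t\<^sup>2)) \<le> integral {x..y} (\<lambda>t. exp (- x\<^sup>2))"
    by (rule integral_le) (use assms integrable_gauss in \<open>auto intro!: power_mono\<close>)
  thus "gauss_integral y - gauss_integral x \<le> exp (- x\<^sup>2) * (y - x)" using assms by (simp add: eq mult.commute)
qed

lemma gauss_integral_tendsto: "(gauss_integral \<longlongrightarrow> sqrt pi / 2) at_top"
proof -
  have int: "set_integrable lborel {0..} (\<lambda>x :: real. exp (- x\<^sup>2))"
    using gaussian_moment_0 by (simp add: set_integrable_def has_bochner_integral_iff)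
  have "((\<lambda>b. set_lebesgue_integral lborel {0..b} (\<lambda>x :: real. exp (- x\<^sup>2))) \<longlongrightarrow> set_lebesgue_integral lborel {0..} (\<lambda>x. exp (- x\<^sup>2))) at_top"
    by (rule tendsto_set_lebesgue_integral_at_top[OF _ int]) simp
  moreover have "set_lebesgue_integral lborel {0..} (\<lambda>x :: real. exp (- x\<^sup>2)) = sqrt pi / 2"
    using gaussian_moment_0 by (simp add: set_lebesgue_integral_def has_bochner_integral_iff)
  moreover have "set_lebesgue_integral lborel {0..b} (\<lambda>x :: real. exp (- x\<^sup>2)) = gauss_integral b" for b
    unfolding gauss_integral_def
    by (rule set_borel_integral_eq_integral(2), rule set_integrable_subset[OF int]) auto
  ultimately show ?thesis by simp
qed

text \<open>Integral test for the decreasing function exp (-u x^2), with \<open>F\<close> its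
  integral from 0. The first term costs at most 1, and the missing piece up to \<beta> at most
  \<beta>.\<close>

lemma gauss_half_sum:
  fixes u \<beta> :: real
  assumes u: "u > 0" and \<beta>: "\<beta> \<ge> 0"
  defines "f \<equiv> \<lambda>m. exp (- u * (real m + \<beta>)\<^sup>2)"
  shows "summable f" "suminf f \<le> sqrt (pi / u) / 2 + 1" "suminf f \<ge> sqrt (pi / u) / 2 - \<beta>"
proof -
  define F where "F x = gauss_integral (sqrt u * x) / sqrt u" for x
  have su: "sqrt u > 0" "sqrt u * sqrt u = u" using u by auto
  have inc: "exp (- u * y\<^sup>2) * (y - x) \<le> F y - F x" "F y - F x \<le> exp (- u * x\<^sup>2) * (y - x)"
    if xy: "0 \<le> x" "x \<le> y" for x y
  proof -
    have "0 \<le> sqrt u * x" "sqrt u * x \<le> sqrt u * y" using xy su by (auto intro: mult_left_mono)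
    from gauss_integral_increment[OF this] su(1)
    show "exp (- u * y\<^sup>2) * (y - x) \<le> F y - F x" "F y - F x \<le> exp (- u * x\<^sup>2) * (y - x)"
      using u by (simp_all add: F_def power_mult_distrib field_simps)
  qed
  have F0: "F 0 = 0" by (simp add: F_def gauss_integral_def)
  have F\<beta>: "F \<beta> \<le> \<beta>" using inc(2)[of 0 \<beta>] \<beta> F0 by simp
  have "filterlim (\<lambda>m. sqrt u * (real m + \<beta>)) at_top sequentially"
    unfolding add.commute[of _ \<beta>]
    by (rule filterlim_tendsto_pos_mult_at_top[OF tendsto_const su(1) filterlim_tendsto_add_at_top[OF tendsto_const filterlim_real_sequentially]])
  hence "(\<lambda>m. F (real m + \<beta>)) \<longlonglongrightarrow> (sqrt pi / 2) / sqrt u"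
    unfolding F_def by (intro tendsto_divide tendsto_const filterlim_compose[OF gauss_integral_tendsto]) (use su in auto)
  hence lim: "(\<lambda>m. F (real m + \<beta>)) \<longlonglongrightarrow> sqrt (pi / u) / 2" by (simp add: real_sqrt_divide mult.commute)
  define D where "D m = F (real (Suc m) + \<beta>) - F (real m + \<beta>)" for m
  have D: "D sums (sqrt (pi / u) / 2 - F \<beta>)"
    unfolding D_def using telescope_sums[OF lim] by simp
  have fD: "f (Suc m) \<le> D m" "D m \<le> f m" for m
    using inc[of "real m + \<beta>" "real (Suc m) + \<beta>"] \<beta> by (simp_all add: D_def f_def)
  have "summable (\<lambda>m. f (Suc m))"
    by (rule summable_comparison_test'[OF sums_summable[OF D], of 0]) (use fD in \<open>auto simp: f_def\<close>)
  thus sf: "summable f" by (simp add: summable_Suc_iff)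
  have "suminf D \<le> suminf f" by (rule suminf_le) (use fD sf sums_summable[OF D] in auto)
  thus "suminf f \<ge> sqrt (pi / u) / 2 - \<beta>" using sums_unique[OF D] F\<beta> by linarith
  have "(\<Sum>m. f (Suc m)) \<le> suminf D"
    by (rule suminf_le) (use fD sums_summable[OF D] \<open>summable (\<lambda>m. f (Suc m))\<close> in auto)
  moreover have "(\<Sum>m. f (Suc m)) = suminf f - f 0" using suminf_split_head[OF sf] by simp
  moreover have "f 0 \<le> 1" using u by (simp add: f_def)
  moreover have "F \<beta> \<ge> 0" using inc(1)[of 0 \<beta>] \<beta> F0 by (smt (verit) exp_gt_zero mult_nonneg_nonneg)
  ultimately show "suminf f \<le> sqrt (pi / u) / 2 + 1" using sums_unique[OF D] by linarith
qed

text \<open>The negative integers m = -i - 1 form a second half sum with shift 1 - \<beta>, so each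
  half contributes half of the integral and the errors add up to at most 2.\<close>

lemma gauss_sum_int_unit:
  fixes u \<beta> :: real
  assumes u: "u > 0" and \<beta>: "0 \<le> \<beta>" "\<beta> \<le> 1"
  obtains T where "((\<lambda>m::int. exp (- u * (of_int m + \<beta>)\<^sup>2)) has_sum T) UNIV" "\<bar>T - sqrt (pi / u)\<bar> \<le> 2"
proof -
  define g where "g m = exp (- u * (of_int m + \<beta>)\<^sup>2)" for m :: int
  define f1 where "f1 m = exp (- u * (real m + \<beta>)\<^sup>2)" for m
  define f2 where "f2 m = exp (- u * (real m + (1 - \<beta>))\<^sup>2)" for m
  have s: "summable f1" "summable f2"
    unfolding f1_def f2_def using gauss_half_sum(1)[OF u] \<beta> by auto
  have "(f1 has_sum suminf f1) UNIV" "(f2 has_sum suminf f2) UNIV"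
    by (rule sums_nonneg_imp_has_sum; use s in \<open>auto simp: f1_def f2_def summable_sums\<close>)+
  moreover have "f1 = g \<circ> int" by (auto simp: f1_def g_def)
  moreover have "f2 = g \<circ> (\<lambda>i. - int i - 1)"
  proof
    fix i
    have "(real i + (1 - \<beta>))\<^sup>2 = (- real i - 1 + \<beta>)\<^sup>2" by (simp add: power2_eq_square algebra_simps)
    thus "f2 i = (g \<circ> (\<lambda>i. - int i - 1)) i" by (simp add: f2_def g_def)
  qed
  ultimately have "(g has_sum suminf f1) (range int)" "(g has_sum suminf f2) (range (\<lambda>i. - int i - 1))"
    by (simp_all add: has_sum_reindex inj_on_def)
  hence "(g has_sum (suminf f1 + suminf f2)) (range int \<union> range (\<lambda>i. - int i - 1))"
    by (rule has_sum_Un_disjoint) auto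
  moreover have "range int \<union> range (\<lambda>i. - int i - 1) = UNIV"
  proof (intro equalityI subsetI)
    fix m :: int
    show "m \<in> range int \<union> range (\<lambda>i. - int i - 1)"
    proof (cases "m \<ge> 0")
      case False
      hence "m = - int (nat (- m - 1)) - 1" by simp
      thus ?thesis by blast
    qed (metis UnI1 nat_0_le rangeI)
  qed auto
  moreover have "suminf f1 \<le> sqrt (pi / u) / 2 + 1" "suminf f1 \<ge> sqrt (pi / u) / 2 - \<beta>"
     "suminf f2 \<le> sqrt (pi / u) / 2 + 1" "suminf f2 \<ge> sqrt (pi / u) / 2 - (1 - \<beta>)"
    unfolding f1_def f2_def using gauss_half_sum(2,3)[OF u] \<beta> by auto
  hence "\<bar>suminf f1 + suminf f2 - sqrt (pi / u)\<bar> \<le> 2" by linarith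
  ultimately show ?thesis using that[of "suminf f1 + suminf f2"] by (simp add: g_def[abs_def])
qed

text \<open>Only the fractional part of \<beta> matters. The error is independent of \<beta>, as
  required in a theta series, where the shift varies with the outer variable.\<close>

lemma gauss_sum_int:
  fixes u \<beta> :: real
  assumes u: "u > 0"
  obtains T where "((\<lambda>m::int. exp (- u * (of_int m + \<beta>)\<^sup>2)) has_sum T) UNIV" "\<bar>T - sqrt (pi / u)\<bar> \<le> 2"
proof -
  obtain T where T: "((\<lambda>m::int. exp (- u * (of_int m + frac \<beta>)\<^sup>2)) has_sum T) UNIV" "\<bar>T - sqrt (pi / u)\<bar> \<le> 2"
    using gauss_sum_int_unit[OF u, of "frac \<beta>"] by (auto simp: frac_lt_1 less_imp_le)
  have "((\<lambda>m::int. exp (- u * (of_int m + frac \<beta>)\<^sup>2)) \<circ> (\<lambda>m. m + \<lfloor>\<beta>\<rfloor>) has_sum T) UNIV"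
    using T(1) has_sum_reindex[of "\<lambda>m. m + \<lfloor>\<beta>\<rfloor>" UNIV "\<lambda>m::int. exp (- u * (of_int m + frac \<beta>)\<^sup>2)" T]
    by (simp add: inj_on_def surj_plus_right[simplified add.commute] del: o_apply)
  also have "(\<lambda>m::int. exp (- u * (of_int m + frac \<beta>)\<^sup>2)) \<circ> (\<lambda>m. m + \<lfloor>\<beta>\<rfloor>) = (\<lambda>m. exp (- u * (of_int m + \<beta>)\<^sup>2))"
    by (auto simp: frac_def)
  finally show ?thesis using that T(2) by blast
qed

text \<open>Completing the square in m gives a (m + b n / (2a))^2 + \<delta> n^2. The inner sums are
  A and the outer sum is B, each up to an error of 2, and s A B is exactly 2 pi / sqrt (4 a c -
  b^2); multiplied by s, the errors become O(sqrt s).\<close>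

lemma theta_form_bound:
  fixes a b c s :: real
  assumes a: "a > 0" and D: "4 * a * c - b\<^sup>2 > 0" and s: "s > 0"
  obtains P where "((\<lambda>(n::int, m::int). exp (- s * (a * (of_int m)\<^sup>2 + b * of_int m * of_int n + c * (of_int n)\<^sup>2))) has_sum P) UNIV"
    "\<bar>s * P - 2 * pi / sqrt (4 * a * c - b\<^sup>2)\<bar> \<le> sqrt s * (2 * sqrt (pi / a) + 2 * sqrt (pi / ((4 * a * c - b\<^sup>2) / (4 * a)))) + 4 * s"
proof -
  define \<delta> where "\<delta> = (4 * a * c - b\<^sup>2) / (4 * a)"
  have \<delta>: "\<delta> > 0" using a D by (simp add: \<delta>_def)
  define A where "A = sqrt (pi / (s * a))"
  define B where "B = sqrt (pi / (s * \<delta>))"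
  have sa: "s * a > 0" "s * \<delta> > 0" using a s \<delta> by auto
  have "\<exists>T. ((\<lambda>m::int. exp (- (s * a) * (of_int m + b * of_int n / (2 * a))\<^sup>2)) has_sum T) UNIV \<and> \<bar>T - A\<bar> \<le> 2" for n :: int
    unfolding A_def by (rule gauss_sum_int[OF sa(1), of "b * of_int n / (2 * a)"]) blast
  then obtain T where T: "\<And>n::int. ((\<lambda>m::int. exp (- (s * a) * (of_int m + b * of_int n / (2 * a))\<^sup>2)) has_sum T n) UNIV"
    "\<And>n. \<bar>T n - A\<bar> \<le> 2" by metis
  obtain W where W: "((\<lambda>n::int. exp (- (s * \<delta>) * (of_int n)\<^sup>2)) has_sum W) UNIV" "\<bar>W - B\<bar> \<le> 2"
    using gauss_sum_int[OF sa(2), of 0] unfolding B_def by auto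
  define w where "w n = exp (- (s * \<delta>) * (of_int n)\<^sup>2)" for n :: int
  have W': "(w has_sum W) UNIV" using W(1) by (simp add: w_def[abs_def])
  have T0: "T n \<ge> 0" for n using has_sum_nonneg[OF T(1)] by simp
  have TA: "T n \<le> A + 2" for n using T(2)[of n] by linarith
  have "(\<lambda>n. w n * T n) summable_on UNIV"
  proof (rule summable_on_comparison_test)
    show "(\<lambda>n. w n * (A + 2)) summable_on UNIV"
      using has_sum_cmult_left[OF W'] by (auto simp: summable_on_def)
  qed (use T0 TA in \<open>auto simp: w_def intro!: mult_left_mono\<close>)
  then obtain P where P: "((\<lambda>n. w n * T n) has_sum P) UNIV" by (auto simp: summable_on_def)
  define q where "q n m = a * (of_int m)\<^sup>2 + b * of_int m * of_int n + c * (of_int n)\<^sup>2" for n m :: int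
  have split: "exp (- s * q n m) = w n * exp (- (s * a) * (of_int m + b * of_int n / (2 * a))\<^sup>2)" for n m
  proof -
    have "- s * q n m = - (s * \<delta>) * (of_int n)\<^sup>2 + - (s * a) * (of_int m + b * of_int n / (2 * a))\<^sup>2"
      using a by (simp add: q_def \<delta>_def field_simps power2_eq_square)
    thus ?thesis unfolding w_def exp_add[symmetric] by simp
  qed
  have inner: "((\<lambda>m. exp (- s * q n m)) has_sum w n * T n) UNIV" for n
    unfolding split by (intro has_sum_cmult_right T)
  have "(\<lambda>(n, m). exp (- s * q n m)) summable_on Sigma UNIV (\<lambda>_. UNIV)"
    by (rule summable_on_SigmaI[where g = "\<lambda>n. w n * T n"]) (use inner P in \<open>auto simp: summable_on_def\<close>)
  hence "((\<lambda>(n, m). exp (- s * q n m)) has_sum P) (Sigma UNIV (\<lambda>_. UNIV))"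
    by (intro has_sum_SigmaI[where g = "\<lambda>n. w n * T n"]) (use inner P in auto)
  hence sum: "((\<lambda>(n, m). exp (- s * q n m)) has_sum P) UNIV" by simp
  have "P \<le> W * (A + 2)" "W * (A - 2) \<le> P"
  proof -
    show "P \<le> W * (A + 2)"
      by (rule has_sum_mono[OF P has_sum_cmult_left[OF W']]) (use TA in \<open>auto simp: w_def intro!: mult_left_mono\<close>)
    have "A - 2 \<le> T n" for n using T(2)[of n] by linarith
    thus "W * (A - 2) \<le> P"
      by (intro has_sum_mono[OF has_sum_cmult_left[OF W'] P]) (auto simp: w_def intro!: mult_left_mono)
  qed
  hence "\<bar>P - W * A\<bar> \<le> 2 * W" by (simp add: abs_le_iff algebra_simps)
  moreover have "\<bar>W * A - B * A\<bar> \<le> 2 * A"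
    using W(2) mult_right_mono[of "\<bar>W - B\<bar>" 2 A] sa by (simp add: A_def left_diff_distrib[symmetric] abs_mult)
  moreover have "W \<le> B + 2" using W(2) by linarith
  ultimately have PB: "\<bar>P - B * A\<bar> \<le> 2 * B + 2 * A + 4" by linarith

  have A': "A = sqrt (pi / a) / sqrt s" "B = sqrt (pi / \<delta>) / sqrt s"
    by (simp_all add: A_def B_def real_sqrt_divide real_sqrt_mult)
  have sq: "s / sqrt s = sqrt s" using s by (simp add: real_div_sqrt)
  have sX: "s * (X / sqrt s) = sqrt s * X" for X
  proof -
    have "s * (X / sqrt s) = (s / sqrt s) * X" by simp
    thus ?thesis unfolding sq .
  qed
  have sA: "s * A = sqrt s * sqrt (pi / a)" and sB: "s * B = sqrt s * sqrt (pi / \<delta>)"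
    unfolding A' by (rule sX)+
  have "(s * (B * A))\<^sup>2 = (2 * pi / sqrt (4 * a * c - b\<^sup>2))\<^sup>2"
    using s a \<delta> D by (simp add: A_def B_def power_mult_distrib power_divide \<delta>_def) (simp add: field_simps power2_eq_square)
  hence sBA: "s * (B * A) = 2 * pi / sqrt (4 * a * c - b\<^sup>2)"
    by (rule power2_eq_imp_eq) (use s a \<delta> D in \<open>auto simp: A_def B_def\<close>)
  have "\<bar>s * P - s * (B * A)\<bar> = s * \<bar>P - B * A\<bar>"
    using s by (simp add: right_diff_distrib[symmetric] abs_mult)
  also have "\<dots> \<le> s * (2 * B + 2 * A + 4)" using PB s by (intro mult_left_mono) auto
  also have "\<dots> = sqrt s * (2 * sqrt (pi / a) + 2 * sqrt (pi / \<delta>)) + 4 * s"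
    using sA sB by (simp add: algebra_simps)
  finally show ?thesis using that[of P] sum unfolding sBA q_def \<delta>_def by blast
qed

lemma theta_form_limit:
  fixes a b c :: real
  assumes a: "a > 0" and D: "4 * a * c - b\<^sup>2 > 0"
  obtains P where
    "\<And>s. s > 0 \<Longrightarrow> ((\<lambda>(n::int, m::int). exp (- s * (a * (of_int m)\<^sup>2 + b * of_int m * of_int n + c * (of_int n)\<^sup>2))) has_sum P s) UNIV"
    "((\<lambda>s. s * P s) \<longlongrightarrow> 2 * pi / sqrt (4 * a * c - b\<^sup>2)) (at_right 0)"
proof -
  define K where "K = 2 * sqrt (pi / a) + 2 * sqrt (pi / ((4 * a * c - b\<^sup>2) / (4 * a)))"
  have "\<exists>P. ((\<lambda>(n::int, m::int). exp (- s * (a * (of_int m)\<^sup>2 + b * of_int m * of_int n + c * (of_int n)\<^sup>2))) has_sum P) UNIV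
      \<and> \<bar>s * P - 2 * pi / sqrt (4 * a * c - b\<^sup>2)\<bar> \<le> sqrt s * K + 4 * s" if "s > 0" for s
    unfolding K_def by (rule theta_form_bound[OF a D that]) blast
  hence "\<forall>s. \<exists>P. s > 0 \<longrightarrow> ((\<lambda>(n::int, m::int). exp (- s * (a * (of_int m)\<^sup>2 + b * of_int m * of_int n + c * (of_int n)\<^sup>2))) has_sum P) UNIV
      \<and> \<bar>s * P - 2 * pi / sqrt (4 * a * c - b\<^sup>2)\<bar> \<le> sqrt s * K + 4 * s" by blast
  from choice[OF this] obtain P where P: "\<And>s. s > 0 \<Longrightarrow> ((\<lambda>(n::int, m::int). exp (- s * (a * (of_int m)\<^sup>2 + b * of_int m * of_int n + c * (of_int n)\<^sup>2))) has_sum P s) UNIV"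
    "\<And>s. s > 0 \<Longrightarrow> \<bar>s * P s - 2 * pi / sqrt (4 * a * c - b\<^sup>2)\<bar> \<le> sqrt s * K + 4 * s" by blast
  have "((\<lambda>s. s * P s - 2 * pi / sqrt (4 * a * c - b\<^sup>2)) \<longlongrightarrow> 0) (at_right 0)"
  proof (rule Lim_null_comparison)
    show "eventually (\<lambda>s. norm (s * P s - 2 * pi / sqrt (4 * a * c - b\<^sup>2)) \<le> sqrt s * K + 4 * s) (at_right 0)"
      using P(2) by (auto simp: eventually_at_filter)
    have "((\<lambda>s. sqrt s * K + 4 * s) \<longlongrightarrow> sqrt 0 * K + 4 * 0) (at_right 0)"
      by (intro tendsto_intros)
    thus "((\<lambda>s. sqrt s * K + 4 * s) \<longlongrightarrow> 0) (at_right 0)" by simp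
  qed
  hence "((\<lambda>s. s * P s) \<longlongrightarrow> 2 * pi / sqrt (4 * a * c - b\<^sup>2)) (at_right 0)"
    using Lim_null by blast
  thus ?thesis using that P(1) by blast
qed

section \<open>Lambert series\<close>

text \<open>Logarithmic derivative of Euler's reflection formula for
  \<open>rGamma z * rGamma (1 - z)\<close>.\<close>

lemma Digamma_reflection:
  fixes z :: complex
  assumes z: "z \<notin> \<int>"
  shows "Digamma (1 - z) - Digamma z = of_real pi * cot (of_real pi * z)"
proof -
  have "1 - z \<notin> \<int>" using z Ints_diff[of 1 "1 - z"] by auto
  hence nz: "z \<notin> \<int>\<^sub>\<le>\<^sub>0" "1 - z \<notin> \<int>\<^sub>\<le>\<^sub>0"
    using z by (auto dest: nonpos_Ints_Int)
  define R where "R = (\<lambda>z :: complex. rGamma z * rGamma (1 - z))"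
  have R: "R = (\<lambda>z. sin (of_real pi * z) / of_real pi)"
    by (simp add: R_def rGamma_reflection_complex)
  have d0: "((\<lambda>z. rGamma (1 - z)) has_field_derivative (- rGamma (1 - z) * Digamma (1 - z)) * (0 - 1)) (at z)"
    by (rule DERIV_chain2[where f = rGamma and g = "\<lambda>z. 1 - z", OF has_field_derivative_rGamma_no_nonpos_int[OF nz(2)]])
       (intro derivative_intros)
  have "(R has_field_derivative (- rGamma z * Digamma z) * rGamma (1 - z) + ((- rGamma (1 - z) * Digamma (1 - z)) * (0 - 1)) * rGamma z) (at z)"
    unfolding R_def by (rule DERIV_cong[OF DERIV_mult'[OF has_field_derivative_rGamma_no_nonpos_int[OF nz(1)] d0]]) simp
  moreover have "(R has_field_derivative cos (of_real pi * z)) (at z)"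
    unfolding R by (auto intro!: derivative_eq_intros)
  ultimately have "(- rGamma z * Digamma z) * rGamma (1 - z) + ((- rGamma (1 - z) * Digamma (1 - z)) * (0 - 1)) * rGamma z = cos (of_real pi * z)"
    by (rule DERIV_unique)
  hence "R z * (Digamma (1 - z) - Digamma z) = cos (of_real pi * z)"
    by (simp add: R_def algebra_simps)
  moreover have "sin (of_real pi * z) \<noteq> 0"
  proof
    assume "sin (of_real pi * z) = 0"
    hence "R z = 0" by (simp add: R)
    thus False using nz by (simp add: R_def rGamma_eq_zero_iff)
  qed
  ultimately show ?thesis by (simp add: R cot_def field_simps)
qed

text \<open>Termwise difference of the Digamma series at 1 - x and x, in which the terms 1 / (n + 1)
  and the Euler constant cancel.\<close>

lemma cot_partial_fractions:
  fixes x :: real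
  assumes x: "0 < x" "x < 1"
  shows "(\<lambda>n. 1 / (real n + x) - 1 / (real n + (1 - x))) sums (pi * cot (pi * x))"
proof -
  define z where "z = complex_of_real x"
  have zZ: "z \<notin> \<int>"
  proof
    assume "z \<in> \<int>"
    then obtain i where "z = of_int i" by (auto elim: Ints_cases)
    hence "x = of_int i" unfolding z_def by (metis of_real_eq_iff of_real_of_int_eq)
    thus False using x by simp
  qed
  have "z \<noteq> 0" "1 - z \<noteq> 0" using zZ by auto
  from summable_Digamma[OF this(1)] summable_Digamma[OF this(2)]
  have "(\<lambda>n. (inverse (of_nat (Suc n)) - inverse (1 - z + of_nat n)) - (inverse (of_nat (Suc n)) - inverse (z + of_nat n)))
     sums ((Digamma (1 - z) + euler_mascheroni) - (Digamma z + euler_mascheroni))"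
    by (intro sums_diff) (simp_all add: Digamma_def summable_sums)
  also have "(Digamma (1 - z) + euler_mascheroni) - (Digamma z + euler_mascheroni) = of_real (pi * cot (pi * x))"
  proof -
    have "of_real pi * z = of_real (pi * x)" by (simp add: z_def)
    hence "sin (of_real pi * z) = of_real (sin (pi * x))" "cos (of_real pi * z) = of_real (cos (pi * x))"
      by (simp_all only: sin_of_real cos_of_real)
    thus ?thesis using Digamma_reflection[OF zZ] by (simp add: cot_def)
  qed
  also have "(\<lambda>n. (inverse (of_nat (Suc n)) - inverse (1 - z + of_nat n)) - (inverse (of_nat (Suc n)) - inverse (z + of_nat n)))
      = (\<lambda>n. of_real (1 / (real n + x) - 1 / (real n + (1 - x))))"
    by (auto simp: z_def inverse_eq_divide add_ac)
  finally show ?thesis by (simp only: sums_of_real_iff)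
qed

lemma has_sum_geometric_exp:
  fixes t :: real
  assumes "t > 0"
  shows "((\<lambda>m::nat. exp (- t * real m)) has_sum (1 / (exp t - 1))) {1..}"
proof -
  have "(\<lambda>m. exp (- t) * exp (- t) ^ m) sums (exp (- t) * (1 / (1 - exp (- t))))"
    by (intro sums_mult geometric_sums) (use assms in simp)
  moreover have "exp (- t) * (1 / (1 - exp (- t))) = 1 / (exp t - 1)"
    using assms by (simp add: exp_minus field_simps)
  moreover have "(\<lambda>m. exp (- t) * exp (- t) ^ m) = (\<lambda>m. exp (- t * real (Suc m)))"
    by (simp add: exp_of_nat_mult[symmetric] exp_add[symmetric] algebra_simps)
  ultimately have "((\<lambda>m. exp (- t * real (Suc m))) has_sum (1 / (exp t - 1))) UNIV"
    by (intro sums_nonneg_imp_has_sum) auto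
  hence "((\<lambda>m. exp (- t * real m)) has_sum (1 / (exp t - 1))) (range Suc)"
    by (simp add: has_sum_reindex o_def)
  also have "range Suc = {1..}" by (auto simp: image_iff Suc_le_eq gr0_conv_Suc)
  finally show ?thesis .
qed

text \<open>The Lambert series identity, by summing over the pairs \<open>(d, n / d)\<close> in two ways.\<close>

lemma lambert_series:
  fixes X :: "nat \<Rightarrow> real" and s :: real
  assumes X: "\<And>n. \<bar>X n\<bar> \<le> 1" and s: "s > 0"
  obtains S where "((\<lambda>d. X d / (exp (s * real d) - 1)) has_sum S) {1..}"
    "((\<lambda>n. (\<Sum>d | d dvd n. X d) * exp (- s * real n)) has_sum S) {1..}"
proof -
  define f where "f = (\<lambda>(d, m). X d * exp (- s * real d * real m))"
  have inner: "((\<lambda>m. exp (- (s * real d) * real m)) has_sum 1 / (exp (s * real d) - 1)) {1..}" if "d \<in> {1..}" for d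
    by (rule has_sum_geometric_exp) (use that s in auto)
  \<comment> \<open>Comparison with a geometric series gives absolute summability over all pairs,
    which justifies both orders of summation.\<close>
  have "(\<lambda>d. 1 / (exp (s * real d) - 1)) summable_on {1..}"
  proof (rule summable_on_comparison_test)
    show "(\<lambda>d. exp (- s * real d) * (1 / (1 - exp (- s)))) summable_on {1..}"
      using has_sum_cmult_left[OF has_sum_geometric_exp[OF s], of "1 / (1 - exp (- s))"]
      unfolding summable_on_def by blast
    fix d :: nat assume d: "d \<in> {1..}"
    have "s * 1 \<le> s * real d" using d s by (intro mult_left_mono) auto
    hence e: "exp (- (s * real d)) \<le> exp (- s)" by simp
    have "1 / (exp (s * real d) - 1) = exp (- (s * real d)) / (1 - exp (- (s * real d)))"
      using d s by (simp add: exp_minus field_simps)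
    also have "\<dots> \<le> exp (- (s * real d)) / (1 - exp (- s))"
      by (rule divide_left_mono) (use e s d in auto)
    finally show "1 / (exp (s * real d) - 1) \<le> exp (- s * real d) * (1 / (1 - exp (- s)))" by simp
    show "0 \<le> 1 / (exp (s * real d) - 1)" using d s by simp
  qed
  hence "(\<lambda>(d, m). exp (- (s * real d) * real m)) summable_on Sigma {1..} (\<lambda>_. {1..})"
    by (intro summable_on_SigmaI[where g = "\<lambda>d. 1 / (exp (s * real d) - 1)"]) (use inner in auto)
  hence "(\<lambda>z. norm (f z)) summable_on Sigma {1..} (\<lambda>_. {1..})"
  proof (rule Infinite_Sum.abs_summable_on_comparison_test')
    fix z :: "nat \<times> nat" assume "z \<in> {1..} \<times> {1..}"
    obtain d m where z: "z = (d, m)" by (cases z)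
    show "norm (f z) \<le> (case z of (d, m) \<Rightarrow> exp (- (s * real d) * real m))"
      using mult_right_mono[OF X[of d], of "exp (- (s * real d * real m))"] by (simp add: z f_def abs_mult)
  qed
  hence "f summable_on Sigma {1..} (\<lambda>_. {1..})" by (rule Infinite_Sum.abs_summable_summable)
  then obtain S where S: "(f has_sum S) (Sigma {1..} (\<lambda>_. {1..}))" by (auto simp: summable_on_def)
  have "((\<lambda>d. X d * (1 / (exp (s * real d) - 1))) has_sum S) {1..}"
  proof (rule has_sum_Sigma'[OF S])
    fix d :: nat assume "d \<in> {1..}"
    from has_sum_cmult_right[OF inner[OF this], of "X d"]
    show "((\<lambda>m. f (d, m)) has_sum X d * (1 / (exp (s * real d) - 1))) {1..}" by (simp add: f_def)
  qed
  moreover have "((\<lambda>n. (\<Sum>d | d dvd n. X d) * exp (- s * real n)) has_sum S) {1..}"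
  proof -
    define g where "g = (\<lambda>(n, d). X d * exp (- s * real n))"
    have bij: "bij_betw (\<lambda>(n, d). (d, n div d)) (Sigma {1::nat..} (\<lambda>n. {d. d dvd n})) (Sigma {1::nat..} (\<lambda>_. {1::nat..}))"
    proof (rule bij_betwI[where g = "\<lambda>(d, m). (d * m, d)"])
      show "(\<lambda>(n, d). (d, n div d)) \<in> Sigma {1::nat..} (\<lambda>n. {d. d dvd n}) \<rightarrow> Sigma {1::nat..} (\<lambda>_. {1::nat..})"
      proof (rule funcsetI)
        fix z :: "nat \<times> nat" assume "z \<in> Sigma {1::nat..} (\<lambda>n. {d. d dvd n})"
        then obtain n d where z: "z = (n, d)" "n \<ge> 1" "d dvd n" by auto
        then obtain m where m: "n = d * m" by (auto elim: dvdE)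
        hence "d > 0" "m > 0" using z by (auto intro!: Nat.gr0I)
        thus "(\<lambda>(n, d). (d, n div d)) z \<in> Sigma {1::nat..} (\<lambda>_. {1::nat..})" by (simp add: z(1) m Suc_le_eq)
      qed
    next
      fix z :: "nat \<times> nat" assume "z \<in> Sigma {1::nat..} (\<lambda>n. {d. d dvd n})"
      then obtain n d where "z = (n, d)" "d dvd n" by auto
      thus "(\<lambda>(d, m). (d * m, d)) ((\<lambda>(n, d). (d, n div d)) z) = z" by simp
    qed (auto simp: Suc_le_eq)
    have "((\<lambda>z. f (case z of (n, d) \<Rightarrow> (d, n div d))) has_sum S) (Sigma {1..} (\<lambda>n. {d. d dvd n}))"
      using S has_sum_reindex_bij_betw[OF bij] by blast
    also have "?this \<longleftrightarrow> (g has_sum S) (Sigma {1..} (\<lambda>n. {d. d dvd n}))"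
      by (rule has_sum_cong) (auto simp: f_def g_def elim!: dvdE)
    finally show ?thesis
      by (rule has_sum_Sigma') (auto simp: g_def sum_distrib_right intro!: has_sum_finiteI finite_divisors_nat)
  qed
  ultimately show ?thesis using that by simp
qed

text \<open>The difference has derivative cosh (t / 2) - 1, half of a square. The estimate serves to
  bound the derivative of \<open>lambert_kernel\<close> independently of s.\<close>

lemma two_sinh_half_ge:
  fixes t :: real
  assumes "t \<ge> 0"
  shows "t \<le> exp (t / 2) - exp (- t / 2)"
proof -
  define v where "v t = exp (t / 2) - exp (- t / 2) - t" for t :: real
  have "v 0 \<le> v t"
  proof (rule DERIV_nonneg_imp_nondecreasing[OF assms])
    fix x :: real
    have "(v has_real_derivative (exp (x / 2) + exp (- x / 2)) / 2 - 1) (at x)"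
      unfolding v_def by (auto intro!: derivative_eq_intros simp: field_simps)
    moreover have "(exp (x / 2) + exp (- x / 2)) / 2 - 1 \<ge> 0"
    proof -
      have "0 \<le> (exp (x / 4) - exp (- x / 4))\<^sup>2" by simp
      also have "\<dots> = exp (x / 2) + exp (- x / 2) - 2"
        by (simp add: power2_eq_square algebra_simps exp_add[symmetric] flip: exp_minus)
      finally show ?thesis by simp
    qed
    ultimately show "\<exists>y. (v has_real_derivative y) (at x) \<and> 0 \<le> y" by blast
  qed
  thus ?thesis by (simp add: v_def)
qed

text \<open>The Lambert weight at x, multiplied by s so that it tends to 1 / x as s tends to
  0.\<close>

definition lambert_kernel :: "real \<Rightarrow> real \<Rightarrow> real" where
  "lambert_kernel s x = s / (exp (s * x) - 1)"

text \<open>Mean value theorem, the derivative at z being at most 1 / z^2 in modulus. That s is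
  absent from the bound is the point: it supplies the majorant for the limit.\<close>

lemma lambert_kernel_diff:
  assumes s: "s > 0" and xy: "0 < x" "x \<le> y"
  shows "\<bar>lambert_kernel s y - lambert_kernel s x\<bar> \<le> (y - x) / x\<^sup>2"
proof (cases "x = y")
  case False
  hence lt: "x < y" using xy by simp
  have D: "(lambert_kernel s has_real_derivative - (s\<^sup>2 * exp (s * z) / (exp (s * z) - 1)\<^sup>2)) (at z)" if "z > 0" for z
  proof -
    have "exp (s * z) - 1 \<noteq> 0" using s that by simp
    thus ?thesis unfolding lambert_kernel_def[abs_def]
      by (auto intro!: derivative_eq_intros simp: power2_eq_square)
  qed
  obtain z where z: "z > x" "z < y" "lambert_kernel s y - lambert_kernel s x = (y - x) * - (s\<^sup>2 * exp (s * z) / (exp (s * z) - 1)\<^sup>2)"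
    using MVT2[OF lt, of "lambert_kernel s" "\<lambda>z. - (s\<^sup>2 * exp (s * z) / (exp (s * z) - 1)\<^sup>2)"] D xy by auto
  have z0: "z > 0" using z xy by linarith
  have "s * z * exp (s * z / 2) \<le> (exp (s * z / 2) - exp (- (s * z) / 2)) * exp (s * z / 2)"
    by (rule mult_right_mono) (use two_sinh_half_ge[of "s * z"] s z0 in auto)
  also have "\<dots> = exp (s * z) - 1" by (simp add: left_diff_distrib exp_add[symmetric])
  finally have "(s * z * exp (s * z / 2))\<^sup>2 \<le> (exp (s * z) - 1)\<^sup>2"
    by (rule power_mono) (use s z0 in auto)
  hence "z\<^sup>2 * (s\<^sup>2 * exp (s * z)) \<le> (exp (s * z) - 1)\<^sup>2"
    by (simp add: power_mult_distrib exp_double[symmetric] ac_simps)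
  moreover have "(exp (s * z) - 1)\<^sup>2 > 0" using s z0 by simp
  ultimately have b: "s\<^sup>2 * exp (s * z) / (exp (s * z) - 1)\<^sup>2 \<le> 1 / z\<^sup>2"
    using z0 by (simp add: field_simps)
  have "\<bar>lambert_kernel s y - lambert_kernel s x\<bar> = (y - x) * (s\<^sup>2 * exp (s * z) / (exp (s * z) - 1)\<^sup>2)"
    using lt by (simp add: z(3) abs_mult)
  also have "\<dots> \<le> (y - x) * (1 / z\<^sup>2)" by (rule mult_left_mono[OF b]) (use lt in simp)
  also have "\<dots> \<le> (y - x) * (1 / x\<^sup>2)"
    by (intro mult_left_mono divide_left_mono power_mono) (use lt xy z in auto)
  finally show ?thesis by simp
qed simp

lemma lambert_kernel_tendsto:
  assumes "x > 0"
  shows "((\<lambda>s. lambert_kernel s x) \<longlongrightarrow> 1 / x) (at_right 0)"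
proof -
  have "((\<lambda>s. s / (exp (s * x) - 1)) \<longlongrightarrow> inverse x) (at_right 0)"
    using assms by real_asymp
  thus ?thesis by (simp add: lambert_kernel_def inverse_eq_divide)
qed

text \<open>Averaging with the reflection of i to k - i replaces single values of g by differences;
  for the m-th period these are of order 1/m^2, while single terms are only of order 1/m.\<close>

lemma sum_odd_reflect:
  fixes X :: "nat \<Rightarrow> real"
  assumes odd: "\<And>j. 0 < j \<Longrightarrow> j < k \<Longrightarrow> X (k - j) = - X j"
  shows "(\<Sum>i=1..<k. X i * g i) = (\<Sum>i=1..<k. X i * ((g i - g (k - i)) / 2))"
proof -
  have "(\<Sum>i=1..<k. X i * g (k - i)) = (\<Sum>i=1..<k. X (k - i) * g i)"
    by (rule sum.reindex_bij_witness[of _ "\<lambda>i. k - i" "\<lambda>i. k - i"]) auto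
  also have "\<dots> = (\<Sum>i=1..<k. - (X i * g i))" by (intro sum.cong refl) (use odd in auto)
  finally have "(\<Sum>i=1..<k. X i * g (k - i)) = - (\<Sum>i=1..<k. X i * g i)" by (simp add: sum_negf)
  thus ?thesis by (simp add: right_diff_distrib sum_subtractf sum_divide_distrib[symmetric] diff_divide_distrib)
qed

text \<open>The series is cut into periods, and \<open>a m s\<close> is the m-th one after
  antisymmetrization. It is at most k^2 / (m + 1)^2 for every s > 0, so Tannery's theorem gives the
  termwise limit, which the partial fractions of the cotangent sum up.\<close>

lemma lambert_limit:
  fixes X :: "nat \<Rightarrow> real" and k :: nat
  assumes k: "k > 0" and per: "\<And>n. X (n + k) = X n" and X: "\<And>n. \<bar>X n\<bar> \<le> 1" and X0: "X 0 = 0"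
    and odd: "\<And>j. 0 < j \<Longrightarrow> j < k \<Longrightarrow> X (k - j) = - X j"
    and F: "\<And>s. s > 0 \<Longrightarrow> ((\<lambda>n. (\<Sum>d | d dvd n. X d) * exp (- s * real n)) has_sum F s) {1..}"
  shows "((\<lambda>s. s * F s) \<longlongrightarrow> pi / (2 * real k) * (\<Sum>j=1..<k. X j * cot (pi * real j / real k))) (at_right 0)"
proof -
  define a where "a m s = (\<Sum>i=1..<k. X i * ((lambert_kernel s (real (m * k + i)) - lambert_kernel s (real (m * k + (k - i)))) / 2))"
    for m s
  define b where "b m = (\<Sum>i=1..<k. X i * ((1 / real (m * k + i) - 1 / real (m * k + (k - i))) / 2))" for m
  have perm: "X (m * k + i) = X i" for m i
  proof (induction m)
    case (Suc m)
    thus ?case using per[of "m * k + i"] by (simp add: add_ac)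
  qed simp
  have asum: "(\<lambda>m. a m s) sums (s * F s)" if s: "s > 0" for s
  proof -
    obtain S where S: "((\<lambda>d. X d / (exp (s * real d) - 1)) has_sum S) {1..}"
      "((\<lambda>n. (\<Sum>d | d dvd n. X d) * exp (- s * real n)) has_sum S) {1..}"
      by (rule lambert_series[OF X s])
    have "S = F s" using has_sum_unique[OF S(2) F[OF s]] .
    have "((\<lambda>d. s * (X d / (exp (s * real d) - 1))) has_sum s * F s) {1..}"
      using has_sum_cmult_right[OF S(1), of s] unfolding \<open>S = F s\<close> .
    also have "?this \<longleftrightarrow> ((\<lambda>d. X d * lambert_kernel s (real d)) has_sum s * F s) UNIV"
      by (rule has_sum_cong_neutral) (auto simp: lambert_kernel_def X0 not_less_eq_eq)
    finally have "(\<lambda>d. X d * lambert_kernel s (real d)) sums (s * F s)" by (rule has_sum_imp_sums)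
    hence "(\<lambda>m. \<Sum>d=m*k..<m*k+k. X d * lambert_kernel s (real d)) sums (s * F s)"
      using k by (rule sums_group)
    also have "(\<lambda>m. \<Sum>d=m*k..<m*k+k. X d * lambert_kernel s (real d)) = (\<lambda>m. a m s)"
    proof
      fix m
      have "(\<Sum>d=m*k..<m*k+k. X d * lambert_kernel s (real d)) = (\<Sum>i=0..<k. X (m * k + i) * lambert_kernel s (real (m * k + i)))"
        using sum.shift_bounds_nat_ivl[of "\<lambda>d. X d * lambert_kernel s (real d)" 0 "m * k" k] by (simp add: add_ac)
      also have "\<dots> = (\<Sum>i=1..<k. X i * lambert_kernel s (real (m * k + i)))"
        using k by (simp add: perm X0 sum.atLeast_Suc_lessThan)
      also have "\<dots> = a m s" unfolding a_def by (rule sum_odd_reflect[where X = X and k = k, OF odd])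
      finally show "(\<Sum>d=m*k..<m*k+k. X d * lambert_kernel s (real d)) = a m s" .
    qed
    finally show ?thesis .
  qed
  have bsum: "b sums (pi / (2 * real k) * (\<Sum>j=1..<k. X j * cot (pi * real j / real k)))"
  proof -
    have "(\<lambda>m. X i * ((1 / real (m * k + i) - 1 / real (m * k + (k - i))) / 2)) sums
        (X i * (pi / (2 * real k) * cot (pi * real i / real k)))" if i: "i \<in> {1..<k}" for i
    proof -
      have "(\<lambda>m. (1 / (2 * real k)) * (1 / (real m + real i / real k) - 1 / (real m + (1 - real i / real k)))) sums
          ((1 / (2 * real k)) * (pi * cot (pi * (real i / real k))))"
        by (rule sums_mult[OF cot_partial_fractions]) (use i in auto)
      also have "(\<lambda>m. (1 / (2 * real k)) * (1 / (real m + real i / real k) - 1 / (real m + (1 - real i / real k))))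
          = (\<lambda>m. (1 / real (m * k + i) - 1 / real (m * k + (k - i))) / 2)"
      proof
        fix m
        have "real m + real i / real k = real (m * k + i) / real k" using k by (simp add: field_simps)
        moreover have "real m + (1 - real i / real k) = real (m * k + (k - i)) / real k"
          using k i by (simp add: field_simps of_nat_diff)
        moreover have "(1 / (2 * K)) * (1 / (A / K) - 1 / (B / K)) = (1 / A - 1 / B) / 2" if "K \<noteq> 0" for A B K :: real
        proof -
          have "(1 / (2 * K)) * (1 / (A / K) - 1 / (B / K)) = (1 / (2 * K)) * (K * (1 / A - 1 / B))"
            by (simp add: right_diff_distrib)
          thus ?thesis using that by simp
        qed
        moreover have "real k \<noteq> 0" using k by simp
        ultimately show "(1 / (2 * real k)) * (1 / (real m + real i / real k) - 1 / (real m + (1 - real i / real k)))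
            = (1 / real (m * k + i) - 1 / real (m * k + (k - i))) / 2"
          by (simp only:)
      qed
      finally show ?thesis by (intro sums_mult) simp
    qed
    hence "b sums (\<Sum>i=1..<k. X i * (pi / (2 * real k) * cot (pi * real i / real k)))"
      unfolding b_def by (rule sums_sum)
    thus ?thesis by (simp add: sum_distrib_left ac_simps)
  qed
  have "((\<lambda>s. \<Sum>m. a m s) \<longlongrightarrow> suminf b) (at_right 0)"
  proof (rule tannerys_theorem[THEN conjunct2, THEN conjunct2])
    show "((\<lambda>s. a m s) \<longlongrightarrow> b m) (at_right 0)" for m
      unfolding a_def b_def
    proof (intro tendsto_intros lambert_kernel_tendsto)
      fix i assume "i \<in> {1..<k}"
      hence "m * k + i > 0" "m * k + (k - i) > 0" by auto
      thus "real (m * k + i) > 0" "real (m * k + (k - i)) > 0" by (simp_all only: of_nat_0_less_iff)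
    qed auto
    have "norm (a m s) \<le> real k * real k * inverse ((real (Suc m))\<^sup>2)" if s: "s > 0" for m s
    proof -
      have "norm (a m s) \<le> (\<Sum>i=1..<k. real k * inverse ((real (Suc m))\<^sup>2))"
        unfolding a_def
      proof (rule sum_norm_le)
        fix i assume i: "i \<in> {1..<k}"
        have m1: "real (Suc m) \<le> real (m * k + j)" if "j \<ge> 1" for j
        proof -
          have "m * 1 \<le> m * k" using k by (intro mult_le_mono2) simp
          thus ?thesis using that by (simp only: of_nat_le_iff)
        qed
        have key: "\<bar>lambert_kernel s y - lambert_kernel s x\<bar> \<le> real k * inverse ((real (Suc m))\<^sup>2)"
          if "real (Suc m) \<le> x" "x \<le> y" "y - x \<le> real k" for x y
        proof -
          have x0: "x > 0" using that(1) by (simp add: less_le_trans[OF _ that(1)])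
          have "\<bar>lambert_kernel s y - lambert_kernel s x\<bar> \<le> (y - x) / x\<^sup>2"
            by (rule lambert_kernel_diff[OF s x0 that(2)])
          also have "\<dots> \<le> real k / (real (Suc m))\<^sup>2"
            by (rule frac_le) (use that k in \<open>auto intro!: power_mono\<close>)
          finally show ?thesis by (simp add: divide_inverse)
        qed
        define x y where "x = real (m * k + i)" and "y = real (m * k + (k - i))"
        have xy: "real (Suc m) \<le> x" "real (Suc m) \<le> y"
          unfolding x_def y_def using i by (intro m1; auto)+
        have yx: "\<bar>y - x\<bar> \<le> real k" using i by (auto simp: x_def y_def of_nat_diff abs_le_iff)
        have "\<bar>lambert_kernel s x - lambert_kernel s y\<bar> \<le> real k * inverse ((real (Suc m))\<^sup>2)"
          using key[of x y] key[of y x] xy yx by (cases "x \<le> y") (auto simp: abs_minus_commute)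
        moreover have "norm (X i * ((lambert_kernel s x - lambert_kernel s y) / 2)) \<le> 1 * \<bar>lambert_kernel s x - lambert_kernel s y\<bar>"
          unfolding norm_mult by (rule mult_mono) (use X[of i] in auto)
        ultimately show "norm (X i * ((lambert_kernel s (real (m * k + i)) - lambert_kernel s (real (m * k + (k - i)))) / 2))
           \<le> real k * inverse ((real (Suc m))\<^sup>2)" unfolding x_def y_def mult_1 by (rule order_trans[rotated])
      qed
      also have "\<dots> = real (k - 1) * (real k * inverse ((real (Suc m))\<^sup>2))" by simp
      also have "\<dots> \<le> real k * (real k * inverse ((real (Suc m))\<^sup>2))" by (intro mult_right_mono) auto
      finally show ?thesis by simp
    qed
    thus "\<forall>\<^sub>F (m, s) in sequentially \<times>\<^sub>F at_right 0. norm (a m s) \<le> real k * real k * inverse ((real (Suc m))\<^sup>2)"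
      unfolding eventually_prod_filter
      by (intro exI[of _ "\<lambda>_. True"] exI[of _ "\<lambda>s. s > 0"]) (auto simp: eventually_at_right_less)
    show "summable (\<lambda>m. real k * real k * inverse ((real (Suc m))\<^sup>2))"
      using inverse_power_summable[of 2, where 'a = real] by (intro summable_mult) (subst summable_Suc_iff, simp)
  qed simp
  moreover have "\<forall>\<^sub>F s in at_right 0. (\<Sum>m. a m s) = s * F s"
    using eventually_at_right_less[of "0::real"] by eventually_elim (use asum sums_unique in force)
  ultimately have "((\<lambda>s. s * F s) \<longlongrightarrow> suminf b) (at_right 0)" by (rule Lim_transform_eventually)
  thus ?thesis using sums_unique[OF bsum] by simp
qed

section \<open>The class number formula\<close>

text \<open>Points are grouped by their value under f. The one point of value 0 contributes 1 and is
  removed, whence P - 1.\<close>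

lemma has_sum_fibres_exp:
  fixes f :: "'z \<Rightarrow> int" and s P :: real
  assumes sum: "((\<lambda>z. exp (- s * of_int (f z))) has_sum P) UNIV"
    and nonneg: "\<And>z. f z \<ge> 0" and zero: "\<And>z. f z = 0 \<longleftrightarrow> z = w"
    and fin: "\<And>n. n > 0 \<Longrightarrow> finite {z. f z = int n}"
  shows "((\<lambda>n. real (card {z. f z = int n}) * exp (- s * real n)) has_sum (P - 1)) {1..}"
proof -
  define g where "g z = exp (- s * of_int (f z))" for z
  have "(g has_sum g w) {w}" by (rule has_sum_finiteI) auto
  moreover have "g w = 1" using zero[of w] by (simp add: g_def)
  moreover have "(g has_sum P) UNIV" using sum by (simp add: g_def[abs_def])
  ultimately have "(g has_sum (P - 1)) (UNIV - {w})" by (metis has_sum_Diff subset_UNIV)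
  moreover have bij: "bij_betw snd (Sigma {1::nat..} (\<lambda>n. {z. f z = int n})) (UNIV - {w})"
  proof (rule bij_betwI[where g = "\<lambda>z. (nat (f z), z)"])
    have pos: "f z > 0" if "z \<noteq> w" for z using nonneg[of z] zero[of z] that by linarith
    show "(\<lambda>z. (nat (f z), z)) \<in> UNIV - {w} \<rightarrow> Sigma {1::nat..} (\<lambda>n. {z. f z = int n})"
      using pos by (force simp: Suc_le_eq)
    show "snd \<in> Sigma {1::nat..} (\<lambda>n. {z. f z = int n}) \<rightarrow> UNIV - {w}"
    proof
      fix y assume "y \<in> Sigma {1::nat..} (\<lambda>n. {z. f z = int n})"
      hence "f (snd y) \<noteq> 0" by auto
      thus "snd y \<in> UNIV - {w}" using zero by auto
    qed
  qed auto
  ultimately have "((\<lambda>y. g (snd y)) has_sum (P - 1)) (Sigma {1::nat..} (\<lambda>n. {z. f z = int n}))"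
    using has_sum_reindex_bij_betw[OF bij, of g "P - 1"] by blast
  thus ?thesis
  proof (rule has_sum_Sigma')
    fix n :: nat assume n: "n \<in> {1..}"
    show "((\<lambda>z. g (snd (n, z))) has_sum real (card {z. f z = int n}) * exp (- s * real n)) {z. f z = int n}"
      by (rule has_sum_finiteI) (use fin[of n] n in \<open>auto simp: g_def\<close>)
  qed
qed

text \<open>The half-angle formula writes the cotangent in terms of \<open>ee k n\<close>, which
  makes its periodicity in n evident.\<close>

lemma cot_eq_ee: "cot (pi * real_of_int n / real_of_int k) = Im (ee k n) / (1 - Re (ee k n))"
proof -
  define x where "x = pi * real_of_int n / real_of_int k"
  have "Im (ee k n) = sin (2 * x)" "Re (ee k n) = cos (2 * x)"
    by (simp_all add: ee_def x_def mult.assoc)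
  moreover have "cot x = sin (2 * x) / (1 - cos (2 * x))"
    unfolding sin_double cos_double_sin by (simp add: cot_def power2_eq_square)
  ultimately show ?thesis by (simp add: x_def)
qed

section \<open>The contribution of a single ideal class, and the sum over all classes\<close>

context imaginary_quadratic
begin

lemma class_form_0_iff:
  assumes t: "t \<in> triples"
  shows "class_form t z = 0 \<longleftrightarrow> z = 0" and "class_form t z \<ge> 0"
proof -
  have e: "(cmod (lam t z))\<^sup>2 * real (tnorm t) = of_int (class_form t z)" by (rule class_form_norm[OF t])
  have "of_int (class_form t z) \<ge> (0 :: real)" unfolding e[symmetric] by simp
  thus "class_form t z \<ge> 0" by simp
  have "class_form t z = 0 \<longleftrightarrow> real_of_int (class_form t z) = 0" by simp
  also have "\<dots> \<longleftrightarrow> lam t z = 0" unfolding e[symmetric] using tnorm_pos[OF t] by simp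
  also have "\<dots> \<longleftrightarrow> z = 0" using lam_eq_iff[OF t, of z 0] by (simp add: lam_0)
  finally show "class_form t z = 0 \<longleftrightarrow> z = 0" .
qed

text \<open>The theta series of the form of discriminant -k has limit 2 pi / sqrt k. Each ideal of
  the class is represented twice, which halves the limit; the zero vector contributes nothing after
  multiplication by s.\<close>

lemma class_theta:
  assumes t: "t \<in> triples"
  obtains P where
    "\<And>s. s > 0 \<Longrightarrow> ((\<lambda>n. real (card {t' \<in> triples. tnorm t' = n \<and> (idl t', idl t) \<in> ideal_class_rel R}) * exp (- s * real n)) has_sum P s) {1..}"
    "((\<lambda>s. s * P s) \<longlongrightarrow> pi / rk) (at_right 0)"
proof -
  obtain c a x where tt: "t = (c, a, x)" by (cases t)
  obtain b where b: "x\<^sup>2 + x + offset = int a * b" using triples_cofactor t tt by blast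
  have apos: "real a > 0" using t by (auto simp: tt triples_def)
  have "4 * int a * b - (2 * x + 1)\<^sup>2 = 4 * (int a * b) - (4 * (x\<^sup>2 + x) + 1)"
    by (simp add: power2_eq_square algebra_simps)
  also have "\<dots> = k" unfolding b[symmetric] using offset by simp
  finally have "real_of_int (4 * int a * b - (2 * x + 1)\<^sup>2) = real_of_int k" by (simp only:)
  hence disc: "4 * real a * of_int b - (of_int (2 * x + 1))\<^sup>2 = real_of_int k" by simp
  hence discpos: "4 * real a * of_int b - (real_of_int (2 * x + 1))\<^sup>2 > 0" using k_ge by simp
  obtain P where P: "\<And>s. s > 0 \<Longrightarrow> ((\<lambda>(n::int, m::int). exp (- s * (real a * (of_int m)\<^sup>2 + of_int (2 * x + 1) * of_int m * of_int n + of_int b * (of_int n)\<^sup>2))) has_sum P s) UNIV"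
    "((\<lambda>s. s * P s) \<longlongrightarrow> 2 * pi / sqrt (4 * real a * of_int b - (of_int (2 * x + 1))\<^sup>2)) (at_right 0)"
    by (rule theta_form_limit[OF apos discpos], rule that, blast+)
  have "((\<lambda>n. real (card {t' \<in> triples. tnorm t' = n \<and> (idl t', idl t) \<in> ideal_class_rel R}) * exp (- s * real n)) has_sum (P s - 1) / 2) {1..}"
    if s: "s > 0" for s
  proof -
    have bb: "(x\<^sup>2 + x + offset) div int a = b" using b apos by simp
    have "(\<lambda>(n::int, m::int). exp (- s * (real a * (of_int m)\<^sup>2 + of_int (2 * x + 1) * of_int m * of_int n + of_int b * (of_int n)\<^sup>2)))
       = (\<lambda>z. exp (- s * of_int (class_form t z)))"
      by (auto simp: class_form_def tt bb)
    hence "((\<lambda>z. exp (- s * of_int (class_form t z))) has_sum P s) UNIV" using P(1)[OF s] by simp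
    hence "((\<lambda>n. real (card {z. class_form t z = int n}) * exp (- s * real n)) has_sum (P s - 1)) {1..}"
      by (rule has_sum_fibres_exp[where w = 0]) (use class_form_0_iff[OF t] card_class_norm(1)[OF t] in auto)
    from has_sum_cmult_right[OF this, of "1 / 2"]
    have "((\<lambda>n. 1 / 2 * (real (card {z. class_form t z = int n}) * exp (- s * real n))) has_sum (P s - 1) / 2) {1..}" by simp
    also have "?this \<longleftrightarrow> ?thesis"
      by (rule has_sum_cong) (use card_class_norm(2)[OF t] in auto)
    finally show ?thesis .
  qed
  moreover have "((\<lambda>s. s * ((P s - 1) / 2)) \<longlongrightarrow> pi / rk) (at_right 0)"
  proof -
    have "((\<lambda>s. (s * P s - s) / 2) \<longlongrightarrow> (2 * pi / sqrt (real_of_int k) - 0) / 2) (at_right 0)"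
      using P(2) unfolding disc by (intro tendsto_intros) simp_all
    thus ?thesis by (simp add: rk_def right_diff_distrib diff_divide_distrib)
  qed
  ultimately show ?thesis by (rule that)
qed

text \<open>Every ideal class contributes the same density \<open>pi / sqrt k\<close> to the count of ideals by norm.\<close>

lemma class_number_asymptotics:
  assumes F: "\<And>s. s > 0 \<Longrightarrow> ((\<lambda>n. real (form_count offset n) * exp (- s * real n)) has_sum F s) {1..}"
    and L: "((\<lambda>s. s * F s) \<longlongrightarrow> L) (at_right 0)"
  shows "real (quadratic_class_number (- k)) * (pi / rk) = L"
proof -
  define Cls where "Cls = nonzero_ideals R // ideal_class_rel R"
  have "\<exists>t. t \<in> triples \<and> C = ideal_class_rel R `` {idl t}" if C: "C \<in> Cls" for C
  proof -
    obtain J where J: "J \<in> nonzero_ideals R" "C = ideal_class_rel R `` {J}"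
      using C unfolding Cls_def by (rule quotientE)
    obtain t where t: "t \<in> triples" "J = idl t" using idl_surj[OF J(1)] .
    thus ?thesis using J(2) by blast
  qed
  then obtain rep where rep: "\<And>C. C \<in> Cls \<Longrightarrow> rep C \<in> triples" "\<And>C. C \<in> Cls \<Longrightarrow> C = ideal_class_rel R `` {idl (rep C)}"
    by metis
  define r where "r C n = card {t' \<in> triples. tnorm t' = n \<and> (idl t', idl (rep C)) \<in> ideal_class_rel R}" for C n
  have "\<exists>P. (\<forall>s>0. ((\<lambda>n. real (r C n) * exp (- s * real n)) has_sum P s) {1..}) \<and> ((\<lambda>s. s * P s) \<longlongrightarrow> pi / rk) (at_right 0)"
    if "C \<in> Cls" for C
    unfolding r_def by (rule class_theta[OF rep(1)[OF that]]) blast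
  then obtain P where P: "\<And>C s. C \<in> Cls \<Longrightarrow> s > 0 \<Longrightarrow> ((\<lambda>n. real (r C n) * exp (- s * real n)) has_sum P C s) {1..}"
    "\<And>C. C \<in> Cls \<Longrightarrow> ((\<lambda>s. s * P C s) \<longlongrightarrow> pi / rk) (at_right 0)" by metis
  have rmem: "{t' \<in> triples. tnorm t' = n \<and> (idl t', idl (rep C)) \<in> ideal_class_rel R} = {t' \<in> triples. tnorm t' = n \<and> idl t' \<in> C}"
    if "C \<in> Cls" for C n
    using rep(2)[OF that] equivE[OF equiv_class_rel] by (auto dest: symD)
  have disj: "C = C'" if "C \<in> Cls" "C' \<in> Cls" "I \<in> C" "I \<in> C'" for C C' I
    using quotient_disj[OF equiv_class_rel, of C C'] that by (auto simp: Cls_def)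
  have cardU: "(\<Sum>C\<in>M. r C n) = card (\<Union>C\<in>M. {t' \<in> triples. tnorm t' = n \<and> idl t' \<in> C})"
    if M: "finite M" "M \<subseteq> Cls" and n: "n > 0" for M n
  proof -
    have "card (\<Union>C\<in>M. {t' \<in> triples. tnorm t' = n \<and> idl t' \<in> C}) = (\<Sum>C\<in>M. card {t' \<in> triples. tnorm t' = n \<and> idl t' \<in> C})"
    proof (rule card_UN_disjoint[OF M(1)])
      show "\<forall>C\<in>M. finite {t' \<in> triples. tnorm t' = n \<and> idl t' \<in> C}"
        by (intro ballI finite_subset[OF _ finite_triples_norm[OF n]]) auto
      show "\<forall>C\<in>M. \<forall>C'\<in>M. C \<noteq> C' \<longrightarrow> {t' \<in> triples. tnorm t' = n \<and> idl t' \<in> C} \<inter> {t' \<in> triples. tnorm t' = n \<and> idl t' \<in> C'} = {}"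
        using disj M(2) by blast
    qed
    also have "\<dots> = (\<Sum>C\<in>M. r C n)" unfolding r_def by (intro sum.cong refl) (use rmem M(2) in auto)
    finally show ?thesis by simp
  qed
  have sumP: "((\<lambda>n. real (\<Sum>C\<in>M. r C n) * exp (- s * real n)) has_sum (\<Sum>C\<in>M. P C s)) {1..}"
    if M: "finite M" "M \<subseteq> Cls" and s: "s > 0" for M s
  proof -
    have "((\<lambda>n. \<Sum>C\<in>M. real (r C n) * exp (- s * real n)) has_sum (\<Sum>C\<in>M. P C s)) {1..}"
      using M
    proof (induction M rule: finite_induct)
      case (insert C M)
      have "((\<lambda>n. real (r C n) * exp (- s * real n) + (\<Sum>C\<in>M. real (r C n) * exp (- s * real n))) has_sum (P C s + (\<Sum>C\<in>M. P C s))) {1..}"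
        by (rule has_sum_add) (use insert P(1) s in auto)
      thus ?case using insert by simp
    qed simp
    thus ?thesis by (simp add: sum_distrib_right)
  qed
  have limP: "((\<lambda>s. s * (\<Sum>C\<in>M. P C s)) \<longlongrightarrow> real (card M) * (pi / rk)) (at_right 0)"
    if M: "M \<subseteq> Cls" for M
  proof -
    have "((\<lambda>s. \<Sum>C\<in>M. s * P C s) \<longlongrightarrow> (\<Sum>C\<in>M. pi / rk)) (at_right 0)"
      by (rule tendsto_sum) (use P(2) M in auto)
    thus ?thesis by (simp add: sum_distrib_left)
  qed
  \<comment> \<open>Any finite set of classes accounts for part of a count with nonnegative terms.
    As each class contributes the same positive limit, the number of classes is bounded.\<close>
  have le: "real (card M) * (pi / rk) \<le> L" if M: "finite M" "M \<subseteq> Cls" for M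
  proof (rule tendsto_le[OF _ L limP[OF M(2)]])
    have "s * (\<Sum>C\<in>M. P C s) \<le> s * F s" if s: "s > 0" for s
    proof (rule mult_left_mono[OF has_sum_mono[OF sumP[OF M s] F[OF s]]])
      fix n :: nat assume "n \<in> {1..}"
      hence n: "n > 0" by simp
      have "(\<Sum>C\<in>M. r C n) \<le> card {t' \<in> triples. tnorm t' = n}"
        unfolding cardU[OF M n] by (rule card_mono[OF finite_triples_norm[OF n]]) auto
      hence "(\<Sum>C\<in>M. r C n) \<le> form_count offset n" using card_triples_norm[OF n] by simp
      thus "real (\<Sum>C\<in>M. r C n) * exp (- s * real n) \<le> real (form_count offset n) * exp (- s * real n)"
        by (intro mult_right_mono) (simp_all only: of_nat_le_iff exp_ge_zero)
    qed (use s in simp)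
    thus "\<forall>\<^sub>F s in at_right 0. s * (\<Sum>C\<in>M. P C s) \<le> s * F s"
      using eventually_at_right_less[of "0::real"] by (auto elim: eventually_mono)
  qed simp
  have fin: "finite Cls"
  proof (rule ccontr)
    assume inf: "infinite Cls"
    obtain N where N: "L / (pi / rk) < real N" using reals_Archimedean2 by blast
    obtain M where M: "M \<subseteq> Cls" "finite M" "card M = N" using infinite_arbitrarily_large[OF inf, of N] by blast
    have "pi / rk > 0" using rk by simp
    hence "L < real N * (pi / rk)" using N by (simp only: pos_divide_less_eq)
    thus False using le[OF M(2,1)] M(3) by simp
  qed
  have "s * (\<Sum>C\<in>Cls. P C s) = s * F s" if s: "s > 0" for s
  proof -
    have "((\<lambda>n. real (\<Sum>C\<in>Cls. r C n) * exp (- s * real n)) has_sum F s) {1..} \<longleftrightarrow>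
        ((\<lambda>n. real (form_count offset n) * exp (- s * real n)) has_sum F s) {1..}"
    proof (rule has_sum_cong)
      fix n :: nat assume "n \<in> {1..}"
      hence n: "n > 0" by simp
      have "idl t' \<in> ideal_class_rel R `` {idl t'} \<and> ideal_class_rel R `` {idl t'} \<in> Cls" if "t' \<in> triples" for t'
        using idl_ideal[OF that] equiv_class_self[OF equiv_class_rel] by (auto simp: Cls_def quotientI)
      hence "(\<Union>C\<in>Cls. {t' \<in> triples. tnorm t' = n \<and> idl t' \<in> C}) = {t' \<in> triples. tnorm t' = n}" by blast
      hence "(\<Sum>C\<in>Cls. r C n) = form_count offset n"
        using cardU[OF fin subset_refl n] card_triples_norm[OF n] by simp
      thus "real (\<Sum>C\<in>Cls. r C n) * exp (- s * real n) = real (form_count offset n) * exp (- s * real n)" by (simp only:)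
    qed
    hence "((\<lambda>n. real (\<Sum>C\<in>Cls. r C n) * exp (- s * real n)) has_sum F s) {1..}" using F[OF s] by blast
    thus ?thesis using has_sum_unique[OF sumP[OF fin subset_refl s]] by simp
  qed
  hence "\<forall>\<^sub>F s in at_right 0. s * (\<Sum>C\<in>Cls. P C s) = s * F s"
    using eventually_at_right_less[of "0::real"] by (auto elim: eventually_mono)
  with limP[OF subset_refl] have "((\<lambda>s. s * F s) \<longlongrightarrow> real (card Cls) * (pi / rk)) (at_right 0)"
    by (rule Lim_transform_eventually)
  from tendsto_unique[OF _ this L] show ?thesis
    by (simp add: quadratic_class_number_def class_number_def Cls_def)
qed

end

section \<open>From the class number to the trigonometric sum\<close>

context odd_real_primitive_character
begin

lemma jacobi_mod: "jacobi k (n mod k) = jacobi k n"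
proof -
  have "complex_of_int (jacobi k (n mod k)) = of_int (jacobi k n)"
    using cong_eq[of "n mod k" n] by (simp add: eq_jacobi cong_def)
  thus ?thesis by (simp only: of_int_eq_iff)
qed

lemma jacobi_uminus: "jacobi k (- n) = - jacobi k n"
proof -
  have "complex_of_int (jacobi k (- n)) = of_int (- jacobi k n)"
    using odd by (simp add: odd_character_def eq_jacobi)
  thus ?thesis by (simp only: of_int_eq_iff)
qed

lemma jacobi_zero: "k > 1 \<Longrightarrow> jacobi k 0 = 0"
  by (simp add: jacobi_eq_0_iff)

text \<open>\<open>form_count_eq\<close> identifies the coefficients of the Lambert series with the
  ideal counts, so the limit from \<open>lambert_limit\<close> is the L of
  \<open>class_number_asymptotics\<close>.\<close>

lemma sum_jacobi_cot:
  assumes k7: "k \<ge> 7"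
  shows "(\<Sum>j\<in>{0..<k}. of_int (jacobi k j) * cot (pi * real_of_int j / real_of_int k))
    = 2 * sqrt (of_int k) * real (quadratic_class_number (- k))"
proof -
  interpret Q: imaginary_quadratic k
    by unfold_locales (use k7 k_mod_4 squarefree in auto)
  define X where "X n = real_of_int (jacobi k (int n))" for n :: nat
  define K where "K = nat k"
  have K: "int K = k" "K > 0" using k7 by (auto simp: K_def)
  have X1: "\<bar>X n\<bar> \<le> 1" for n using jacobi_values[of "int n"] by (auto simp: X_def)
  have "\<exists>S. ((\<lambda>n. (\<Sum>d | d dvd n. X d) * exp (- s * real n)) has_sum S) {1..}" if s: "s > 0" for s
    by (rule lambert_series[where X = X, OF X1 s]) blast
  then obtain F where F: "\<And>s. s > 0 \<Longrightarrow> ((\<lambda>n. (\<Sum>d | d dvd n. X d) * exp (- s * real n)) has_sum F s) {1..}"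
    by metis
  have lim: "((\<lambda>s. s * F s) \<longlongrightarrow> pi / (2 * real K) * (\<Sum>j=1..<K. X j * cot (pi * real j / real K))) (at_right 0)"
  proof (rule lambert_limit[where X = X and k = K, OF K(2) _ X1 _ _ F])
    show "X (n + K) = X n" for n
      using jacobi_mod[of "int n + k"] jacobi_mod[of "int n"] by (simp add: X_def K)
    show "X 0 = 0" using jacobi_zero k7 by (simp add: X_def)
    show "X (K - j) = - X j" if "0 < j" "j < K" for j
    proof -
      have "int (K - j) mod k = (- int j) mod k" using that K by (simp add: of_nat_diff mod_diff_left_eq[symmetric])
      hence "jacobi k (int (K - j)) = jacobi k (- int j)" using jacobi_mod by metis
      thus ?thesis by (simp add: X_def jacobi_uminus)
    qed
  qed
  have "((\<lambda>n. real (form_count Q.offset n) * exp (- s * real n)) has_sum F s) {1..}" if s: "s > 0" for s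
  proof -
    have "((\<lambda>n. real (form_count Q.offset n) * exp (- s * real n)) has_sum F s) {1..} \<longleftrightarrow>
        ((\<lambda>n. (\<Sum>d | d dvd n. X d) * exp (- s * real n)) has_sum F s) {1..}"
    proof (rule has_sum_cong)
      fix n :: nat assume "n \<in> {1..}"
      hence "n > 0" by simp
      have "root_offset = Q.offset" by (simp add: root_offset_def Q.offset_def)
      hence "real_of_int (int (form_count Q.offset n)) = real_of_int (\<Sum>d | d dvd n. jacobi k (int d))"
        using form_count_eq[OF \<open>n > 0\<close>] by simp
      thus "real (form_count Q.offset n) * exp (- s * real n) = (\<Sum>d | d dvd n. X d) * exp (- s * real n)"
        by (simp add: X_def)
    qed
    thus ?thesis using F[OF s] by blast
  qed
  from Q.class_number_asymptotics[OF this lim]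
  have h: "real (quadratic_class_number (- k)) * (pi / sqrt (of_int k)) = pi / (2 * real K) * (\<Sum>j=1..<K. X j * cot (pi * real j / real K))"
    by (simp add: Q.rk_def)
  have Kk: "real K = real_of_int k" using K(1) by (metis of_int_of_nat_eq)
  have ss: "sqrt (real_of_int k) > 0" "sqrt (real_of_int k) * sqrt (real_of_int k) = real_of_int k" using k7 by auto
  define S where "S = (\<Sum>j=1..<K. X j * cot (pi * real j / real K))"
  have "2 * sqrt (of_int k) * real (quadratic_class_number (- k))
      = (real (quadratic_class_number (- k)) * (pi / sqrt (of_int k))) * (2 * (sqrt (real_of_int k) * sqrt (real_of_int k)) / pi)"
    using ss by (simp add: field_simps)
  also have "\<dots> = S" unfolding h ss(2) Kk S_def[symmetric, unfolded Kk] using k7 by (simp add: field_simps S_def Kk)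
  also have "S = (\<Sum>j\<in>{1..<k}. of_int (jacobi k j) * cot (pi * real_of_int j / real_of_int k))"
    unfolding S_def X_def Kk
    by (rule sum.reindex_bij_witness[of _ nat int]) (use K in auto)
  also have "\<dots> = (\<Sum>j\<in>{0..<k}. of_int (jacobi k j) * cot (pi * real_of_int j / real_of_int k))"
  proof (rule sum.mono_neutral_left)
    have "{0..<k} - {1..<k} = {0}" using k7 by auto
    thus "\<forall>j\<in>{0..<k} - {1..<k}. of_int (jacobi k j) * cot (pi * real_of_int j / real_of_int k) = 0"
      using k7 jacobi_zero by simp
  qed auto
  finally show ?thesis by simp
qed

text \<open>Substituting a j for j modulo k brings out the sign \<open>jacobi k a\<close>, which is
  its own inverse and so may change sides.\<close>

lemma sum_jacobi_cot_mult:
  assumes a: "coprime a k"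
  shows "(\<Sum>j\<in>{0..<k}. of_int (jacobi k j) * cot (pi * real_of_int (a * j) / real_of_int k))
    = of_int (jacobi k a) * (\<Sum>j\<in>{0..<k}. of_int (jacobi k j) * cot (pi * real_of_int j / real_of_int k))"
proof -
  define F where "F n = real_of_int (jacobi k n) * cot (pi * real_of_int n / real_of_int k)" for n
  have per: "F (n mod k) = F n" for n
    unfolding F_def cot_eq_ee jacobi_mod using k_pos by (simp add: ee_mod)
  have "jacobi k a * jacobi k a = 1" using jacobi_values[of a] jacobi_eq_0_iff[of a] a by auto
  hence sq: "real_of_int (jacobi k a) * real_of_int (jacobi k a) = 1" by (metis of_int_1 of_int_mult)
  have "sum F {0..<k} = (\<Sum>j\<in>{0..<k}. F (a * j))"
    by (rule sum_residues_mult[where F = F, symmetric, OF k_pos per a])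
  also have "\<dots> = of_int (jacobi k a) * (\<Sum>j\<in>{0..<k}. of_int (jacobi k j) * cot (pi * real_of_int (a * j) / real_of_int k))"
    by (simp add: F_def jacobi_mult sum_distrib_left mult.assoc)
  finally have e: "sum F {0..<k} = of_int (jacobi k a) * (\<Sum>j\<in>{0..<k}. of_int (jacobi k j) * cot (pi * real_of_int (a * j) / real_of_int k))" .
  have "of_int (jacobi k a) * sum F {0..<k} = (\<Sum>j\<in>{0..<k}. of_int (jacobi k j) * cot (pi * real_of_int (a * j) / real_of_int k))"
    unfolding e mult.assoc[symmetric] sq by simp
  thus ?thesis by (simp add: F_def)
qed

text \<open>With sin^2 (\<theta> / 2) = (1 - cos \<theta>) / 2 the product becomes (tan \<theta> -
  sin \<theta>) / 2, and tan \<theta> = cot \<theta> - 2 cot (2 \<theta>) yields cotangents at 2j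
  and 4j.\<close>

lemma sin_sq_tan_eq:
  assumes j: "0 < j" "j < k"
  defines "\<theta> \<equiv> 2 * pi * real_of_int j / real_of_int k"
  shows "(sin (pi * real_of_int j / real_of_int k))\<^sup>2 * tan \<theta>
    = (cot (pi * real_of_int (2 * j) / real_of_int k) - 2 * cot (pi * real_of_int (4 * j) / real_of_int k) - sin \<theta>) / 2"
proof -
  have k0: "k \<noteq> 0" using k_pos by simp
  have nd: "\<not> k dvd j" using j zdvd_not_zless by blast
  have c2: "coprime k 2" "coprime k 4" using k_odd coprime_power_right_iff[of k 2 2] by auto
  have nd2: "\<not> k dvd 2 * j" "\<not> k dvd 4 * j" using nd c2 by (simp_all add: coprime_dvd_mult_right_iff)
  \<comment> \<open>A zero would make 4 \<theta> a multiple of 2 pi, hence k a divisor of 4 j,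
    impossible for odd k and 0 < j < k.\<close>
  have s4: "sin (2 * \<theta>) \<noteq> 0"
  proof
    assume "sin (2 * \<theta>) = 0"
    hence "(cos (2 * \<theta>))\<^sup>2 = 1" using sin_cos_squared_add[of "2 * \<theta>"] by simp
    hence "cos (2 * (2 * \<theta>)) = 1" using cos_double_cos[of "2 * \<theta>"] by simp
    moreover have "sin (2 * (2 * \<theta>)) = 0" using sin_double[of "2 * \<theta>"] \<open>sin (2 * \<theta>) = 0\<close> by simp
    ultimately have "cis (2 * (2 * \<theta>)) = 1" by (simp add: complex_eq_iff)
    hence "ee k (4 * j) = 1" by (simp add: ee_def \<theta>_def mult.assoc[symmetric])
    thus False using ee_eq_1_iff[OF k0] nd2 by simp
  qed
  hence sc: "sin \<theta> \<noteq> 0" "cos \<theta> \<noteq> 0" unfolding sin_double by auto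
  have half: "pi * real_of_int j / real_of_int k = \<theta> / 2" by (simp add: \<theta>_def)
  have a2: "pi * real_of_int (2 * j) / real_of_int k = \<theta>" "pi * real_of_int (4 * j) / real_of_int k = 2 * \<theta>"
    by (simp_all add: \<theta>_def)
  have half_sq: "(sin (\<theta> / 2))\<^sup>2 = (1 - cos \<theta>) / 2" using cos_double_sin[of "\<theta> / 2"] by simp
  have "(sin (\<theta> / 2))\<^sup>2 * tan \<theta> = (tan \<theta> - sin \<theta>) / 2"
    unfolding half_sq using sc by (simp add: tan_def field_simps)
  moreover have "tan \<theta> = cot \<theta> - 2 * cot (2 * \<theta>)"
  proof -
    have "2 * cot (2 * \<theta>) = ((cos \<theta>)\<^sup>2 - (sin \<theta>)\<^sup>2) / (sin \<theta> * cos \<theta>)"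
      unfolding cot_def sin_double cos_double using sc by (simp add: divide_simps) (simp add: algebra_simps)?
    thus ?thesis using sc by (simp add: tan_def cot_def field_simps power2_eq_square)
  qed
  ultimately show ?thesis unfolding half a2 by simp
qed

lemma sum_chi_sin_sq_tan:
  assumes k7: "k \<ge> 7"
  shows "(\<Sum>j = 1..k - 1. \<chi> j * of_real ((sin (pi * real_of_int j / real_of_int k))\<^sup>2 * tan (2 * pi * real_of_int j / real_of_int k)))
    = of_real (sqrt (real_of_int k)) * (- 1 / 2 + (\<chi> 2 - 2) * of_nat (quadratic_class_number (- k)))"
proof -
  define J where "J j = real_of_int (jacobi k j)" for j
  define h where "h = real (quadratic_class_number (- k))"
  define C where "C = (\<Sum>j\<in>{0..<k}. J j * cot (pi * real_of_int j / real_of_int k))"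
  have C: "C = 2 * sqrt (of_int k) * h" unfolding C_def J_def h_def by (rule sum_jacobi_cot[OF k7])
  have cop: "coprime 2 k" "coprime 4 k" using k_odd coprime_power_left_iff[of 2 2 k] by auto
  \<comment> \<open>As \<chi>(4) = \<chi>(2)^2 = 1, the cotangent sum at 4j is C itself, while the
    one at 2j acquires the factor \<chi>(2).\<close>
  have "jacobi k 4 = jacobi k 2 * jacobi k 2" using jacobi_mult[of 2 2] by simp
  hence j4: "jacobi k 4 = 1" using jacobi_values[of 2] jacobi_eq_0_iff[of 2] cop by auto
  have "complex_of_real (\<Sum>j\<in>{0..<k}. J j * sin (2 * pi * of_int j / of_int k)) = of_real (sqrt (of_int k))"
    using sum_chi_sin[OF k7] by (simp add: J_def eq_jacobi)
  hence sins: "(\<Sum>j\<in>{0..<k}. J j * sin (2 * pi * of_int j / of_int k)) = sqrt (of_int k)" by (simp only: of_real_eq_iff)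
  have cots: "(\<Sum>j\<in>{0..<k}. J j * cot (pi * real_of_int (2 * j) / real_of_int k)) = J 2 * C"
    "(\<Sum>j\<in>{0..<k}. J j * cot (pi * real_of_int (4 * j) / real_of_int k)) = C"
    using sum_jacobi_cot_mult[OF cop(1)] sum_jacobi_cot_mult[OF cop(2)] j4 unfolding J_def C_def by simp_all
  define g where "g j = (cot (pi * real_of_int (2 * j) / real_of_int k) - 2 * cot (pi * real_of_int (4 * j) / real_of_int k)
      - sin (2 * pi * real_of_int j / real_of_int k)) / 2" for j
  have "(\<Sum>j = 1..k - 1. J j * ((sin (pi * real_of_int j / real_of_int k))\<^sup>2 * tan (2 * pi * real_of_int j / real_of_int k)))
      = (\<Sum>j = 1..k - 1. J j * g j)"
  proof (rule sum.cong[OF refl])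
    fix j assume "j \<in> {1..k - 1}"
    hence "0 < j" "j < k" by auto
    from sin_sq_tan_eq[OF this]
    show "J j * ((sin (pi * real_of_int j / real_of_int k))\<^sup>2 * tan (2 * pi * real_of_int j / real_of_int k)) = J j * g j"
      unfolding g_def by (rule arg_cong)
  qed
  also have "\<dots> = (\<Sum>j\<in>{0..<k}. J j * g j)"
  proof (rule sum.mono_neutral_left)
    have "{0..<k} - {1..k - 1} = {0}" using k7 by auto
    thus "\<forall>j\<in>{0..<k} - {1..k - 1}. J j * g j = 0" using k7 jacobi_zero by (simp add: J_def)
  qed auto
  also have "\<dots> = (J 2 * C - 2 * C - sqrt (of_int k)) / 2"
  proof -
    have "J j * g j = (J j * cot (pi * real_of_int (2 * j) / real_of_int k) - 2 * (J j * cot (pi * real_of_int (4 * j) / real_of_int k))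
        - J j * sin (2 * pi * real_of_int j / real_of_int k)) / 2" for j
      unfolding g_def by (simp only: times_divide_eq_right right_diff_distrib mult.left_commute[of 2])
    thus ?thesis
      by (simp only: sum_divide_distrib[symmetric] sum_subtractf sum_distrib_left[symmetric] cots sins)
  qed
  also have "\<dots> = sqrt (of_int k) * (- 1 / 2 + (J 2 - 2) * h)"
    unfolding C by (simp add: field_simps)
  finally have "complex_of_real (\<Sum>j = 1..k - 1. J j * ((sin (pi * real_of_int j / real_of_int k))\<^sup>2 * tan (2 * pi * real_of_int j / real_of_int k)))
      = of_real (sqrt (of_int k) * (- 1 / 2 + (J 2 - 2) * h))" by (rule arg_cong)
  moreover have "complex_of_real (J 2) = \<chi> 2" "complex_of_real h = of_nat (quadratic_class_number (- k))"
    by (simp_all add: J_def eq_jacobi h_def)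
  ultimately show ?thesis by (simp add: J_def eq_jacobi)
qed

end

theorem theorem4p13:
  fixes k :: int and \<chi> :: "int \<Rightarrow> complex"
  assumes "k \<ge> 7" and "odd k"
    and "dirichlet_character k \<chi>"
    and "\<not> principal_character k \<chi>"
    and "real_character \<chi>"
    and "primitive_character k \<chi>"
    and "odd_character \<chi>"
  shows "(\<Sum>j = 1..k - 1.
            \<chi> j * of_real ((sin (pi * real_of_int j / real_of_int k))\<^sup>2
                          * tan (2 * pi * real_of_int j / real_of_int k)))
         = of_real (sqrt (real_of_int k)) * (- 1 / 2 + (\<chi> 2 - 2) * of_nat (quadratic_class_number (- k)))
       \<and> ((k mod 8 = 3 \<and>
            of_real (sqrt (real_of_int k)) * (- 1 / 2 + (\<chi> 2 - 2) * of_nat (quadratic_class_number (- k)))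
            = of_real (sqrt (real_of_int k)) * (- 1 / 2 - 3 * of_nat (quadratic_class_number (- k))))
        \<or> (k mod 8 = 7 \<and>
            of_real (sqrt (real_of_int k)) * (- 1 / 2 + (\<chi> 2 - 2) * of_nat (quadratic_class_number (- k)))
            = of_real (sqrt (real_of_int k)) * (- 1 / 2 - of_nat (quadratic_class_number (- k)))))"
proof -
  interpret odd_real_primitive_character k \<chi>
    by unfold_locales (use assms in auto)
  have "k mod 8 = 3 \<or> k mod 8 = 7" using k_mod_4 by presburger
  moreover have "(\<chi> 2 - 2) * z = - 3 * z" if "k mod 8 = 3" for z using two that by simp
  moreover have "(\<chi> 2 - 2) * z = - z" if "k mod 8 = 7" for z using two that by simp
  ultimately show ?thesis using sum_chi_sin_sq_tan[OF assms(1)] by auto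
qed

end
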